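(* Let $M_\pi=\Gamma_\pi\backslash G$ be the $4$-dimensional holomorphically parallelizable solvmanifold described in the context. The Kuranishi space of $M_\pi$ is, near the origin, the set of those $t=(t_{i\lambda})_{1\le i\le4,\,1\le\lambda\le3}\in\mathbb{C}^{12}$ satisfying $$\begin{aligned}&t_{11}t_{12}=t_{11}t_{13}=t_{12}t_{21}=t_{21}t_{13}-2t_{11}t_{23}=2t_{11}t_{32}-t_{31}t_{12}=t_{13}t_{31}=t_{12}t_{13}=t_{12}t_{23}=t_{13}t_{32}\\&=t_{11}t_{42}+t_{21}t_{32}-t_{31}t_{22}=t_{21}t_{33}-t_{11}t_{43}-t_{31}t_{23}=0,\end{aligned}$$ and the corresponding deformations of $M_\pi$ are given by $$\psi(t)=\sum_{\lambda=1}^3\sum_{i=1}^4t_{i\lambda}\,\widetilde\varphi^{\overline\lambda}\otimes Z_i+(-t_{22}t_{33}+t_{12}t_{43}+t_{13}t_{42}+t_{23}t_{32})\,\varphi^{\overline4}\otimes Z_4 .$$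
   Context: The manifold: $G=(\mathbb{C}^4,* )$ is the solvable complex Lie group with $$(y_1,y_2,y_3,y_4)*(z_1,z_2,z_3,z_4)=\left(z_1+y_1,\ e^{-y_1}z_2+y_2,\ e^{y_1}z_3+y_3,\ z_4+y_4+\tfrac12e^{y_1}y_2z_3-\tfrac12e^{-y_1}y_3z_2\right),$$ and $\Gamma_\pi\subset G$ is a lattice (acting by left multiplication) such that $e^{y_1-\overline{y}_1}=1$ for every $(y_1,y_2,y_3,y_4)\in\Gamma_\pi$. Set $M_\pi=\Gamma_\pi\backslash G$. A left-invariant holomorphic $(1,0)$-coframe is $$\varphi^1=dz_1,\quad\varphi^2=e^{z_1}dz_2,\quad\varphi^3=e^{-z_1}dz_3,\quad\varphi^4=dz_4-\tfrac12z_2dz_3+\tfrac12z_3dz_2,$$ with $d\varphi^1=0$, $d\varphi^2=\varphi^1\wedge\varphi^2$, $d\varphi^3=-\varphi^1\wedge\varphi^3$, $d\varphi^4=-\varphi^2\wedge\varphi^3$; its dual frame is $\{Z_1,Z_2,Z_3,Z_4\}$, and $\varphi^{\overline j}=\overline{\varphi^j}$. Put $$\widetilde\varphi^{\overline1}=\varphi^{\overline1},\qquad\widetilde\varphi^{\overline2}=e^{z_1-\overline z_1}\varphi^{\overline2},\qquad\widetilde\varphi^{\overline3}=e^{\overline z_1-z_1}\varphi^{\overline3};$$ these are well defined on $M_\pi$ and their classes generate $H^{0,1}_{\overline\partial}(M_\pi)$. Kuranishi space: $M_\pi$ is endowed with the Hermitian metric for which the coframe $\{\varphi^1,\dots,\varphi^4\}$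 is unitary. The elements $\widetilde\varphi^{\overline\lambda}\otimes Z_i$ ($1\le\lambda\le3$, $1\le i\le4$) form a basis of the harmonic space representing $H^{1}(M_\pi,T^{1,0}M_\pi)$. Deformations are described by power series $\psi(t)=\sum_{k\ge1}\psi_k(t)\in\mathcal{A}^{0,1}(T^{1,0}M_\pi)$ with $\psi_k$ homogeneous of degree $k$ in $t$, $\psi_1(t)=\sum_{\lambda,i}t_{i\lambda}\widetilde\varphi^{\overline\lambda}\otimes Z_i$, and satisfying the Maurer–Cartan equation $\overline\partial\psi-\frac12[\psi,\psi]=0$; the Kuranishi space is the set (germ at $0$) of parameters $t$ for which the standard Kuranishi power series with first term $\psi_1(t)$ solves this equation. The deformed complex structure is the one whose $(1,0)$-forms are spanned by $\varphi^i+\psi^i$, where $\psi=\sum_i\psi^i\otimes Z_i$. *)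

theory Defs
  imports "HOL-Analysis.Analysis" "HOL-Algebra.Group"
begin

definition gmul :: "complex^4 \<Rightarrow> complex^4 \<Rightarrow> complex^4" where
  "gmul y z = vector
     [z$1 + y$1,
      exp (- (y$1)) * z$2 + y$2,
      exp (y$1) * z$3 + y$3,
      z$4 + y$4 + 1/2 * exp (y$1) * y$2 * z$3 - 1/2 * exp (- (y$1)) * y$3 * z$2]"

definition solv_group :: "(complex^4) monoid" where
  "solv_group = \<lparr>carrier = UNIV, mult = gmul, one = 0\<rparr>"

definition cocompact_lattice :: "(complex^4) set \<Rightarrow> bool" where
  "cocompact_lattice \<Gamma> \<longleftrightarrow> subgroup \<Gamma> solv_group \<and> discrete \<Gamma> \<and>
     (\<exists>K. compact K \<and> (\<Union>y\<in>\<Gamma>. gmul y ` K) = UNIV)"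

text \<open>The tangent space of the group at any point is identified with \<open>complex^4\<close> by the
  coordinates; this is also the identification of the real tangent space with the (1,0) tangent
  space. So \<open>coframe i z\<close> is a complex linear form, \<open>cnj (coframe i z v)\<close> is the conjugate
  (0,1)-form, and \<open>frame i z\<close> is a (1,0) vector.\<close>

definition coframe :: "4 \<Rightarrow> complex^4 \<Rightarrow> complex^4 \<Rightarrow> complex" where
  "coframe i z v = vector
     [v$1,
      exp (z$1) * v$2,
      exp (- (z$1)) * v$3,
      v$4 - 1/2 * z$2 * v$3 + 1/2 * z$3 * v$2] $ i"

definition frame :: "4 \<Rightarrow> complex^4 \<Rightarrow> complex^4" where
  "frame i z = vector
     [vector [1, 0, 0, 0],
      vector [0, exp (- (z$1)), 0, - (1/2) * exp (- (z$1)) * z$3],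
      vector [0, 0, exp (z$1), 1/2 * exp (z$1) * z$2],
      vector [0, 0, 0, 1]] $ i"

lemma vector_nth_4 [simp]:
  "(vector [a, b, c, d] :: 'a::zero^4) $ 1 = a"
  "(vector [a, b, c, d] :: 'a::zero^4) $ 2 = b"
  "(vector [a, b, c, d] :: 'a::zero^4) $ 3 = c"
  "(vector [a, b, c, d] :: 'a::zero^4) $ 4 = d"
  by (simp_all add: vector_def)

lemma group_solv_group: "group solv_group"
proof (rule groupI)
  fix x y z
  show "x \<otimes>\<^bsub>solv_group\<^esub> y \<otimes>\<^bsub>solv_group\<^esub> z = x \<otimes>\<^bsub>solv_group\<^esub> (y \<otimes>\<^bsub>solv_group\<^esub> z)"
    by (simp add: solv_group_def gmul_def vec_eq_iff forall_4 algebra_simps exp_add exp_diff exp_minus field_simps)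
next
  fix x
  have "gmul (vector [- (x$1), - exp (x$1) * x$2, - exp (- (x$1)) * x$3, - (x$4)]) x = 0"
    by (simp add: gmul_def vec_eq_iff forall_4 algebra_simps exp_add exp_diff exp_minus field_simps)
  then show "\<exists>y\<in>carrier solv_group. y \<otimes>\<^bsub>solv_group\<^esub> x = \<one>\<^bsub>solv_group\<^esub>"
    by (auto simp: solv_group_def)
qed (auto simp: solv_group_def gmul_def vec_eq_iff forall_4)

lemma coframe_frame: "coframe i z (frame j z) = (if i = j then 1 else 0)"
proof -
  have "\<forall>i j. coframe i z (frame j z) = (if i = j then 1 else 0)"
    by (simp add: forall_4 coframe_def frame_def algebra_simps exp_minus)
  then show ?thesis by blast
qed

primrec Ck :: "nat \<Rightarrow> ('a::euclidean_space \<Rightarrow> 'b::real_normed_vector) \<Rightarrow> bool" where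
  "Ck 0 f \<longleftrightarrow> continuous_on UNIV f"
| "Ck (Suc k) f \<longleftrightarrow> f differentiable_on UNIV \<and> (\<forall>v. Ck k (\<lambda>z. frechet_derivative f (at z) v))"

definition smooth :: "('a::euclidean_space \<Rightarrow> 'b::real_normed_vector) \<Rightarrow> bool" where
  "smooth f \<longleftrightarrow> (\<forall>k. Ck k f)"

text \<open>A (0,q)-form with values in the holomorphic tangent bundle takes a point and a list of
  \<open>q\<close> tangent vectors; it is alternating and conjugate linear in every slot, and is extended by
  zero to lists of other lengths. The forms on the quotient by \<open>\<Gamma>\<close> are the forms on the group
  that are invariant under left translations by \<open>\<Gamma>\<close>.\<close>

type_synonym vform = "complex^4 \<Rightarrow> (complex^4) list \<Rightarrow> complex^4"

definition vforms :: "(complex^4) set \<Rightarrow> nat \<Rightarrow> vform set" where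
  "vforms \<Gamma> q = {\<omega>.
     (\<forall>z vs. length vs \<noteq> q \<longrightarrow> \<omega> z vs = 0) \<and>
     (\<forall>z us ws a v w.
        \<omega> z (us @ (a *s v + w) # ws) = cnj a *s \<omega> z (us @ v # ws) + \<omega> z (us @ w # ws)) \<and>
     (\<forall>z vs. \<not> distinct vs \<longrightarrow> \<omega> z vs = 0) \<and>
     (\<forall>vs. smooth (\<lambda>z. \<omega> z vs)) \<and>
     (\<forall>y\<in>\<Gamma>. \<forall>z vs. \<omega> (gmul y z) (map (frechet_derivative (gmul y) (at z)) vs)
                     = frechet_derivative (gmul y) (at z) (\<omega> z vs))}"

text \<open>The derivative of \<open>f\<close> along the (1,0) part, respectively the (0,1) part, of the real
  tangent vector \<open>v\<close>.\<close>

definition D10 :: "(complex^4 \<Rightarrow> complex^4) \<Rightarrow> complex^4 \<Rightarrow> complex^4 \<Rightarrow> complex^4" where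
  "D10 f z v = (1/2) *\<^sub>R
     (frechet_derivative f (at z) v - \<i> *s frechet_derivative f (at z) (\<i> *s v))"

definition D01 :: "(complex^4 \<Rightarrow> complex^4) \<Rightarrow> complex^4 \<Rightarrow> complex^4 \<Rightarrow> complex^4" where
  "D01 f z v = (1/2) *\<^sub>R
     (frechet_derivative f (at z) v + \<i> *s frechet_derivative f (at z) (\<i> *s v))"

definition dbar :: "vform \<Rightarrow> vform" where
  "dbar \<omega> z vs =
     (\<Sum>i<length vs. (-1)^i *\<^sub>R D01 (\<lambda>x. \<omega> x (take i vs @ drop (Suc i) vs)) z (vs ! i))"

text \<open>In coordinates
  \<open>[\<psi>,\<eta>] = \<Sum>i j. (\<psi>^i \<and> \<partial>_i \<eta>^j + \<eta>^i \<and> \<partial>_i \<psi>^j) \<otimes> \<partial>_j\<close> for (0,1)-forms, with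
  \<open>(\<alpha> \<and> \<beta>)(v,w) = \<alpha>(v) \<beta>(w) - \<alpha>(w) \<beta>(v)\<close>.\<close>

definition bracket :: "vform \<Rightarrow> vform \<Rightarrow> vform" where
  "bracket \<psi> \<eta> z vs = (case vs of
       [v, w] \<Rightarrow>
           D10 (\<lambda>x. \<eta> x [w]) z (\<psi> z [v]) - D10 (\<lambda>x. \<eta> x [v]) z (\<psi> z [w])
         + D10 (\<lambda>x. \<psi> x [w]) z (\<eta> z [v]) - D10 (\<lambda>x. \<psi> x [v]) z (\<eta> z [w])
     | _ \<Rightarrow> 0)"

text \<open>The pointwise product of the metric for which the coframe is unitary, summed over all
  index lists and not only the increasing ones.\<close>

definition form_inner :: "nat \<Rightarrow> complex^4 \<Rightarrow> vform \<Rightarrow> vform \<Rightarrow> complex" where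
  "form_inner q z \<alpha> \<beta> = (1 / fact q) *
     (\<Sum>js | length js = q. \<Sum>i\<in>UNIV.
        coframe i z (\<alpha> z (map (\<lambda>j. frame j z) js)) *
        cnj (coframe i z (\<beta> z (map (\<lambda>j. frame j z) js))))"

definition fundamental_domain :: "(complex^4) set \<Rightarrow> (complex^4) set \<Rightarrow> bool" where
  "fundamental_domain \<Gamma> F \<longleftrightarrow>
     F \<in> sets borel \<and> bounded F \<and> (\<forall>z. \<exists>!y. y \<in> \<Gamma> \<and> gmul y z \<in> F)"

text \<open>Lebesgue measure is a constant multiple of the Riemannian volume, because the coframe has
  determinant one in the coordinates. The integral of a \<open>\<Gamma>\<close>-invariant function over a fundamental
  domain does not depend on the chosen domain.\<close>

definition l2_inner :: "(complex^4) set \<Rightarrow> nat \<Rightarrow> vform \<Rightarrow> vform \<Rightarrow> complex" where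
  "l2_inner \<Gamma> q \<alpha> \<beta> =
     set_lebesgue_integral lborel (SOME F. fundamental_domain \<Gamma> F) (\<lambda>z. form_inner q z \<alpha> \<beta>)"

text \<open>The index \<open>q\<close> of the operators below is the degree of their argument.\<close>

definition dbar_star :: "(complex^4) set \<Rightarrow> nat \<Rightarrow> vform \<Rightarrow> vform" where
  "dbar_star \<Gamma> q \<beta> =
     (if q = 0 then (\<lambda>z vs. 0)
      else (THE \<alpha>. \<alpha> \<in> vforms \<Gamma> (q - 1) \<and>
              (\<forall>\<gamma>\<in>vforms \<Gamma> (q - 1). l2_inner \<Gamma> q (dbar \<gamma>) \<beta> = l2_inner \<Gamma> (q - 1) \<gamma> \<alpha>)))"

definition laplacian :: "(complex^4) set \<Rightarrow> nat \<Rightarrow> vform \<Rightarrow> vform" where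
  "laplacian \<Gamma> q \<beta> =
     (\<lambda>z vs. dbar (dbar_star \<Gamma> q \<beta>) z vs + dbar_star \<Gamma> (Suc q) (dbar \<beta>) z vs)"

definition harmonic :: "(complex^4) set \<Rightarrow> nat \<Rightarrow> vform set" where
  "harmonic \<Gamma> q = {\<eta> \<in> vforms \<Gamma> q. laplacian \<Gamma> q \<eta> = (\<lambda>z vs. 0)}"

text \<open>The Green operator: \<open>\<alpha> = H \<alpha> + laplacian (green \<alpha>)\<close>, where \<open>H\<close> is the harmonic projection
  and \<open>green \<alpha>\<close> is orthogonal to the harmonic forms.\<close>

definition green :: "(complex^4) set \<Rightarrow> nat \<Rightarrow> vform \<Rightarrow> vform" where
  "green \<Gamma> q \<alpha> = (THE \<beta>. \<beta> \<in> vforms \<Gamma> q \<and>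
     (\<forall>\<eta>\<in>harmonic \<Gamma> q. l2_inner \<Gamma> q \<beta> \<eta> = 0) \<and>
     (\<lambda>z vs. \<alpha> z vs - laplacian \<Gamma> q \<beta> z vs) \<in> harmonic \<Gamma> q)"

definition tilde_form :: "3 \<Rightarrow> complex^4 \<Rightarrow> complex^4 \<Rightarrow> complex" where
  "tilde_form l z v = vector
     [cnj (coframe 1 z v),
      exp (z$1 - cnj (z$1)) * cnj (coframe 2 z v),
      exp (cnj (z$1) - z$1) * cnj (coframe 3 z v)] $ l"

definition tensor :: "(complex^4 \<Rightarrow> complex^4 \<Rightarrow> complex) \<Rightarrow> (complex^4 \<Rightarrow> complex^4) \<Rightarrow> vform" where
  "tensor \<alpha> X z vs = (case vs of [v] \<Rightarrow> \<alpha> z v *s X z | _ \<Rightarrow> 0)"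

text \<open>The parameter \<open>t\<^sub>i\<^sub>\<lambda>\<close> is \<open>t $ i $ \<lambda>\<close>.\<close>

definition psi1 :: "complex^3^4 \<Rightarrow> vform" where
  "psi1 t z vs = (\<Sum>l\<in>UNIV. \<Sum>i\<in>UNIV. t $ i $ l *s tensor (tilde_form l) (frame i) z vs)"

text \<open>The terms are defined for a fixed first term \<open>\<eta>\<close>; the \<open>k\<close>-th term is homogeneous of
  degree \<open>k\<close> in \<open>\<eta>\<close>. The sign of the factor \<open>1/2\<close> is that of the equation
  \<open>dbar \<psi> = 1/2 [\<psi>,\<psi>]\<close>.\<close>

function kuranishi_term :: "(complex^4) set \<Rightarrow> vform \<Rightarrow> nat \<Rightarrow> vform" where
  "kuranishi_term \<Gamma> \<eta> k =
     (if k = 0 then (\<lambda>z vs. 0) else if k = 1 then \<eta> else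
        (\<lambda>z vs. (1/2) *\<^sub>R dbar_star \<Gamma> 2 (green \<Gamma> 2
           (\<lambda>x us. \<Sum>j\<in>{1..<k}.
              bracket (kuranishi_term \<Gamma> \<eta> j) (kuranishi_term \<Gamma> \<eta> (k - j)) x us)) z vs))"
  by pat_completeness auto
termination
  by (relation "Wellfounded.measure (\<lambda>(\<Gamma>, \<eta>, k). k)") auto

declare kuranishi_term.simps [simp del]

definition kuranishi_sum :: "(complex^4) set \<Rightarrow> complex^3^4 \<Rightarrow> vform" where
  "kuranishi_sum \<Gamma> t z vs = (\<Sum>k. kuranishi_term \<Gamma> (psi1 t) k z vs)"

definition maurer_cartan :: "vform \<Rightarrow> bool" where
  "maurer_cartan \<psi> \<longleftrightarrow> (\<forall>z vs. dbar \<psi> z vs - (1/2) *\<^sub>R bracket \<psi> \<psi> z vs = 0)"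

definition kuranishi_space :: "(complex^4) set \<Rightarrow> (complex^3^4) set" where
  "kuranishi_space \<Gamma> = {t.
     (\<forall>z vs. summable (\<lambda>k. kuranishi_term \<Gamma> (psi1 t) k z vs)) \<and>
     kuranishi_sum \<Gamma> t \<in> vforms \<Gamma> 1 \<and>
     maurer_cartan (kuranishi_sum \<Gamma> t)}"

end

theory Submission
  imports Defs
begin

text \<open>
  The proof reduces the Kuranishi recursion to linear algebra with constant coefficients.

  Write \<open>theta 1\<close>, \<open>theta 2\<close>, \<open>theta 3\<close> for the three generators of the first Dolbeault cohomology
  group and \<open>theta 4\<close> for the conjugate of the fourth member of the coframe. The generators
  differ from the conjugate coframe by powers of the character \<open>exp (z$1 - cnj (z$1))\<close>. The character
  is trivial on the lattice and has modulus one, so the forms \<open>theta\<close> descend to the quotient and are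
  again a unitary frame. They satisfy \<open>dbar (theta 4) = - theta 2 \<and> theta 3\<close> and the other three are
  closed. A form of type (0,q) with values in the tangent bundle is the same thing as an alternating
  family of lattice-invariant functions, and on these dbar is a first order operator with constant
  coefficients (\<open>dbar_form1\<close>, \<open>dbar_form2\<close>).

  The definite descriptions \<open>dbar_star\<close> and \<open>green\<close> have to be shown to denote something. The adjoint
  is written down explicitly (\<open>adjoint1\<close>, \<open>adjoint2\<close>). This is integration by parts on the quotient:
  the derivative of an invariant function along an invariant vector field has integral zero over a
  fundamental domain, because it is the infinitesimal form of right translation, which preserves the
  volume and moves one fundamental domain to another (\<open>quotient_integral_derivative\<close>). Consequently
  the Laplacian is symmetric and a form has at most one image under the Green operator
  (\<open>green_form2\<close>). For forms with constant components the image exists because the Laplacian is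
  the projection to the span of \<open>theta 2 \<and> theta 3\<close> and \<open>theta 1 \<and> theta 4\<close>
  (\<open>laplacian_comps_const\<close>).

  The bracket of two forms with constant components has constant components
  (\<open>bracket_form1_const\<close>). The recursion therefore stays among constant components, where each step
  takes the coefficient of \<open>theta 2 \<and> theta 3\<close> in a bracket and puts half its negative in front of
  \<open>theta 4\<close> (\<open>dbar_star_green_const\<close>). The term of degree two is a multiple of \<open>theta 4\<close>, brackets
  with it have no \<open>theta 2 \<and> theta 3\<close> part, and so all terms of degree three and higher vanish
  (\<open>kuranishi_term_eq\<close>). The series is a polynomial in \<open>t\<close>, it converges for every \<open>t\<close>, and the
  Maurer-Cartan equation becomes a finite system of quadratic and cubic equations whose solution
  set is the one claimed (\<open>maurer_cartan_equations\<close>). The equivalence is proved for all \<open>t\<close>.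
\<close>

section \<open>Volume-preserving maps of the group\<close>

definition volume_preserving :: "('a::euclidean_space \<Rightarrow> 'a) \<Rightarrow> bool" where
  "volume_preserving T \<longleftrightarrow> T \<in> borel \<rightarrow>\<^sub>M borel \<and> distr lborel borel T = lborel"

lemma volume_preserving_comp:
  assumes "volume_preserving S" "volume_preserving T"
  shows "volume_preserving (\<lambda>x. S (T x))"
proof -
  have [measurable]: "S \<in> borel \<rightarrow>\<^sub>M borel" "T \<in> borel \<rightarrow>\<^sub>M borel"
    using assms by (auto simp: volume_preserving_def)
  have "distr lborel borel (\<lambda>x. S (T x)) = distr (distr lborel borel T) borel S"
    by (subst distr_distr) (auto simp: comp_def)
  then show ?thesis using assms by (auto simp: volume_preserving_def)
qed

text \<open>By Fubini one may integrate first along the lines in direction \<open>b\<close>, and on each of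
  these the map is a translation.\<close>

lemma volume_preserving_shear:
  fixes g :: "'a::euclidean_space \<Rightarrow> real"
  assumes b: "b \<in> Basis" and [measurable]: "g \<in> borel_measurable borel"
    and inv: "\<And>x s. g (x + s *\<^sub>R b) = g x"
  shows "volume_preserving (\<lambda>x. x + g x *\<^sub>R b)"
proof -
  interpret product_sigma_finite "\<lambda>_::'a. lborel :: real measure"
    by standard
  define I where "I = Basis - {b}"
  have I: "finite I" "b \<notin> I" "Basis = insert b I" using b by (auto simp: I_def)
  define P where "P = (\<lambda>f::'a\<Rightarrow>real. \<Sum>j\<in>Basis. f j *\<^sub>R j)"
  have P[measurable]: "P \<in> Pi\<^sub>M (insert b I) (\<lambda>_. lborel) \<rightarrow>\<^sub>M borel"
    unfolding P_def I(3)[symmetric] by measurable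
  have Pupd: "P (x(b := y)) = P (x(b := 0)) + y *\<^sub>R b" for x y
  proof -
    have s: "(\<Sum>j\<in>I. (x(b:=c)) j *\<^sub>R j) = (\<Sum>j\<in>I. x j *\<^sub>R j)" for c
      by (rule sum.cong) (use I in auto)
    show ?thesis unfolding P_def I(3) sum.insert[OF I(1,2)] s by simp
  qed
  let ?T = "\<lambda>x. x + g x *\<^sub>R b"
  have nn: "(\<integral>\<^sup>+x. f (?T x) \<partial>lborel) = (\<integral>\<^sup>+x. f x \<partial>lborel)"
    if [measurable]: "f \<in> borel_measurable borel" for f :: "'a \<Rightarrow> ennreal"
  proof -
    have fub: "(\<integral>\<^sup>+x. h x \<partial>lborel) =
      (\<integral>\<^sup>+x. (\<integral>\<^sup>+y. h (P (x(b := 0)) + y *\<^sub>R b) \<partial>lborel) \<partial>(Pi\<^sub>M I (\<lambda>_. lborel)))"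
      if [measurable]: "h \<in> borel_measurable borel" for h :: "'a \<Rightarrow> ennreal"
    proof -
      have "(\<integral>\<^sup>+x. h x \<partial>lborel) = (\<integral>\<^sup>+x. h (P x) \<partial>(Pi\<^sub>M (insert b I) (\<lambda>_. lborel)))"
        unfolding P_def I(3)[symmetric]
        by (subst lborel_eq, subst nn_integral_distr) auto
      also have "\<dots> = (\<integral>\<^sup>+x. (\<integral>\<^sup>+y. h (P (x(b := y))) \<partial>lborel) \<partial>(Pi\<^sub>M I (\<lambda>_. lborel)))"
        by (rule product_nn_integral_insert[OF I(1,2)]) measurable
      finally show ?thesis by (subst (asm) Pupd)
    qed
    have tr: "(\<integral>\<^sup>+y. f (p + (y + g p) *\<^sub>R b) \<partial>lborel) = (\<integral>\<^sup>+y. f (p + y *\<^sub>R b) \<partial>lborel)" for p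
      by (subst nn_integral_real_affine[of "\<lambda>y. f (p + y *\<^sub>R b)" 1 "g p"])
         (auto simp: add.commute)
    show ?thesis
      apply (subst fub, simp)
      apply (subst fub, simp)
      apply (rule nn_integral_cong)
      apply (subst tr[symmetric])
      apply (simp only: inv scaleR_add_left add.assoc)
      done
  qed
  have T[measurable]: "?T \<in> borel \<rightarrow>\<^sub>M borel" by measurable
  have "distr lborel borel ?T = lborel"
  proof (rule measure_eqI)
    fix A assume "A \<in> sets (distr lborel borel ?T)"
    then have [measurable]: "A \<in> sets borel" by simp
    have "emeasure (distr lborel borel ?T) A = (\<integral>\<^sup>+x. indicator A x \<partial>distr lborel borel ?T)"
      by simp
    also have "\<dots> = (\<integral>\<^sup>+x. indicator A (?T x) \<partial>lborel)"
      by (subst nn_integral_distr) auto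
    also have "\<dots> = (\<integral>\<^sup>+x. indicator A x \<partial>lborel)" by (rule nn) simp
    finally show "emeasure (distr lborel borel ?T) A = emeasure lborel A" by simp
  qed simp
  then show ?thesis by (simp add: volume_preserving_def)
qed

lemma volume_preserving_complex_shear:
  fixes g :: "complex^'n \<Rightarrow> complex"
  assumes g: "continuous_on UNIV g"
    and inv: "\<And>x c. g (x + axis i c) = g x"
  shows "volume_preserving (\<lambda>x. x + axis i (g x))"
proof -
  have B: "axis i 1 \<in> (Basis :: (complex^'n) set)" "axis i \<i> \<in> (Basis :: (complex^'n) set)"
    by (auto simp: Basis_vec_def Basis_complex_def)
  have m[measurable]: "g \<in> borel_measurable borel"
    using g by (simp add: borel_measurable_continuous_onI)
  have sc: "s *\<^sub>R axis i c = axis i (s *\<^sub>R c)" for s c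
    by (simp add: vec_eq_iff axis_def)
  have "volume_preserving (\<lambda>x. x + Re (g x) *\<^sub>R axis i 1)"
    by (rule volume_preserving_shear[OF B(1)]) (use inv in \<open>auto simp: sc\<close>)
  moreover have "volume_preserving (\<lambda>x. x + Im (g x) *\<^sub>R axis i \<i>)"
    by (rule volume_preserving_shear[OF B(2)]) (use inv in \<open>auto simp: sc\<close>)
  ultimately have "volume_preserving (\<lambda>x. (x + Im (g x) *\<^sub>R axis i \<i>) +
      Re (g (x + Im (g x) *\<^sub>R axis i \<i>)) *\<^sub>R axis i 1)"
    by (rule volume_preserving_comp)
  also have "(\<lambda>x. (x + Im (g x) *\<^sub>R axis i \<i>) +
      Re (g (x + Im (g x) *\<^sub>R axis i \<i>)) *\<^sub>R axis i 1) = (\<lambda>x. x + axis i (g x))"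
  proof
    fix x show "(x + Im (g x) *\<^sub>R axis i \<i>) +
      Re (g (x + Im (g x) *\<^sub>R axis i \<i>)) *\<^sub>R axis i 1 = x + axis i (g x)"
      unfolding sc inv by (simp add: vec_eq_iff axis_def complex_eq_iff)
  qed
  finally show ?thesis .
qed

lemma axis4_eq_vector [simp]:
  "(axis 1 c :: complex^4) = vector [c,0,0,0]" "(axis 2 c :: complex^4) = vector [0,c,0,0]"
  "(axis 3 c :: complex^4) = vector [0,0,c,0]" "(axis 4 c :: complex^4) = vector [0,0,0,c]"
  by (simp_all add: vec_eq_iff forall_4 axis_def)

text \<open>Taking the coordinates in the order 4, 3, 2, 1, a right translation changes one
  coordinate at a time by a function of coordinates that are still unchanged.\<close>

lemma volume_preserving_gmul_right: "volume_preserving (\<lambda>z. gmul z g)"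
proof -
  have a: "volume_preserving (\<lambda>z::complex^4. z + axis 4 (g$4 + 1/2 * exp (z$1) * z$2 * g$3 - 1/2 * exp (- (z$1)) * z$3 * g$2))"
    by (rule volume_preserving_complex_shear) (auto intro!: continuous_intros)
  have b: "volume_preserving (\<lambda>z::complex^4. z + axis 3 (exp (z$1) * g$3))"
    by (rule volume_preserving_complex_shear) (auto intro!: continuous_intros)
  have c: "volume_preserving (\<lambda>z::complex^4. z + axis 2 (exp (- (z$1)) * g$2))"
    by (rule volume_preserving_complex_shear) (auto intro!: continuous_intros)
  have d: "volume_preserving (\<lambda>z::complex^4. z + axis 1 (g$1))"
    by (rule volume_preserving_complex_shear) (auto intro!: continuous_intros)
  show ?thesis
    using volume_preserving_comp[OF d volume_preserving_comp[OF c volume_preserving_comp[OF b a]]]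
    apply (rule back_subst[of volume_preserving])
    apply (auto simp: fun_eq_iff gmul_def vec_eq_iff forall_4 algebra_simps)
    done
qed

text \<open>The linear part of a left translation has the diagonal entries \<open>a\<close> and \<open>1 / a\<close> with
  \<open>a = exp (- (y$1))\<close> in the second and third coordinate. In \<open>SL\<^sub>2\<close> such a diagonal matrix is a
  product of six elementary matrices, so shears suffice here as well.\<close>

lemma volume_preserving_gmul_left: "volume_preserving (gmul y)"
proof -
  define a where "a = exp (- (y$1))"
  have a0: "a \<noteq> 0" "exp (y$1) = 1/a" "exp (-(y$1)) = a" by (auto simp: a_def exp_minus inverse_eq_divide)
  have E23: "volume_preserving (\<lambda>z::complex^4. z + axis 2 (c * z$3))" for c :: complex
    by (rule volume_preserving_complex_shear) (auto intro!: continuous_intros)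
  have E32: "volume_preserving (\<lambda>z::complex^4. z + axis 3 (c * z$2))" for c :: complex
    by (rule volume_preserving_complex_shear) (auto intro!: continuous_intros)
  have T: "volume_preserving (\<lambda>z::complex^4. z + axis i c)" for i :: 4 and c :: complex
    by (rule volume_preserving_complex_shear) (auto intro!: continuous_intros)
  have S: "volume_preserving (\<lambda>z::complex^4. z + axis 4 (y$4 + 1/2 * exp (y$1) * y$2 * z$3 - 1/2 * exp (- (y$1)) * y$3 * z$2))"
    by (rule volume_preserving_complex_shear) (auto intro!: continuous_intros)
  \<comment> \<open>a quarter turn scaled by the factor c; the diagonal matrix D is the product of two of these\<close>
  have W: "volume_preserving (\<lambda>z::complex^4. vector [z$1, c * z$3, - z$2 / c, z$4])"
    if "c \<noteq> 0" for c
    using volume_preserving_comp[OF E23[of c] volume_preserving_comp[OF E32[of "-1/c"] E23[of c]]]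
    by (rule back_subst[of volume_preserving])
       (use that in \<open>auto simp: fun_eq_iff vec_eq_iff forall_4 field_simps\<close>)
  have D: "volume_preserving (\<lambda>z::complex^4. vector [z$1, a * z$2, z$3 / a, z$4])"
    using volume_preserving_comp[OF W[OF a0(1)] W[of "-1"]]
    by (rule back_subst[of volume_preserving]) (auto simp: fun_eq_iff vec_eq_iff forall_4)
  have "volume_preserving (\<lambda>z::complex^4. z + axis 1 (y$1) + axis 2 (y$2) + axis 3 (y$3))"
    by (intro volume_preserving_comp[OF T] volume_preserving_comp[OF T[of 2 "y$2"] T])
  from volume_preserving_comp[OF this volume_preserving_comp[OF D S]] show ?thesis
    by (rule back_subst[of volume_preserving])
       (use a0 in \<open>auto simp: fun_eq_iff gmul_def vec_eq_iff forall_4\<close>)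
qed

section \<open>The group, the lattice and its fundamental domains\<close>

definition ginv :: "complex^4 \<Rightarrow> complex^4" where
  "ginv y = vector [- (y$1), - exp (y$1) * y$2, - exp (- (y$1)) * y$3, - (y$4)]"

lemma gmul_assoc: "gmul (gmul x y) z = gmul x (gmul y z)"
  using group.is_monoid[OF group_solv_group, THEN monoid.m_assoc, of x y z]
  by (simp add: solv_group_def)

lemma gmul_0 [simp]: "gmul 0 z = z" "gmul z 0 = z"
  by (simp_all add: gmul_def vec_eq_iff forall_4)

lemma gmul_ginv [simp]: "gmul y (ginv y) = 0" "gmul (ginv y) y = 0"
  by (simp_all add: gmul_def ginv_def vec_eq_iff forall_4 exp_minus)

lemma gmul_ginv_cancel [simp]:
  "gmul y (gmul (ginv y) z) = z" "gmul (ginv y) (gmul y z) = z"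
  by (simp_all flip: gmul_assoc)

text \<open>The left translation by \<open>y\<close> is affine, and this is its linear part. The columns of the
  matrix are the invariant frame at \<open>y\<close>, so \<open>lact z\<close> also converts components in that frame into
  vectors.\<close>

definition lact :: "complex^4 \<Rightarrow> complex^4 \<Rightarrow> complex^4" where
  "lact y v = vector [v$1, exp (- (y$1)) * v$2, exp (y$1) * v$3,
     v$4 + 1/2 * exp (y$1) * y$2 * v$3 - 1/2 * exp (- (y$1)) * y$3 * v$2]"

lemma gmul_affine: "gmul y z = y + lact y z"
  by (simp add: gmul_def lact_def vec_eq_iff forall_4)

lemma lact_add: "lact y (v + w) = lact y v + lact y w"
  by (simp add: lact_def vec_eq_iff forall_4 field_simps)

lemma lact_smult: "lact y (c *s v) = c *s lact y v"
  by (simp add: lact_def vec_eq_iff forall_4 algebra_simps)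

lemma scaleR_eq_smult: "r *\<^sub>R (v :: complex^'n) = complex_of_real r *s v"
  by (simp add: vec_eq_iff scaleR_conv_of_real[where 'a=complex])

lemma lact_scaleR: "lact y (r *\<^sub>R v) = r *\<^sub>R lact y v"
  by (simp add: scaleR_eq_smult lact_smult)

lemma bounded_linear_lact: "bounded_linear (lact y)"
  by (rule linear_conv_bounded_linear[THEN iffD1]) (simp add: linear_iff lact_add lact_scaleR)

lemma has_derivative_gmul: "(gmul y has_derivative lact y) (at z)"
  unfolding gmul_affine[abs_def]
  by (auto intro!: derivative_eq_intros bounded_linear.has_derivative[OF bounded_linear_lact])

lemma frechet_derivative_gmul: "frechet_derivative (gmul y) (at z) = lact y"
  by (rule frechet_derivative_at[OF has_derivative_gmul, symmetric])

lemma lact_gmul: "lact (gmul x y) v = lact x (lact y v)"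
proof -
  have "gmul (gmul x y) v = gmul x (gmul y v)" by (rule gmul_assoc)
  then show ?thesis by (simp add: gmul_affine lact_add)
qed

lemma continuous_on_vector4 [continuous_intros]:
  fixes a b c d :: "'a::topological_space \<Rightarrow> complex"
  assumes "continuous_on S a" "continuous_on S b" "continuous_on S c" "continuous_on S d"
  shows "continuous_on S (\<lambda>z. vector [a z, b z, c z, d z] :: complex^4)"
proof -
  have "continuous_on S (\<lambda>z. \<chi> i. (vector [a z, b z, c z, d z] :: complex^4) $ i)"
  proof (rule continuous_on_vec_lambda)
    fix i :: 4
    show "continuous_on S (\<lambda>z. (vector [a z, b z, c z, d z] :: complex^4) $ i)"
      using exhaust_4[of i] assms by auto
  qed
  then show ?thesis by simp
qed

lemma continuous_on_gmul [continuous_intros]: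
  "continuous_on S f \<Longrightarrow> continuous_on S g \<Longrightarrow> continuous_on S (\<lambda>x. gmul (f x) (g x))"
  unfolding gmul_def by (intro continuous_intros)

lemma continuous_on_ginv [continuous_intros]:
  "continuous_on S f \<Longrightarrow> continuous_on S (\<lambda>x. ginv (f x))"
  unfolding ginv_def by (intro continuous_intros)

lemma borel_measurable_gmul [measurable]: "gmul y \<in> borel_measurable borel"
  by (intro borel_measurable_continuous_onI continuous_intros)

lemma borel_measurable_gmul' [measurable]: "(\<lambda>z. gmul z y) \<in> borel_measurable borel"
  by (intro borel_measurable_continuous_onI continuous_intros)

lemma ginv_ginv [simp]: "ginv (ginv y) = y"
  by (simp add: ginv_def vec_eq_iff forall_4 exp_minus)

lemma ginv_gmul: "ginv (gmul a b) = gmul (ginv b) (ginv a)"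
proof -
  have "gmul (gmul a b) (gmul (ginv b) (ginv a)) = 0" by (simp add: gmul_assoc)
  then show ?thesis by (metis gmul_0(2) gmul_ginv_cancel(2))
qed

locale solv_lattice =
  fixes \<Gamma> :: "(complex^4) set"
  assumes lattice: "cocompact_lattice \<Gamma>"
    and unit_character: "\<forall>y\<in>\<Gamma>. exp (y$1 - cnj (y$1)) = 1"
begin

lemma zero_in: "0 \<in> \<Gamma>"
  and gmul_in: "x \<in> \<Gamma> \<Longrightarrow> y \<in> \<Gamma> \<Longrightarrow> gmul x y \<in> \<Gamma>"
  and ginv_in: "y \<in> \<Gamma> \<Longrightarrow> ginv y \<in> \<Gamma>"
proof -
  have s: "subgroup \<Gamma> solv_group" using lattice by (simp add: cocompact_lattice_def)
  show "0 \<in> \<Gamma>" using subgroup.one_closed[OF s] by (simp add: solv_group_def)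
  show "gmul x y \<in> \<Gamma>" if "x \<in> \<Gamma>" "y \<in> \<Gamma>"
    using subgroup.m_closed[OF s that] by (simp add: solv_group_def)
  show "ginv y \<in> \<Gamma>" if "y \<in> \<Gamma>"
  proof -
    have "inv\<^bsub>solv_group\<^esub> y = ginv y"
      by (rule group.inv_equality[OF group_solv_group]) (auto simp: solv_group_def)
    then show ?thesis using subgroup.m_inv_closed[OF s that] by simp
  qed
qed

lemma countable_lattice: "countable \<Gamma>"
proof -
  obtain B :: "(complex^4) set set" where B: "countable B" "topological_basis B"
    using ex_countable_basis by blast
  have "\<exists>b\<in>B. b \<inter> \<Gamma> = {x}" if "x \<in> \<Gamma>" for x
  proof -
    have "x isolated_in \<Gamma>"
      using lattice that by (simp add: cocompact_lattice_def discrete_def)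
    then obtain T where T: "open T" "T \<inter> \<Gamma> = {x}" by (auto simp: isolated_in_def)
    then obtain b where "b \<in> B" "x \<in> b" "b \<subseteq> T"
      using topological_basisE[OF B(2)] by (metis Int_iff insertI1)
    then show ?thesis using T by blast
  qed
  then obtain b where b: "\<And>x. x \<in> \<Gamma> \<Longrightarrow> b x \<in> B \<and> b x \<inter> \<Gamma> = {x}" by metis
  have "inj_on b \<Gamma>" by (rule inj_onI) (metis b singleton_inject)
  moreover have "countable (b ` \<Gamma>)"
    by (rule countable_subset[OF _ B(1)]) (use b in auto)
  ultimately show ?thesis using countable_image_inj_on by blast
qed

text \<open>Discreteness gives an open neighbourhood \<open>V\<close> of the identity such that the quotient of
  two elements of \<open>V\<close> is never a nontrivial lattice element. Finitely many right translates of \<open>V\<close>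
  cover the compact set \<open>K\<close>; each of them meets every orbit at most once. Removing from the \<open>n\<close>-th
  translate all orbits that meet an earlier one leaves exactly one point of each orbit.\<close>

lemma fundamental_domain_exists: "\<exists>F. fundamental_domain \<Gamma> F"
proof -
  obtain K where K: "compact K" "(\<Union>y\<in>\<Gamma>. gmul y ` K) = UNIV"
    using lattice by (auto simp: cocompact_lattice_def)
  have "0 isolated_in \<Gamma>"
    using lattice zero_in by (simp add: cocompact_lattice_def discrete_def)
  then obtain T where T: "open T" "T \<inter> \<Gamma> = {0}" by (auto simp: isolated_in_def)
  have "open ((\<lambda>p. gmul (snd p) (ginv (fst p))) -` T)"
    by (intro open_vimage T continuous_intros)
  moreover have "(0, 0) \<in> (\<lambda>p. gmul (snd p) (ginv (fst p))) -` T"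
    using T gmul_ginv(1)[of 0] by auto
  ultimately obtain A B where "open A" "open B" and AB0: "(0, 0) \<in> A \<times> B"
    and AB: "A \<times> B \<subseteq> (\<lambda>p. gmul (snd p) (ginv (fst p))) -` T"
    by (rule open_prod_elim) blast
  define V where "V = A \<inter> B \<inter> ball 0 1"
  have V: "open V" "0 \<in> V" using AB0 \<open>open A\<close> \<open>open B\<close> by (auto simp: V_def)
  have Vsep: "gmul w (ginv v) \<in> \<Gamma> \<Longrightarrow> gmul w (ginv v) = 0" if "v \<in> V" "w \<in> V" for v w
  proof -
    have "(v, w) \<in> (\<lambda>p. gmul (snd p) (ginv (fst p))) -` T"
      by (rule subsetD[OF AB]) (use that in \<open>auto simp: V_def\<close>)
    then show "gmul w (ginv v) \<in> \<Gamma> \<Longrightarrow> gmul w (ginv v) = 0" using T(2) by auto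
  qed
  define U where "U g = {z. gmul z (ginv g) \<in> V}" for g
  have Uvim: "U g = (\<lambda>z. gmul z (ginv g)) -` V" for g by (auto simp: U_def)
  have openU: "open (U g)" for g
    unfolding Uvim by (intro open_vimage V continuous_intros)
  have bU: "bounded (U g)" for g
  proof -
    have "U g \<subseteq> (\<lambda>v. gmul v g) ` cball 0 1"
    proof
      fix z assume "z \<in> U g"
      then have "gmul z (ginv g) \<in> cball 0 1" "z = gmul (gmul z (ginv g)) g"
        by (auto simp: U_def V_def gmul_assoc)
      then show "z \<in> (\<lambda>v. gmul v g) ` cball 0 1" by blast
    qed
    moreover have "compact ((\<lambda>v. gmul v g) ` cball 0 1)"
      by (intro compact_continuous_image continuous_intros compact_cball)
    ultimately show ?thesis using bounded_subset compact_imp_bounded by blast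
  qed
  have "K \<subseteq> (\<Union>g\<in>K. U g)" using V by (auto simp: U_def)
  then obtain D where D: "D \<subseteq> K" "finite D" "K \<subseteq> (\<Union>g\<in>D. U g)"
    using compactE_image[OF K(1), of K U] openU by metis
  obtain gs where gs: "set gs = D" using finite_list[OF D(2)] by auto
  define N where "N = length gs"
  \<comment> \<open>the orbits that meet the n-th translate\<close>
  define R where "R n = {z. \<exists>y\<in>\<Gamma>. gmul y z \<in> U (gs ! n)}" for n
  have Rinv: "gmul y z \<in> R n \<longleftrightarrow> z \<in> R n" if "y \<in> \<Gamma>" for y z n
  proof
    assume "gmul y z \<in> R n"
    then show "z \<in> R n" using gmul_in that by (auto simp: R_def simp flip: gmul_assoc)
  next
    assume "z \<in> R n"
    then obtain x where x: "x \<in> \<Gamma>" "gmul x z \<in> U (gs ! n)" by (auto simp: R_def)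
    then have "gmul (gmul x (ginv y)) (gmul y z) \<in> U (gs ! n)" by (simp add: gmul_assoc)
    then show "gmul y z \<in> R n" using gmul_in[OF x(1) ginv_in[OF that]] by (auto simp: R_def)
  qed
  have openR: "open (R n)" for n
  proof -
    have "R n = (\<Union>y\<in>\<Gamma>. gmul y -` U (gs ! n))" by (auto simp: R_def)
    moreover have "open (\<Union>y\<in>\<Gamma>. gmul y -` U (gs ! n))"
      by (intro open_UN ballI open_vimage openU continuous_intros)
    ultimately show ?thesis by simp
  qed
  define F where "F = (\<Union>n<N. U (gs ! n) - (\<Union>m<n. R m))"
  have "F \<in> sets borel"
    unfolding F_def using openU openR by (intro sets.finite_UN sets.Diff) auto
  moreover have "bounded F"
  proof (rule bounded_subset)
    show "bounded (\<Union>n<N. U (gs ! n))" using bU by (auto intro!: bounded_UN)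
  qed (auto simp: F_def)
  moreover have "\<exists>!y. y \<in> \<Gamma> \<and> gmul y z \<in> F" for z
  proof -
    have ex: "\<exists>n<N. z \<in> R n" for z
    proof -
      obtain y k where "y \<in> \<Gamma>" "k \<in> K" "z = gmul y k" using K(2) by blast
      then obtain g where "g \<in> set gs" "k \<in> U g" using D gs by auto
      then obtain n where "n < N" "k \<in> U (gs ! n)" by (auto simp: in_set_conv_nth N_def)
      moreover have "z \<in> R n"
        unfolding R_def using \<open>y \<in> \<Gamma>\<close> \<open>z = gmul y k\<close> \<open>k \<in> U (gs ! n)\<close>
        by (auto intro!: bexI[of _ "ginv y"] simp: ginv_in)
      ultimately show ?thesis by blast
    qed
    define n where "n = (LEAST n. z \<in> R n)"
    have n: "z \<in> R n" "\<And>m. m < n \<Longrightarrow> z \<notin> R m"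
    proof -
      show "z \<in> R n" unfolding n_def by (rule LeastI_ex) (use ex[of z] in blast)
      show "z \<notin> R m" if "m < n" for m using that unfolding n_def by (rule not_less_Least)
    qed
    obtain n0 where n0: "n0 < N" "z \<in> R n0" using ex[of z] by blast
    have nN: "n < N" using n0 n(2)[of n0] by linarith
    have F_iff: "gmul y z \<in> F \<longleftrightarrow> gmul y z \<in> U (gs ! n)" if y: "y \<in> \<Gamma>" for y
    proof
      assume "gmul y z \<in> F"
      then obtain m where m: "m < N" "gmul y z \<in> U (gs ! m)" "\<And>l. l < m \<Longrightarrow> gmul y z \<notin> R l"
        by (auto simp: F_def)
      then have "z \<in> R m" using y by (auto simp: R_def)
      moreover have "\<And>l. l < m \<Longrightarrow> z \<notin> R l" using m(3) Rinv[OF y] by blast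
      ultimately have "m = n" using n by (meson linorder_neqE_nat)
      then show "gmul y z \<in> U (gs ! n)" using m by simp
    next
      assume "gmul y z \<in> U (gs ! n)"
      then show "gmul y z \<in> F" using nN n(2) Rinv[OF y] by (auto simp: F_def)
    qed
    obtain y where y: "y \<in> \<Gamma>" "gmul y z \<in> U (gs ! n)" using n(1) by (auto simp: R_def)
    show ?thesis
    proof (rule ex1I[of _ y])
      show "y \<in> \<Gamma> \<and> gmul y z \<in> F" using y F_iff by auto
    next
      fix x assume x: "x \<in> \<Gamma> \<and> gmul x z \<in> F"
      let ?g = "ginv (gs ! n)"
      have V2: "gmul (gmul x z) ?g \<in> V" "gmul (gmul y z) ?g \<in> V"
        using x y F_iff by (auto simp: U_def)
      have "gmul (gmul (gmul x z) ?g) (ginv (gmul (gmul y z) ?g)) = gmul x (ginv y)"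
        by (simp add: ginv_gmul gmul_assoc)
      then have "gmul x (ginv y) = 0"
        using Vsep[OF V2(2,1)] gmul_in[of x "ginv y"] ginv_in[of y] x y by metis
      then have "gmul (gmul x (ginv y)) y = y" by simp
      then show "x = y" by (simp add: gmul_assoc)
    qed
  qed
  ultimately show ?thesis unfolding fundamental_domain_def by blast
qed

definition invariant :: "(complex^4 \<Rightarrow> 'a) \<Rightarrow> bool" where
  "invariant f \<longleftrightarrow> (\<forall>y\<in>\<Gamma>. \<forall>z. f (gmul y z) = f z)"

text \<open>Unfolding: the integral over \<open>F\<close> is the sum over all lattice elements \<open>y\<close> of the integral
  over the part of \<open>F\<close> that \<open>y\<close> moves into \<open>F'\<close>, and \<open>y\<close> preserves the volume.\<close>

lemma nn_integral_domain_independent: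
  fixes f :: "complex^4 \<Rightarrow> ennreal"
  assumes [measurable]: "f \<in> borel_measurable borel" "F \<in> sets borel" "F' \<in> sets borel"
    and inv: "invariant f"
    and F: "\<And>z. \<exists>!y. y \<in> \<Gamma> \<and> gmul y z \<in> F" and F': "\<And>z. \<exists>!y. y \<in> \<Gamma> \<and> gmul y z \<in> F'"
  shows "(\<integral>\<^sup>+z. f z * indicator F z \<partial>lborel) = (\<integral>\<^sup>+z. f z * indicator F' z \<partial>lborel)"
proof -
  interpret pair_sigma_finite "count_space \<Gamma>" "lborel :: (complex^4) measure"
    using countable_lattice
    by (simp add: pair_sigma_finite_def sigma_finite_measure_count_space_countable
        lborel.sigma_finite_measure_axioms)
  have [measurable]: "(\<lambda>p. gmul (fst p) (snd p)) \<in> borel_measurable (count_space \<Gamma> \<Otimes>\<^sub>M borel)"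
    by (rule measurable_pair_measure_countable1) (auto simp: countable_lattice)
  have one: "(\<integral>\<^sup>+y. indicator D (gmul y z) \<partial>count_space \<Gamma>) = (1::ennreal)"
    if D: "\<And>z. \<exists>!y. y \<in> \<Gamma> \<and> gmul y z \<in> D" for D z
  proof -
    obtain y where y: "y \<in> \<Gamma>" "gmul y z \<in> D" "\<And>x. x \<in> \<Gamma> \<Longrightarrow> gmul x z \<in> D \<Longrightarrow> x = y"
      using D[of z] by auto
    have "(\<integral>\<^sup>+y. indicator D (gmul y z) \<partial>count_space \<Gamma>) = (\<integral>\<^sup>+x. indicator {y} x \<partial>count_space \<Gamma>)"
    proof (rule nn_integral_cong)
      fix x assume "x \<in> space (count_space \<Gamma>)"
      then have "gmul x z \<in> D \<longleftrightarrow> x \<in> {y}" using y by (metis singletonD singletonI space_count_space)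
      then show "indicator D (gmul x z) = (indicator {y} x :: ennreal)"
        by (simp only: indicator_def)
    qed
    also have "\<dots> = 1" using y(1) by simp
    finally show ?thesis .
  qed
  have step: "(\<integral>\<^sup>+z. f z * indicator A z \<partial>lborel) =
      (\<integral>\<^sup>+y. (\<integral>\<^sup>+z. f z * indicator A z * indicator B (gmul y z) \<partial>lborel) \<partial>count_space \<Gamma>)"
    if [measurable]: "A \<in> sets borel" "B \<in> sets borel"
      and B: "\<And>z. \<exists>!y. y \<in> \<Gamma> \<and> gmul y z \<in> B" for A B
  proof -
    have "(\<integral>\<^sup>+z. f z * indicator A z \<partial>lborel) =
      (\<integral>\<^sup>+z. (\<integral>\<^sup>+y. f z * indicator A z * indicator B (gmul y z) \<partial>count_space \<Gamma>) \<partial>lborel)"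
      by (subst nn_integral_cmult) (auto simp: one[OF B])
    also have "\<dots> = (\<integral>\<^sup>+y. (\<integral>\<^sup>+z. f z * indicator A z * indicator B (gmul y z) \<partial>lborel) \<partial>count_space \<Gamma>)"
      by (rule Fubini') measurable
    finally show ?thesis .
  qed
  have swap: "(\<integral>\<^sup>+z. f z * indicator F z * indicator F' (gmul y z) \<partial>lborel) =
      (\<integral>\<^sup>+z. f z * indicator F' z * indicator F (gmul (ginv y) z) \<partial>lborel)" if y: "y \<in> \<Gamma>" for y
  proof -
    have d: "distr lborel borel (gmul y) = lborel"
      using volume_preserving_gmul_left[of y] by (simp add: volume_preserving_def)
    have "(\<integral>\<^sup>+z. f z * indicator F' z * indicator F (gmul (ginv y) z) \<partial>lborel) =
      (\<integral>\<^sup>+z. f z * indicator F' z * indicator F (gmul (ginv y) z) \<partial>distr lborel borel (gmul y))"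
      by (simp add: d)
    also have "\<dots> = (\<integral>\<^sup>+z. f (gmul y z) * indicator F' (gmul y z) * indicator F z \<partial>lborel)"
      by (subst nn_integral_distr) auto
    also have "\<dots> = (\<integral>\<^sup>+z. f z * indicator F z * indicator F' (gmul y z) \<partial>lborel)"
      using inv y by (intro nn_integral_cong) (simp add: invariant_def mult_ac)
    finally show ?thesis by simp
  qed
  have bij: "bij_betw ginv \<Gamma> \<Gamma>"
    by (rule bij_betwI[of _ _ _ ginv])
       (auto simp: ginv_in)
  have "(\<integral>\<^sup>+z. f z * indicator F z \<partial>lborel) =
     (\<integral>\<^sup>+y. (\<integral>\<^sup>+z. f z * indicator F' z * indicator F (gmul (ginv y) z) \<partial>lborel) \<partial>count_space \<Gamma>)"
    unfolding step[OF assms(2,3) F'] by (rule nn_integral_cong) (simp add: swap)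
  also have "\<dots> = (\<integral>\<^sup>+y. (\<integral>\<^sup>+z. f z * indicator F' z * indicator F (gmul y z) \<partial>lborel) \<partial>count_space \<Gamma>)"
    by (rule nn_integral_bij_count_space[OF bij])
  also have "\<dots> = (\<integral>\<^sup>+z. f z * indicator F' z \<partial>lborel)"
    using step[OF assms(3,2) F] by simp
  finally show ?thesis .
qed

end

section \<open>Smooth functions\<close>

lemma Ck_SucI:
  assumes D: "\<And>z. (f has_derivative f' z) (at z)" and C: "\<And>v. Ck k (\<lambda>z. f' z v)"
  shows "Ck (Suc k) f"
proof -
  have "frechet_derivative f (at z) = f' z" for z
    by (rule frechet_derivative_at[OF D, symmetric])
  moreover have "f differentiable_on UNIV"
    unfolding differentiable_on_def differentiable_def using D by auto
  ultimately show ?thesis using C by simp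
qed

lemma Ck_Suc_has_derivative:
  "Ck (Suc k) f \<Longrightarrow> (f has_derivative frechet_derivative f (at z)) (at z)"
  by (auto simp: differentiable_on_def frechet_derivative_works)

lemma Ck_Suc_frechet_derivative: "Ck (Suc k) f \<Longrightarrow> Ck k (\<lambda>z. frechet_derivative f (at z) v)"
  by simp

lemma Ck_SucD: "Ck (Suc k) f \<Longrightarrow> Ck k f"
  by (induction k arbitrary: f) (auto intro: differentiable_imp_continuous_on)

lemma Ck_add: "Ck k f \<Longrightarrow> Ck k g \<Longrightarrow> Ck k (\<lambda>z. f z + g z)"
proof (induction k arbitrary: f g)
  case (Suc k)
  show ?case
    by (rule Ck_SucI[OF has_derivative_add[OF Suc.prems[THEN Ck_Suc_has_derivative]]])
       (intro Suc.IH Suc.prems[THEN Ck_Suc_frechet_derivative])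
qed (auto intro: continuous_intros)

lemma Ck_bounded_bilinear:
  assumes P: "bounded_bilinear P" and "Ck k f" "Ck k g"
  shows "Ck k (\<lambda>z. P (f z) (g z))"
  using assms(2,3)
proof (induction k arbitrary: f g)
  case (Suc k)
  show ?case
    by (rule Ck_SucI[OF bounded_bilinear.FDERIV[OF P Suc.prems[THEN Ck_Suc_has_derivative]]])
       (intro Ck_add Suc.IH Suc.prems[THEN Ck_Suc_frechet_derivative] Suc.prems[THEN Ck_SucD])
qed (auto intro: bounded_bilinear.continuous_on[OF P])

lemma Ck_const: "Ck k (\<lambda>z. c)"
  by (induction k arbitrary: c) (auto simp del: Ck.simps(2) intro!: Ck_SucI[OF has_derivative_const])

lemma Ck_bounded_linear: "bounded_linear L \<Longrightarrow> Ck k L"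
  by (cases k) (auto simp: linear_continuous_on Ck_const simp del: Ck.simps(2)
      intro!: Ck_SucI[OF bounded_linear_imp_has_derivative])

lemma Ck_bounded_linear_comp:
  assumes L: "bounded_linear L" and "Ck k f" shows "Ck k (\<lambda>z. L (f z))"
  using assms(2)
proof (induction k arbitrary: f)
  case (Suc k)
  show ?case
    by (rule Ck_SucI[OF bounded_linear.has_derivative[OF L Suc.prems[THEN Ck_Suc_has_derivative]]])
       (intro Suc.IH Suc.prems[THEN Ck_Suc_frechet_derivative])
qed (auto intro: bounded_linear.continuous_on[OF L])

lemma Ck_exp:
  fixes f :: "'a::euclidean_space \<Rightarrow> complex"
  assumes "Ck k f" shows "Ck k (\<lambda>z. exp (f z))"
  using assms
proof (induction k arbitrary: f)
  case (Suc k)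
  show ?case
    by (rule Ck_SucI[OF has_derivative_compose[OF Suc.prems[THEN Ck_Suc_has_derivative]
          DERIV_exp[THEN has_field_derivative_imp_has_derivative]]])
       (intro Ck_bounded_bilinear[OF bounded_bilinear_mult] Suc.IH
          Suc.prems[THEN Ck_Suc_frechet_derivative] Suc.prems[THEN Ck_SucD])
qed (auto intro: continuous_intros)

named_theorems smooth_intros

lemma smooth_add [smooth_intros]: "smooth f \<Longrightarrow> smooth g \<Longrightarrow> smooth (\<lambda>z. f z + g z)"
  by (simp add: smooth_def Ck_add)

lemma smooth_bounded_bilinear:
  "bounded_bilinear P \<Longrightarrow> smooth f \<Longrightarrow> smooth g \<Longrightarrow> smooth (\<lambda>z. P (f z) (g z))"
  by (simp add: smooth_def Ck_bounded_bilinear)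

lemma smooth_const [smooth_intros]: "smooth (\<lambda>z. c)"
  by (simp add: smooth_def Ck_const)

lemma smooth_bounded_linear: "bounded_linear L \<Longrightarrow> smooth L"
  by (simp add: smooth_def Ck_bounded_linear)

lemma smooth_bounded_linear_comp: "bounded_linear L \<Longrightarrow> smooth f \<Longrightarrow> smooth (\<lambda>z. L (f z))"
  by (simp add: smooth_def Ck_bounded_linear_comp)

lemma smooth_exp [smooth_intros]: "smooth f \<Longrightarrow> smooth (\<lambda>z. exp (f z :: complex))"
  by (simp add: smooth_def Ck_exp)

lemma smooth_mult [smooth_intros]: "smooth f \<Longrightarrow> smooth g \<Longrightarrow> smooth (\<lambda>z. f z * g z :: complex)"
  by (rule smooth_bounded_bilinear[OF bounded_bilinear_mult])

lemma bounded_bilinear_smult: "bounded_bilinear (\<lambda>c (v::complex^'n). c *s v)"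
proof (rule bounded_bilinear.intro)
  show "\<exists>K. \<forall>a (b::complex^'n). norm (a *s b) \<le> norm a * norm b * K"
  proof (intro exI[of _ 1] allI)
    fix a and b :: "complex^'n"
    have "norm (a *s b) = norm a * norm b"
      by (simp add: norm_vec_def norm_mult L2_set_def power_mult_distrib real_sqrt_mult
          flip: sum_distrib_left)
    then show "norm (a *s b) \<le> norm a * norm b * 1" by simp
  qed
qed (auto simp: vec_eq_iff algebra_simps)

lemma smooth_smult [smooth_intros]:
  "smooth f \<Longrightarrow> smooth g \<Longrightarrow> smooth (\<lambda>z. f z *s (g z :: complex^'n))"
  by (rule smooth_bounded_bilinear[OF bounded_bilinear_smult])

lemma smooth_cnj [smooth_intros]: "smooth f \<Longrightarrow> smooth (\<lambda>z. cnj (f z))"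
  by (rule smooth_bounded_linear_comp[OF bounded_linear_cnj])

lemma smooth_component [smooth_intros]: "smooth f \<Longrightarrow> smooth (\<lambda>z. f z $ i)"
  by (rule smooth_bounded_linear_comp[OF bounded_linear_vec_nth])

lemma smooth_ident [smooth_intros]: "smooth (\<lambda>z. z)"
  by (rule smooth_bounded_linear[OF bounded_linear_ident])

lemma smooth_scaleR [smooth_intros]: "smooth f \<Longrightarrow> smooth (\<lambda>z. r *\<^sub>R f z)"
  by (rule smooth_bounded_linear_comp[OF bounded_linear_scaleR_right])

lemma smooth_minus [smooth_intros]: "smooth f \<Longrightarrow> smooth (\<lambda>z. - f z)"
  by (rule smooth_bounded_linear_comp[OF bounded_linear_minus[OF bounded_linear_ident]])

lemma smooth_diff [smooth_intros]: "smooth f \<Longrightarrow> smooth g \<Longrightarrow> smooth (\<lambda>z. f z - g z)"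
  using smooth_add[OF _ smooth_minus, of f g] by simp

lemma smooth_sum [smooth_intros]:
  "(\<And>i. i \<in> A \<Longrightarrow> smooth (f i)) \<Longrightarrow> smooth (\<lambda>z. \<Sum>i\<in>A. f i z)"
  by (induction A rule: infinite_finite_induct) (auto intro: smooth_intros)

lemma vector4_eq_sum:
  "(vector [a, b, c, d] :: complex^4) = a *s axis 1 1 + b *s axis 2 1 + c *s axis 3 1 + d *s axis 4 1"
  by (simp add: vec_eq_iff forall_4)

lemma smooth_vector4 [smooth_intros]:
  assumes "smooth a" "smooth b" "smooth c" "smooth d"
  shows "smooth (\<lambda>z. vector [a z, b z, c z, d z] :: complex^4)"
  unfolding vector4_eq_sum using assms by (intro smooth_intros)

lemma smooth_has_derivative:
  "smooth f \<Longrightarrow> (f has_derivative frechet_derivative f (at z)) (at z)"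
  unfolding smooth_def using Ck.simps(2)[of 0 f]
  by (auto simp: differentiable_on_def frechet_derivative_works)

lemma smooth_frechet_derivative [smooth_intros]:
  "smooth f \<Longrightarrow> smooth (\<lambda>z. frechet_derivative f (at z) v)"
  unfolding smooth_def using Ck.simps(2) by blast

lemma smooth_imp_continuous_on: "smooth f \<Longrightarrow> continuous_on S f"
  unfolding smooth_def using Ck.simps(1)[of f] continuous_on_subset by blast

lemma frechet_derivative_Basis:
  assumes "smooth f"
  shows "frechet_derivative f (at z) w = (\<Sum>b\<in>Basis. (w \<bullet> b) *\<^sub>R frechet_derivative f (at z) b)"
proof -
  let ?d = "frechet_derivative f (at z)"
  have l: "linear ?d" by (rule has_derivative_linear[OF smooth_has_derivative[OF assms]])
  have "?d w = ?d (\<Sum>b\<in>Basis. (w \<bullet> b) *\<^sub>R b)" by (simp add: euclidean_representation)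
  then show ?thesis by (simp only: linear_sum[OF l] linear_scale[OF l])
qed

section \<open>Integration over the quotient\<close>

lemma integrable_on_bounded:
  fixes h :: "complex^4 \<Rightarrow> 'b::euclidean_space"
  assumes "continuous_on UNIV h" "F \<in> sets borel" "bounded F"
  shows "integrable lborel (\<lambda>z. indicator F z *\<^sub>R h z)"
proof -
  have "integrable lborel (\<lambda>z. indicator (closure F) z *\<^sub>R h z)"
    by (rule borel_integrable_compact)
       (simp_all add: assms(3) continuous_on_subset[OF assms(1)])
  then have "set_integrable lborel (closure F) h" by (simp add: set_integrable_def)
  then have "set_integrable lborel F h"
    by (rule set_integrable_subset) (simp_all add: assms(2) closure_subset)
  then show ?thesis by (simp add: set_integrable_def)
qed

context solv_lattice
begin

definition fund :: "(complex^4) set" where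
  "fund = (SOME F. fundamental_domain \<Gamma> F)"

lemma fundamental_domain_fund: "fundamental_domain \<Gamma> fund"
  unfolding fund_def by (rule someI_ex[OF fundamental_domain_exists])

lemma fund_borel [measurable]: "fund \<in> sets borel"
  and bounded_fund: "bounded fund"
  and fund_ex1: "\<And>z. \<exists>!y. y \<in> \<Gamma> \<and> gmul y z \<in> fund"
  using fundamental_domain_fund by (auto simp: fundamental_domain_def)

definition quotient_integral :: "(complex^4 \<Rightarrow> complex) \<Rightarrow> complex" where
  "quotient_integral h = set_lebesgue_integral lborel fund h"

lemma quotient_integral_add: "continuous_on UNIV f \<Longrightarrow> continuous_on UNIV g \<Longrightarrow> quotient_integral (\<lambda>z. f z + g z) = quotient_integral f + quotient_integral g"
  unfolding quotient_integral_def by (intro set_integral_add) (simp_all add: set_integrable_def integrable_on_bounded bounded_fund)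

lemma quotient_integral_cmult: "quotient_integral (\<lambda>z. c * f z) = c * quotient_integral f"
  unfolding quotient_integral_def by simp

text \<open>Right translations commute with the action of the lattice, hence they move one fundamental
  domain to another one.\<close>

lemma quotient_integral_right_translate_real:
  fixes h :: "complex^4 \<Rightarrow> real"
  assumes h: "continuous_on UNIV h" and inv: "invariant h"
  shows "(\<integral>z. indicator fund z * h (gmul z g) \<partial>lborel) = (\<integral>z. indicator fund z * h z \<partial>lborel)"
proof -
  define F' where "F' = {z. gmul z (ginv g) \<in> fund}"
  have F'_vim: "F' = (\<lambda>z. gmul z (ginv g)) -` fund" by (auto simp: F'_def)
  have F'_image: "F' = (\<lambda>z. gmul z g) ` fund"
  proof safe
    fix z assume "z \<in> F'"
    then have "gmul z (ginv g) \<in> fund" "z = gmul (gmul z (ginv g)) g"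
      by (auto simp: F'_def gmul_assoc)
    then show "z \<in> (\<lambda>z. gmul z g) ` fund" by blast
  qed (simp add: F'_def gmul_assoc)
  have [measurable]: "F' \<in> sets borel"
    unfolding F'_vim using measurable_sets_borel[OF borel_measurable_gmul' fund_borel] by simp
  have bF': "bounded F'"
  proof -
    have "compact ((\<lambda>z. gmul z g) ` closure fund)"
      by (intro compact_continuous_image continuous_intros) (simp add: bounded_fund)
    then show ?thesis unfolding F'_image
      by (meson bounded_subset closure_subset compact_imp_bounded image_mono)
  qed
  have exF': "\<exists>!y. y \<in> \<Gamma> \<and> gmul y z \<in> F'" for z
    using fund_ex1[of "gmul z (ginv g)"] by (simp add: F'_def gmul_assoc)
  have [measurable]: "h \<in> borel_measurable borel" using h by (rule borel_measurable_continuous_onI)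
  have "(\<integral>z. indicator fund z * h (gmul z g) \<partial>lborel) =
        (\<integral>z. indicator F' (gmul z g) * h (gmul z g) \<partial>lborel)"
    by (simp add: F'_def indicator_def gmul_assoc)
  also have "\<dots> = (\<integral>z. indicator F' z * h z \<partial>distr lborel borel (\<lambda>z. gmul z g))"
    by (subst integral_distr) auto
  also have "\<dots> = (\<integral>z. indicator F' z * h z \<partial>lborel)"
    using volume_preserving_gmul_right[of g] by (simp add: volume_preserving_def)
  also have "\<dots> = (\<integral>z. indicator fund z * h z \<partial>lborel)"
  proof -
    have e: "ennreal (indicator A z * k z) = ennreal (k z) * indicator A z" for A z and k :: "complex^4 \<Rightarrow> real"
      by (simp add: indicator_def)
    have n: "(\<integral>\<^sup>+z. ennreal (indicator F' z * k z) \<partial>lborel) =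
             (\<integral>\<^sup>+z. ennreal (indicator fund z * k z) \<partial>lborel)"
      if [measurable]: "k \<in> borel_measurable borel" and k: "invariant k" for k :: "complex^4 \<Rightarrow> real"
      unfolding e
      by (rule nn_integral_domain_independent)
         (use k exF' fund_ex1 in \<open>auto simp: invariant_def\<close>)
    have "integrable lborel (\<lambda>z. indicator F' z * h z)" "integrable lborel (\<lambda>z. indicator fund z * h z)"
      using integrable_on_bounded[OF h _ bF'] integrable_on_bounded[OF h _ bounded_fund] by auto
    moreover have "invariant (\<lambda>z. - h z)" using inv by (simp add: invariant_def)
    ultimately show ?thesis
      using n[of h] n[of "\<lambda>z. - h z"] inv by (simp add: real_lebesgue_integral_def)
  qed
  finally show ?thesis .
qed

lemma quotient_integral_right_translate:
  assumes h: "continuous_on UNIV h" and inv: "invariant h"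
  shows "quotient_integral (\<lambda>z. h (gmul z g)) = quotient_integral h"
proof -
  have hg: "continuous_on UNIV (\<lambda>z. h (gmul z g))"
    by (intro continuous_on_compose2[OF h] continuous_intros) auto
  have i: "integrable lborel (\<lambda>z. indicator fund z *\<^sub>R h (gmul z g))" "integrable lborel (\<lambda>z. indicator fund z *\<^sub>R h z)"
    using h hg by (auto intro!: integrable_on_bounded bounded_fund)
  have "(\<integral>z. indicator fund z * Re (h (gmul z g)) \<partial>lborel) = (\<integral>z. indicator fund z * Re (h z) \<partial>lborel)"
    by (rule quotient_integral_right_translate_real) (use h inv in \<open>auto simp: invariant_def intro!: continuous_intros\<close>)
  moreover have "(\<integral>z. indicator fund z * Im (h (gmul z g)) \<partial>lborel) = (\<integral>z. indicator fund z * Im (h z) \<partial>lborel)"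
    by (rule quotient_integral_right_translate_real) (use h inv in \<open>auto simp: invariant_def intro!: continuous_intros\<close>)
  ultimately show ?thesis
    unfolding quotient_integral_def set_lebesgue_integral_def
    using integral_Re[OF i(1)] integral_Re[OF i(2)] integral_Im[OF i(1)] integral_Im[OF i(2)]
    by (intro complex_eqI) auto
qed

text \<open>Since left translations are affine, \<open>gmul z (s *\<^sub>R v) = z + s *\<^sub>R lact z v\<close>. The derivative
  in direction \<open>lact z v\<close> is therefore the limit of difference quotients along right translations,
  and each of these has integral zero. On a bounded fundamental domain the mean value theorem
  dominates them.\<close>

lemma quotient_integral_derivative:
  fixes h :: "complex^4 \<Rightarrow> complex"
  assumes h: "smooth h" and inv: "invariant h"
  shows "quotient_integral (\<lambda>z. frechet_derivative h (at z) (lact z v)) = 0"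
proof -
  let ?D = "\<lambda>z. frechet_derivative h (at z)"
  have D: "(h has_derivative ?D z) (at z)" for z by (rule smooth_has_derivative[OF h])
  have cD: "continuous_on UNIV (\<lambda>z. ?D z w)" for w
    by (intro smooth_imp_continuous_on smooth_frechet_derivative h)
  have clact: "continuous_on UNIV (\<lambda>z. lact z v)"
    unfolding lact_def by (intro continuous_intros)
  have ch: "continuous_on UNIV h" by (intro smooth_imp_continuous_on h)
  have Dsum: "?D z w = (\<Sum>b\<in>Basis. (w \<bullet> b) *\<^sub>R ?D z b)" for z w
    by (rule frechet_derivative_Basis[OF h])
  have cDl: "continuous_on UNIV (\<lambda>z. ?D z (lact z v))"
    by (subst Dsum) (intro continuous_intros cD clact)
  have "compact ((\<lambda>z. lact z v) ` closure fund)"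
    by (intro compact_continuous_image continuous_on_subset[OF clact]) (auto simp: bounded_fund)
  then obtain C where "C > 0" "\<forall>x\<in>(\<lambda>z. lact z v) ` closure fund. norm x \<le> C"
    using compact_imp_bounded bounded_pos by blast
  then have C: "\<And>z. z \<in> fund \<Longrightarrow> norm (lact z v) \<le> C" "C > 0"
    using closure_subset by blast+
  obtain R where R: "\<And>z. z \<in> fund \<Longrightarrow> norm z \<le> R"
    using bounded_fund by (auto simp: bounded_iff)
  define S where "S = cball (0::complex^4) (R + C)"
  define B where "B z = (\<Sum>b\<in>Basis. norm (?D z b))" for z
  have "compact (B ` S)"
    unfolding B_def S_def
    by (intro compact_continuous_image continuous_intros continuous_on_subset[OF cD]) auto
  then obtain M where "\<forall>x\<in>B ` S. norm x \<le> M"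
    using compact_imp_bounded bounded_iff by blast
  then have M: "B z \<le> M" if "z \<in> S" for z
    using that by (auto dest: bspec)
  have onormD: "onorm (?D z) \<le> M" if "z \<in> S" for z
  proof (rule onorm_le)
    fix w
    have "norm (?D z w) \<le> (\<Sum>b\<in>Basis. norm ((w \<bullet> b) *\<^sub>R ?D z b))"
      by (subst Dsum) (rule norm_sum)
    also have "\<dots> \<le> (\<Sum>b\<in>Basis. norm (?D z b) * norm w)"
      by (rule sum_mono) (simp add: mult.commute Basis_le_norm mult_right_mono)
    also have "\<dots> = B z * norm w" by (simp add: B_def sum_distrib_right)
    also have "\<dots> \<le> M * norm w" using M[OF that] by (simp add: mult_right_mono)
    finally show "norm (?D z w) \<le> M * norm w" .
  qed
  define Q where "Q n z = real (Suc n) *\<^sub>R (h (z + (1 / real (Suc n)) *\<^sub>R lact z v) - h z)" for n z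
  have meanQ: "(\<integral>z. indicator fund z *\<^sub>R Q n z \<partial>lborel) = 0" for n
  proof -
    have e: "h (z + (1 / real (Suc n)) *\<^sub>R lact z v) = h (gmul z ((1 / real (Suc n)) *\<^sub>R v))" for z
      by (simp add: gmul_affine lact_scaleR)
    have hg: "continuous_on UNIV (\<lambda>z. h (gmul z g))" for g
      by (intro continuous_on_compose2[OF ch] continuous_intros) auto
    let ?g = "(1 / real (Suc n)) *\<^sub>R v"
    have "(\<integral>z. indicator fund z *\<^sub>R Q n z \<partial>lborel) = quotient_integral (\<lambda>z. real (Suc n) * (h (gmul z ?g) + (- 1) * h z))"
      unfolding quotient_integral_def set_lebesgue_integral_def Q_def e
      by (simp add: scaleR_conv_of_real)
    also have "\<dots> = real (Suc n) * (quotient_integral (\<lambda>z. h (gmul z ?g)) + (- 1) * quotient_integral h)"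
      unfolding quotient_integral_cmult by (subst quotient_integral_add) (auto intro!: hg ch continuous_intros simp only: quotient_integral_cmult)
    also have "\<dots> = 0" using quotient_integral_right_translate[OF ch inv] by simp
    finally show ?thesis .
  qed
  have "(\<lambda>n. \<integral>z. indicator fund z *\<^sub>R Q n z \<partial>lborel) \<longlonglongrightarrow> (\<integral>z. indicator fund z *\<^sub>R ?D z (lact z v) \<partial>lborel)"
  proof (rule integral_dominated_convergence[where w = "\<lambda>z. indicator fund z *\<^sub>R (M * C)"])
    show "(\<lambda>z. indicator fund z *\<^sub>R ?D z (lact z v)) \<in> borel_measurable lborel"
      using borel_measurable_continuous_onI[OF cDl] by simp
    show "(\<lambda>z. indicator fund z *\<^sub>R Q n z) \<in> borel_measurable lborel" for n
    proof -
      have "continuous_on UNIV (Q n)"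
        unfolding Q_def by (intro continuous_intros continuous_on_compose2[OF ch] clact) auto
      then have [measurable]: "Q n \<in> borel_measurable borel" by (rule borel_measurable_continuous_onI)
      show ?thesis by simp
    qed
    show "integrable lborel (\<lambda>z. indicator fund z *\<^sub>R (M * C))"
      by (rule integrable_on_bounded) (auto simp: bounded_fund)
    show "AE z in lborel. (\<lambda>n. indicator fund z *\<^sub>R Q n z) \<longlonglongrightarrow> indicator fund z *\<^sub>R ?D z (lact z v)"
    proof (intro AE_I2 tendsto_intros)
      fix z
      have "((\<lambda>s::real. h (z + s *\<^sub>R lact z v)) has_derivative (\<lambda>s. ?D z (s *\<^sub>R lact z v))) (at 0)"
        by (rule has_derivative_compose[where g = h])
           (auto intro!: derivative_eq_intros simp: D)
      then have "((\<lambda>s::real. h (z + s *\<^sub>R lact z v)) has_vector_derivative ?D z (lact z v)) (at 0)"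
        unfolding has_vector_derivative_def
        by (simp add: linear_scale[OF has_derivative_linear[OF D]])
      then have lim: "((\<lambda>s. norm (h (z + s *\<^sub>R lact z v) - h z - s *\<^sub>R ?D z (lact z v)) / \<bar>s\<bar>) \<longlongrightarrow> 0) (at (0::real))"
        by (simp add: has_vector_derivative_def has_derivative_iff_norm)
      have "((\<lambda>s::real. norm ((h (z + s *\<^sub>R lact z v) - h z) /\<^sub>R s - ?D z (lact z v))) \<longlongrightarrow> 0) (at 0)"
      proof (rule Lim_transform_eventually[OF lim])
        have "norm (h (z + s *\<^sub>R lact z v) - h z - s *\<^sub>R ?D z (lact z v)) / \<bar>s\<bar> =
            norm ((h (z + s *\<^sub>R lact z v) - h z) /\<^sub>R s - ?D z (lact z v))" if "s \<noteq> 0" for s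
        proof -
          have "(h (z + s *\<^sub>R lact z v) - h z) /\<^sub>R s - ?D z (lact z v) =
            inverse s *\<^sub>R (h (z + s *\<^sub>R lact z v) - h z - s *\<^sub>R ?D z (lact z v))"
            using that by (simp add: scaleR_right_diff_distrib)
          then show ?thesis by (simp only: norm_scaleR) (simp add: divide_inverse mult.commute)
        qed
        then show "\<forall>\<^sub>F s in at 0. norm (h (z + s *\<^sub>R lact z v) - h z - s *\<^sub>R ?D z (lact z v)) / \<bar>s\<bar> =
            norm ((h (z + s *\<^sub>R lact z v) - h z) /\<^sub>R s - ?D z (lact z v))"
          by (simp add: eventually_at_filter)
      qed
      then have "((\<lambda>s::real. (h (z + s *\<^sub>R lact z v) - h z) /\<^sub>R s) \<longlongrightarrow> ?D z (lact z v)) (at 0)"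
        by (rule Lim_null[THEN iffD2, OF tendsto_norm_zero_cancel])
      moreover have "filterlim (\<lambda>n. 1 / real (Suc n)) (at 0) sequentially"
        using LIMSEQ_inverse_real_of_nat by (simp add: filterlim_at inverse_eq_divide)
      ultimately have "((\<lambda>n. (h (z + (1 / real (Suc n)) *\<^sub>R lact z v) - h z) /\<^sub>R (1 / real (Suc n))) \<longlonglongrightarrow> ?D z (lact z v))"
        by (rule filterlim_compose)
      then show "(\<lambda>n. Q n z) \<longlonglongrightarrow> ?D z (lact z v)"
        by (simp add: Q_def)
    qed
    show "AE z in lborel. norm (indicator fund z *\<^sub>R Q n z) \<le> indicator fund z *\<^sub>R (M * C)" for n
    proof (intro AE_I2)
      fix z
      show "norm (indicator fund z *\<^sub>R Q n z) \<le> indicator fund z *\<^sub>R (M * C)"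
      proof (cases "z \<in> fund")
        case True
        let ?s = "1 / real (Suc n)"
        have le: "norm (?s *\<^sub>R lact z v) \<le> ?s * C"
          using C(1)[OF True] by (simp add: divide_right_mono)
        also have "\<dots> \<le> 1 * C" by (rule mult_right_mono) (use C in auto)
        finally have inS: "z \<in> S" "z + ?s *\<^sub>R lact z v \<in> S"
          using R[OF True] norm_triangle_ineq[of z "?s *\<^sub>R lact z v"] C(2) by (auto simp: S_def)
        have "norm (h (z + ?s *\<^sub>R lact z v) - h z) \<le> M * norm (z + ?s *\<^sub>R lact z v - z)"
          by (rule differentiable_bound[of S h ?D])
             (use inS D onormD in \<open>auto simp: S_def intro: has_derivative_at_withinI\<close>)
        also have "\<dots> = M * norm (?s *\<^sub>R lact z v)" by simp
        also have "\<dots> \<le> M * (?s * C)"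
        proof (rule mult_left_mono[OF le])
          have "0 \<le> B z" by (auto simp: B_def intro: sum_nonneg)
          then show "0 \<le> M" using M[OF inS(1)] by linarith
        qed
        finally have "real (Suc n) * norm (h (z + ?s *\<^sub>R lact z v) - h z) \<le> real (Suc n) * (M * (?s * C))"
          by (rule mult_left_mono) simp
        then show ?thesis using True by (simp add: Q_def)
      qed simp
    qed
  qed
  then show ?thesis
    unfolding meanQ quotient_integral_def set_lebesgue_integral_def
    by (simp add: LIMSEQ_const_iff)
qed

text \<open>The function vanishes almost everywhere on the fundamental domain, hence by invariance
  almost everywhere on its countably many translates, which cover the group; a continuous function
  that vanishes almost everywhere is zero.\<close>

lemma quotient_integral_nonneg_eq_0:
  fixes h :: "complex^4 \<Rightarrow> complex"
  assumes c: "continuous_on UNIV h" and inv: "invariant h" and pos: "\<And>z. 0 \<le> Re (h z)" "\<And>z. Im (h z) = 0"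
    and zero: "quotient_integral h = 0"
  shows "h z = 0"
proof -
  have [measurable]: "h \<in> borel_measurable borel" using c by (rule borel_measurable_continuous_onI)
  have i: "integrable lborel (\<lambda>z. indicator fund z *\<^sub>R h z)"
    by (intro integrable_on_bounded c fund_borel bounded_fund)
  have z0: "(\<integral>z. Re (indicator fund z *\<^sub>R h z) \<partial>lborel) = 0"
    unfolding integral_Re[OF i] using zero by (simp add: quotient_integral_def set_lebesgue_integral_def)
  have nn: "AE z in lborel. 0 \<le> Re (indicator fund z *\<^sub>R h z)"
    by (rule AE_I2) (simp add: pos)
  have "AE z in lborel. Re (indicator fund z *\<^sub>R h z) = 0"
    by (rule integral_nonneg_eq_0_iff_AE[OF integrable_Re[OF i] nn, THEN iffD1, OF z0])
  then have ae: "AE z in lborel. z \<in> fund \<longrightarrow> h z = 0"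
    by (rule eventually_mono) (auto simp: complex_eq_iff pos)
  have "AE z in lborel. gmul y z \<in> fund \<longrightarrow> h (gmul y z) = 0" for y
  proof -
    have m: "gmul y \<in> lborel \<rightarrow>\<^sub>M borel" by simp
    have "AE z in distr lborel borel (gmul y). z \<in> fund \<longrightarrow> h z = 0"
      using ae volume_preserving_gmul_left[of y] unfolding volume_preserving_def by metis
    from AE_distrD[OF m this] show ?thesis .
  qed
  then have "AE z in lborel. \<forall>y\<in>\<Gamma>. gmul y z \<in> fund \<longrightarrow> h (gmul y z) = 0"
    using countable_lattice by (subst AE_ball_countable) auto
  then have ae0: "AE z in lborel. h z = 0"
  proof (rule eventually_mono)
    fix z assume a: "\<forall>y\<in>\<Gamma>. gmul y z \<in> fund \<longrightarrow> h (gmul y z) = 0"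
    obtain y where "y \<in> \<Gamma>" "gmul y z \<in> fund" using fund_ex1 by blast
    then show "h z = 0" using a inv by (metis invariant_def)
  qed
  have "open {z. h z \<noteq> 0}"
    by (rule open_Collect_neq) (use c in auto)
  moreover have "{z. h z \<noteq> 0} \<in> null_sets lborel"
    by (subst AE_iff_null_sets) (use \<open>open {z. h z \<noteq> 0}\<close> ae0 in auto)
  then have "negligible {z. h z \<noteq> 0}"
    unfolding negligible_iff_null_sets by (rule null_sets_completionI)
  ultimately have "{z. h z \<noteq> 0} = {}" using open_not_negligible by blast
  then show ?thesis by blast
qed

end

section \<open>A frame in which the coefficients of dbar are constant\<close>

text \<open>The (0,1)-forms \<open>tilde_form\<close>, written out in coordinates, together with the conjugate of
  the fourth member of the coframe.\<close>

definition theta :: "4 \<Rightarrow> complex^4 \<Rightarrow> complex^4 \<Rightarrow> complex" where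
  "theta j z v = vector [cnj (v$1), exp (z$1) * cnj (v$2), exp (- (z$1)) * cnj (v$3),
     cnj (v$4 - 1/2 * z$2 * v$3 + 1/2 * z$3 * v$2)] $ j"

text \<open>The forms \<open>theta\<close> are conjugate linear, so the dual vectors carry the conjugate of the
  inverse exponential factors.\<close>

definition dual_frame :: "4 \<Rightarrow> complex^4 \<Rightarrow> complex^4" where
  "dual_frame j z = vector
     [vector [1, 0, 0, 0],
      vector [0, exp (- cnj (z$1)), 0, - (1/2) * exp (- cnj (z$1)) * z$3],
      vector [0, 0, exp (cnj (z$1)), 1/2 * exp (cnj (z$1)) * z$2],
      vector [0, 0, 0, 1]] $ j"

lemma forall_4I: "P 1 \<Longrightarrow> P 2 \<Longrightarrow> P 3 \<Longrightarrow> P 4 \<Longrightarrow> P (j::4)"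
  using forall_4 by metis

lemma theta_conj_linear: "theta j z (a *s v + w) = cnj a * theta j z v + theta j z w"
  by (rule forall_4I[of _ j]) (simp_all add: theta_def field_simps)

lemma theta_0 [simp]: "theta j z 0 = 0"
  by (rule forall_4I[of _ j]) (simp_all add: theta_def)

lemma theta_smult: "theta j z (a *s v) = cnj a * theta j z v"
  using theta_conj_linear[of j z a v 0] by simp

lemma theta_dual_frame: "theta i z (dual_frame j z) = (if i = j then 1 else 0)"
  by (rule forall_4I[of _ i]; rule forall_4I[of _ j]) (simp_all add: theta_def dual_frame_def exp_minus exp_cnj field_simps)

lemma dual_frame_expansion: "(\<Sum>j\<in>UNIV. cnj (theta j z v) *s dual_frame j z) = v"
  by (simp add: sum_4 theta_def dual_frame_def vec_eq_iff forall_4 exp_minus exp_cnj field_simps)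

lemma smooth_divide [smooth_intros]: "smooth f \<Longrightarrow> smooth (\<lambda>z. f z / (c::complex))"
  unfolding divide_inverse by (intro smooth_intros)

lemma smooth_theta [smooth_intros]: "smooth v \<Longrightarrow> smooth (\<lambda>z. theta j z (v z))"
  by (rule forall_4I[of _ j]) (simp_all add: theta_def, (intro smooth_intros; assumption)+)

lemma smooth_dual_frame [smooth_intros]: "smooth (dual_frame j)"
  by (rule forall_4I[of _ j]) (simp_all add: dual_frame_def[abs_def], (intro smooth_intros)+)

lemma smooth_lact [smooth_intros]: "smooth y \<Longrightarrow> smooth v \<Longrightarrow> smooth (\<lambda>z. lact (y z) (v z))"
  unfolding lact_def by (intro smooth_intros)

lemma smooth_ginv [smooth_intros]: "smooth y \<Longrightarrow> smooth (\<lambda>z. ginv (y z))"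
  unfolding ginv_def by (intro smooth_intros)

lemma lact_0 [simp]: "lact 0 v = v" "lact y 0 = 0"
  by (simp_all add: lact_def vec_eq_iff forall_4)

lemma lact_ginv [simp]: "lact (ginv z) (lact z v) = v" "lact z (lact (ginv z) v) = v"
  by (simp_all flip: lact_gmul)

lemma lact_sum: "lact z (\<Sum>i\<in>A. f i) = (\<Sum>i\<in>A. lact z (f i))"
  by (rule linear_sum) (simp add: bounded_linear.linear bounded_linear_lact)

lemma lact_minus: "lact z (- v) = - lact z v"
  using lact_smult[of z "-1" v] by simp

lemma lact_diff: "lact z (v - w) = lact z v - lact z w"
  using lact_add[of z v "- w"] by (simp add: lact_minus)

lemma coframe_lact: "coframe i z (lact z f) = f $ i"
  by (rule forall_4I[of _ i]) (simp_all add: coframe_def lact_def exp_minus field_simps)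

lemma lact_eq_frame: "lact z f = (\<Sum>i\<in>UNIV. f $ i *s frame i z)"
  by (simp add: sum_4 lact_def frame_def vec_eq_iff forall_4 field_simps)

lemma frame_eq_lact: "frame i z = lact z (axis i 1)"
  unfolding frame_def lact_def by (rule forall_4I[of _ i]) (simp_all add: vec_eq_iff forall_4)

text \<open>The factor of modulus one between \<open>theta\<close> and the conjugate coframe; it is what makes
  both frames unitary for the same metric.\<close>

definition phase :: "4 \<Rightarrow> complex^4 \<Rightarrow> complex" where
  "phase j z = vector [1, exp (z$1 - cnj (z$1)), exp (cnj (z$1) - z$1), 1] $ j"

lemma phase_unit: "phase j z * cnj (phase j z) = 1"
  by (rule forall_4I[of _ j]) (simp_all add: phase_def exp_cnj flip: exp_add)

lemma theta_frame: "theta i z (frame j z) = (if i = j then phase j z else 0)"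
  by (rule forall_4I[of _ i]; rule forall_4I[of _ j])
     (simp_all add: theta_def frame_def phase_def exp_cnj exp_diff exp_minus field_simps)

lemma dual_frame_eq_frame: "dual_frame j z = phase j z *s frame j z"
  by (rule forall_4I[of _ j])
     (simp_all add: dual_frame_def frame_def phase_def vec_eq_iff forall_4 exp_cnj exp_diff exp_minus field_simps)

section \<open>Derivatives of the frame\<close>

lemma has_derivative_vector4:
  assumes "(a has_derivative a') F" "(b has_derivative b') F" "(c has_derivative c') F" "(d has_derivative d') F"
  shows "((\<lambda>z. vector [a z, b z, c z, d z] :: complex^4) has_derivative
      (\<lambda>v. vector [a' v, b' v, c' v, d' v])) F"
  unfolding vector4_eq_sum using assms
  by (intro has_derivative_add
      bounded_linear.has_derivative[OF bounded_bilinear.bounded_linear_left[OF bounded_bilinear_smult]])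

lemma has_derivative_cexp:
  fixes f :: "'a::real_normed_vector \<Rightarrow> complex"
  assumes "(f has_derivative f') (at z)"
  shows "((\<lambda>x. exp (f x)) has_derivative (\<lambda>v. exp (f z) * f' v)) (at z)"
  using has_derivative_compose[OF assms DERIV_exp[THEN has_field_derivative_imp_has_derivative]] .

lemma has_derivative_nth: "(f has_derivative f') F \<Longrightarrow> ((\<lambda>x. f x $ i) has_derivative (\<lambda>v. f' v $ i)) F"
  by (rule bounded_linear.has_derivative[OF bounded_linear_vec_nth])

text \<open>The derivative of \<open>y \<mapsto> lact y f\<close> at the identity in direction \<open>x\<close>.\<close>

definition lact_deriv :: "complex^4 \<Rightarrow> complex^4 \<Rightarrow> complex^4" where
  "lact_deriv x f = vector [0, - (x$1) * f$2, x$1 * f$3, (x$2 * f$3 - x$3 * f$2) / 2]"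

text \<open>By \<open>lact_gmul\<close> the derivative at \<open>z\<close> is the one at the identity transported by \<open>lact z\<close>,
  once the direction \<open>v\<close> is written as \<open>lact z\<close> of its components.\<close>

lemma has_derivative_lact:
  assumes g: "(g has_derivative g') (at z)"
  shows "((\<lambda>x. lact x (g x)) has_derivative
     (\<lambda>v. lact z (lact_deriv (lact (ginv z) v) (g z)) + lact z (g' v))) (at z)"
proof -
  have "((\<lambda>x. lact x (g x)) has_derivative (\<lambda>v. vector
     [g' v $ 1,
      exp (- (z$1)) * g' v $ 2 + (exp (- (z$1)) * (- (v$1))) * g z $ 2,
      exp (z$1) * g' v $ 3 + (exp (z$1) * v$1) * g z $ 3,
      g' v $ 4 + ((1/2 * exp (z$1) * z$2) * g' v $ 3 + ((1/2 * exp (z$1)) * v$2 + (1/2 * (exp (z$1) * v$1)) * z$2) * g z $ 3)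
       - ((1/2 * exp (- (z$1)) * z$3) * g' v $ 2 + ((1/2 * exp (- (z$1))) * v$3 + (1/2 * (exp (- (z$1)) * - (v$1))) * z$3) * g z $ 2)])) (at z)"
    unfolding lact_def
    by (intro has_derivative_vector4 has_derivative_add has_derivative_diff has_derivative_mult
        has_derivative_cexp has_derivative_nth g has_derivative_minus has_derivative_ident
        has_derivative_mult_right)
  also have "(\<lambda>v. vector
     [g' v $ 1,
      exp (- (z$1)) * g' v $ 2 + (exp (- (z$1)) * (- (v$1))) * g z $ 2,
      exp (z$1) * g' v $ 3 + (exp (z$1) * v$1) * g z $ 3,
      g' v $ 4 + ((1/2 * exp (z$1) * z$2) * g' v $ 3 + ((1/2 * exp (z$1)) * v$2 + (1/2 * (exp (z$1) * v$1)) * z$2) * g z $ 3)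
       - ((1/2 * exp (- (z$1)) * z$3) * g' v $ 2 + ((1/2 * exp (- (z$1))) * v$3 + (1/2 * (exp (- (z$1)) * - (v$1))) * z$3) * g z $ 2)]) =
     (\<lambda>v. lact z (lact_deriv (lact (ginv z) v) (g z)) + lact z (g' v))"
    by (simp add: fun_eq_iff lact_def lact_deriv_def ginv_def vec_eq_iff forall_4 exp_minus field_simps)
  finally show ?thesis .
qed

text \<open>The complex linear and the conjugate linear part, in the direction \<open>v\<close>, of the derivative
  of \<open>theta j z w\<close> in \<open>z\<close>. The second one is nonzero only for the fourth form, which is why that form
  is the only one that is not closed.\<close>

definition theta_d10 :: "4 \<Rightarrow> complex^4 \<Rightarrow> complex^4 \<Rightarrow> complex^4 \<Rightarrow> complex" where
  "theta_d10 j z w v = v$1 * vector [0, theta 2 z w, - theta 3 z w, 0] $ j"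

definition theta_d01 :: "4 \<Rightarrow> complex^4 \<Rightarrow> complex^4 \<Rightarrow> complex^4 \<Rightarrow> complex" where
  "theta_d01 j z w v = (if j = 4 then 1/2 * theta 3 z v * theta 2 z w - 1/2 * theta 2 z v * theta 3 z w else 0)"

lemma has_derivative_theta:
  "((\<lambda>x. theta j x w) has_derivative (\<lambda>v. theta_d10 j z w v + theta_d01 j z w v)) (at z)"
proof (rule forall_4I[of _ j])
  show "((\<lambda>x. theta 1 x w) has_derivative (\<lambda>v. theta_d10 1 z w v + theta_d01 1 z w v)) (at z)"
    by (simp add: theta_def theta_d10_def theta_d01_def)
  have "((\<lambda>x. exp (x$1) * cnj (w$2)) has_derivative (\<lambda>v. (exp (z$1) * v$1) * cnj (w$2))) (at z)"
    by (intro has_derivative_mult_left has_derivative_cexp has_derivative_nth has_derivative_ident)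
  then show "((\<lambda>x. theta 2 x w) has_derivative (\<lambda>v. theta_d10 2 z w v + theta_d01 2 z w v)) (at z)"
    by (simp add: theta_def theta_d10_def theta_d01_def mult_ac)
  have "((\<lambda>x. exp (- (x$1)) * cnj (w$3)) has_derivative (\<lambda>v. (exp (- (z$1)) * - (v$1)) * cnj (w$3))) (at z)"
    by (intro has_derivative_mult_left has_derivative_cexp has_derivative_minus has_derivative_nth has_derivative_ident)
  then show "((\<lambda>x. theta 3 x w) has_derivative (\<lambda>v. theta_d10 3 z w v + theta_d01 3 z w v)) (at z)"
    by (simp add: theta_def theta_d10_def theta_d01_def mult_ac)
  have "((\<lambda>x. cnj (w$4 - 1/2 * x$2 * w$3 + 1/2 * x$3 * w$2)) has_derivative
     (\<lambda>v. cnj (0 - 1/2 * v$2 * w$3 + 1/2 * v$3 * w$2))) (at z)"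
    by (intro bounded_linear.has_derivative[OF bounded_linear_cnj] has_derivative_add has_derivative_diff
        has_derivative_const has_derivative_mult_left has_derivative_mult_right
        has_derivative_nth has_derivative_ident)
  then show "((\<lambda>x. theta 4 x w) has_derivative (\<lambda>v. theta_d10 4 z w v + theta_d01 4 z w v)) (at z)"
    by (simp add: theta_def theta_d10_def theta_d01_def exp_minus field_simps)
qed

lemma D01_eqI: "(f has_derivative f') (at z) \<Longrightarrow>
   D01 f z v = (1/2) *\<^sub>R (f' v + \<i> *s f' (\<i> *s v))"
  unfolding D01_def by (metis frechet_derivative_at)

lemma D10_eqI: "(f has_derivative f') (at z) \<Longrightarrow>
   D10 f z v = (1/2) *\<^sub>R (f' v - \<i> *s f' (\<i> *s v))"
  unfolding D10_def by (metis frechet_derivative_at)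

lemma lact_deriv_smult: "lact_deriv (c *s x) f = c *s lact_deriv x f"
  by (simp add: lact_deriv_def vec_eq_iff forall_4 field_simps)

text \<open>The frame of the holomorphic tangent bundle is holomorphic, so \<open>D01\<close> acts on components.\<close>

lemma D01_lact: assumes "smooth g" shows "D01 (\<lambda>x. lact x (g x)) z v = lact z (D01 g z v)"
  unfolding D01_eqI[OF has_derivative_lact[OF smooth_has_derivative[OF assms]]] D01_def
  by (simp add: lact_smult lact_deriv_smult lact_add lact_scaleR vector_add_ldistrib vector_smult_assoc)

lemma D10_lact: assumes "smooth g"
  shows "D10 (\<lambda>x. lact x (g x)) z v = lact z (lact_deriv (lact (ginv z) v) (g z) + D10 g z v)"
  unfolding D10_eqI[OF has_derivative_lact[OF smooth_has_derivative[OF assms]]] D10_def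
  by (simp add: lact_smult lact_deriv_smult lact_add lact_diff lact_scaleR vector_add_ldistrib vector_smult_assoc
      scaleR_right_diff_distrib scaleR_right_distrib flip: scaleR_add_left)

lemma D01_theta_smult:
  assumes "smooth f"
  shows "D01 (\<lambda>x. theta j x w *s f x) z v = theta_d01 j z w v *s f z + theta j z w *s D01 f z v"
  unfolding D01_eqI[OF bounded_bilinear.FDERIV[OF bounded_bilinear_smult has_derivative_theta
        smooth_has_derivative[OF assms]]] D01_def
  by (simp add: theta_d10_def theta_d01_def theta_smult vec_eq_iff scaleR_conv_of_real[where 'a=complex] field_simps)

lemma D10_theta_smult:
  assumes "smooth f"
  shows "D10 (\<lambda>x. theta j x w *s f x) z v = theta_d10 j z w v *s f z + theta j z w *s D10 f z v"
  unfolding D10_eqI[OF bounded_bilinear.FDERIV[OF bounded_bilinear_smult has_derivative_theta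
        smooth_has_derivative[OF assms]]] D10_def
  by (simp add: theta_d10_def theta_d01_def theta_smult vec_eq_iff scaleR_conv_of_real[where 'a=complex] field_simps)

lemma D01_add: "smooth f \<Longrightarrow> smooth g \<Longrightarrow> D01 (\<lambda>x. f x + g x) z v = D01 f z v + D01 g z v"
  by (subst D01_eqI[OF has_derivative_add[OF smooth_has_derivative smooth_has_derivative]])
     (simp_all add: D01_def vec_eq_iff field_simps)

lemma D10_add: "smooth f \<Longrightarrow> smooth g \<Longrightarrow> D10 (\<lambda>x. f x + g x) z v = D10 f z v + D10 g z v"
  by (subst D10_eqI[OF has_derivative_add[OF smooth_has_derivative smooth_has_derivative]])
     (simp_all add: D10_def vec_eq_iff field_simps)

lemma D01_const [simp]: "D01 (\<lambda>x. c) z v = 0" and D10_const [simp]: "D10 (\<lambda>x. c) z v = 0"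
  by (simp_all add: D01_eqI[OF has_derivative_const] D10_eqI[OF has_derivative_const])

lemma D01_sum: "(\<And>i. i \<in> A \<Longrightarrow> smooth (f i)) \<Longrightarrow> D01 (\<lambda>x. \<Sum>i\<in>A. f i x) z v = (\<Sum>i\<in>A. D01 (f i) z v)"
  by (induction A rule: infinite_finite_induct) (simp_all add: D01_add smooth_sum)

lemma D10_sum: "(\<And>i. i \<in> A \<Longrightarrow> smooth (f i)) \<Longrightarrow> D10 (\<lambda>x. \<Sum>i\<in>A. f i x) z v = (\<Sum>i\<in>A. D10 (f i) z v)"
  by (induction A rule: infinite_finite_induct) (simp_all add: D10_add smooth_sum)

section \<open>Forms given by components\<close>

definition conj_linear :: "(complex^4 \<Rightarrow> complex^4) \<Rightarrow> bool" where
  "conj_linear \<phi> \<longleftrightarrow> (\<forall>a v w. \<phi> (a *s v + w) = cnj a *s \<phi> v + \<phi> w)"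

lemma conj_linear_add: "conj_linear \<phi> \<Longrightarrow> \<phi> (v + w) = \<phi> v + \<phi> w"
  unfolding conj_linear_def using vector_smult_lid complex_cnj_one by metis

lemma conj_linear_0: "conj_linear \<phi> \<Longrightarrow> \<phi> 0 = 0"
  using conj_linear_add[of \<phi> 0 0] by simp

lemma conj_linear_smult: "conj_linear \<phi> \<Longrightarrow> \<phi> (a *s v) = cnj a *s \<phi> v"
  using conj_linear_0[of \<phi>] unfolding conj_linear_def by (metis add.right_neutral)

lemma conj_linear_sum: "conj_linear \<phi> \<Longrightarrow> \<phi> (\<Sum>i\<in>A. c i *s f i) = (\<Sum>i\<in>A. cnj (c i) *s \<phi> (f i))"
  by (induction A rule: infinite_finite_induct)
     (simp_all add: conj_linear_add conj_linear_0 conj_linear_smult)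

lemma conj_linear_dual_frame: "conj_linear \<phi> \<Longrightarrow> \<phi> v = (\<Sum>j\<in>UNIV. theta j z v *s \<phi> (dual_frame j z))"
  using conj_linear_sum[of \<phi> "\<lambda>j. cnj (theta j z v)" "\<lambda>j. dual_frame j z" UNIV] by (simp add: dual_frame_expansion)

lemma conj_linear_axis: "conj_linear \<phi> \<Longrightarrow> \<phi> v = (\<Sum>j\<in>UNIV. cnj (v $ j) *s \<phi> (axis j 1))"
  using conj_linear_sum[of \<phi> "\<lambda>j. v $ j" "\<lambda>j. axis j 1" UNIV] by (simp add: basis_expansion)

lemma frechet_derivative_smult:
  assumes "smooth f"
  shows "frechet_derivative f (at z) (a *s v) =
    Re a *\<^sub>R frechet_derivative f (at z) v + Im a *\<^sub>R frechet_derivative f (at z) (\<i> *s v)"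
proof -
  have l: "linear (frechet_derivative f (at z))"
    by (rule has_derivative_linear[OF smooth_has_derivative[OF assms]])
  have "a *s v = Re a *\<^sub>R v + Im a *\<^sub>R (\<i> *s v)"
    by (simp add: vec_eq_iff complex_eq_iff)
  then show ?thesis by (simp add: linear_add[OF l] linear_scale[OF l])
qed

lemma conj_linear_D01: assumes "smooth f" shows "conj_linear (D01 f z)"
proof -
  let ?d = "frechet_derivative f (at z)"
  have l: "linear ?d" by (rule has_derivative_linear[OF smooth_has_derivative[OF assms]])
  note d = frechet_derivative_smult[OF assms]
  show ?thesis
    unfolding conj_linear_def D01_def
  proof (intro allI)
    fix a v w
    have "?d (\<i> *s (a *s v)) = - Im a *\<^sub>R ?d v + Re a *\<^sub>R ?d (\<i> *s v)"
      using d[of z "\<i> * a" v] by (simp add: vector_smult_assoc)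
    then have e2: "?d (\<i> *s (a *s v + w)) = (- Im a *\<^sub>R ?d v + Re a *\<^sub>R ?d (\<i> *s v)) + ?d (\<i> *s w)"
      by (simp only: vector_add_ldistrib linear_add[OF l])
    have e1: "?d (a *s v + w) = (Re a *\<^sub>R ?d v + Im a *\<^sub>R ?d (\<i> *s v)) + ?d w"
      by (simp only: linear_add[OF l] d[of z a v])
    show "(1/2) *\<^sub>R (?d (a *s v + w) + \<i> *s ?d (\<i> *s (a *s v + w))) =
       cnj a *s ((1/2) *\<^sub>R (?d v + \<i> *s ?d (\<i> *s v))) + (1/2) *\<^sub>R (?d w + \<i> *s ?d (\<i> *s w))"
      unfolding e1 e2 by (simp add: vec_eq_iff complex_eq_iff field_simps)
  qed
qed

text \<open>Forms with values in the tangent bundle, given by their components with respect to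
  \<open>theta\<close> and the invariant frame. The sums run over all pairs and triples of indices, so for
  alternating components no factor 1/2 or 1/6 appears, and the components are the values of the
  form on \<open>dual_frame\<close>.\<close>

definition form1 :: "(4 \<Rightarrow> complex^4 \<Rightarrow> complex^4) \<Rightarrow> vform" where
  "form1 u z vs = (case vs of [a] \<Rightarrow> lact z (\<Sum>j\<in>UNIV. theta j z a *s u j z) | _ \<Rightarrow> 0)"

definition form2 :: "(4 \<Rightarrow> 4 \<Rightarrow> complex^4 \<Rightarrow> complex^4) \<Rightarrow> vform" where
  "form2 w z vs = (case vs of [a, b] \<Rightarrow>
     lact z (\<Sum>i\<in>UNIV. \<Sum>j\<in>UNIV. (theta i z a * theta j z b) *s w i j z) | _ \<Rightarrow> 0)"

definition form3 :: "(4 \<Rightarrow> 4 \<Rightarrow> 4 \<Rightarrow> complex^4 \<Rightarrow> complex^4) \<Rightarrow> vform" where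
  "form3 x z vs = (case vs of [a, b, c] \<Rightarrow>
     lact z (\<Sum>i\<in>UNIV. \<Sum>j\<in>UNIV. \<Sum>k\<in>UNIV. (theta i z a * theta j z b * theta k z c) *s x i j k z) | _ \<Rightarrow> 0)"

lemma form1_Cons [simp]: "form1 u z [a] = lact z (\<Sum>j\<in>UNIV. theta j z a *s u j z)"
  by (simp add: form1_def)
lemma form2_Cons [simp]: "form2 w z [a, b] = lact z (\<Sum>i\<in>UNIV. \<Sum>j\<in>UNIV. (theta i z a * theta j z b) *s w i j z)"
  by (simp add: form2_def)
lemma form3_Cons [simp]: "form3 x z [a, b, c] = lact z (\<Sum>i\<in>UNIV. \<Sum>j\<in>UNIV. \<Sum>k\<in>UNIV. (theta i z a * theta j z b * theta k z c) *s x i j k z)"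
  by (simp add: form3_def)
lemma form1_other: "length vs \<noteq> 1 \<Longrightarrow> form1 u z vs = 0"
  by (auto simp: form1_def split: list.split)
lemma form2_other: "length vs \<noteq> 2 \<Longrightarrow> form2 w z vs = 0"
  by (auto simp: form2_def split: list.split)
lemma form3_other: "length vs \<noteq> 3 \<Longrightarrow> form3 w z vs = 0"
  by (auto simp: form3_def split: list.split)

lemma length1E: "length vs = 1 \<Longrightarrow> \<exists>a. vs = [a]"
  by (simp add: length_Suc_conv)
lemma length2E: "length vs = 2 \<Longrightarrow> \<exists>a b. vs = [a, b]"
  by (auto simp: length_Suc_conv numeral_2_eq_2)
lemma length3E: "length vs = 3 \<Longrightarrow> \<exists>a b c. vs = [a, b, c]"
  by (auto simp: length_Suc_conv numeral_3_eq_3)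

definition alternating2 :: "(4 \<Rightarrow> 4 \<Rightarrow> 'b \<Rightarrow> complex^4) \<Rightarrow> bool" where
  "alternating2 w \<longleftrightarrow> (\<forall>i j z. w j i z = - w i j z)"

definition alternating3 :: "(4 \<Rightarrow> 4 \<Rightarrow> 4 \<Rightarrow> 'b \<Rightarrow> complex^4) \<Rightarrow> bool" where
  "alternating3 x \<longleftrightarrow> (\<forall>i j k z. x j i k z = - x i j k z \<and> x i k j z = - x i j k z)"

lemma smult_sum: "c *s (\<Sum>i\<in>A. f i :: complex^'n) = (\<Sum>i\<in>A. c *s f i)"
  by (simp add: vec_eq_iff sum_distrib_left)

lemma antisym_sum_zero:
  assumes "\<And>i j::'a::finite. f j i = - (f i j :: complex^4)"
  shows "(\<Sum>i\<in>UNIV. \<Sum>j\<in>UNIV. f i j) = 0"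
proof -
  have "(\<Sum>i\<in>UNIV. \<Sum>j\<in>UNIV. f i j) = (\<Sum>i\<in>UNIV. \<Sum>j\<in>UNIV. f j i)"
    by (rule sum.swap)
  also have "\<dots> = (\<Sum>i\<in>UNIV. \<Sum>j\<in>UNIV. - f i j)"
    by (intro sum.cong refl assms)
  also have "\<dots> = - (\<Sum>i\<in>UNIV. \<Sum>j\<in>UNIV. f i j)" by (simp add: sum_negf)
  finally show ?thesis by (simp add: vec_eq_iff)
qed

lemma conj_linear_slot1:
  assumes "\<And>v. length v \<noteq> 1 \<Longrightarrow> f v = (0::complex^4)" "conj_linear (\<lambda>v. f [v])"
  shows "f (us @ (a *s v + w) # ws) = cnj a *s f (us @ v # ws) + f (us @ w # ws)"
proof (cases "us = [] \<and> ws = []")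
  case True then show ?thesis using assms(2) by (simp add: conj_linear_def)
next
  case False
  then have "f (us @ x # ws) = 0" for x by (intro assms(1)) auto
  then show ?thesis by simp
qed

lemma conj_linear_slot2:
  assumes "\<And>v. length v \<noteq> 2 \<Longrightarrow> f v = (0::complex^4)"
    "\<And>b. conj_linear (\<lambda>v. f [v, b])" "\<And>a. conj_linear (\<lambda>v. f [a, v])"
  shows "f (us @ (a *s v + w) # ws) = cnj a *s f (us @ v # ws) + f (us @ w # ws)"
proof (cases "length us + length ws = 1")
  case True
  then consider b where "us = []" "ws = [b]" | b where "us = [b]" "ws = []"
    using length1E by (metis add_is_1 length_0_conv One_nat_def)
  then show ?thesis using assms(2,3) by cases (simp_all add: conj_linear_def)
next
  case False
  then have "f (us @ x # ws) = 0" for x by (intro assms(1)) auto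
  then show ?thesis by simp
qed

lemma smooth_form1: assumes "\<And>j. smooth (u j)" shows "smooth (\<lambda>z. form1 u z vs)"
proof (cases "length vs = 1")
  case True
  then obtain a where "vs = [a]" using length1E by blast
  then show ?thesis using assms by simp (intro smooth_intros assms)
qed (simp add: form1_other smooth_const)

lemma smooth_form2: assumes "\<And>i j. smooth (w i j)" shows "smooth (\<lambda>z. form2 w z vs)"
proof (cases "length vs = 2")
  case True
  then obtain a b where "vs = [a, b]" using length2E by blast
  then show ?thesis using assms by simp (intro smooth_intros assms)
qed (simp add: form2_other smooth_const)

lemma theta_add: "theta j z (v + w) = theta j z v + theta j z w"
  using theta_conj_linear[of j z 1 v w] by simp

lemmas conj_linear_simps = theta_add theta_smult lact_add algebra_simps
  vector_sadd_rdistrib vector_add_ldistrib vector_smult_assoc sum.distrib smult_sum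

lemma conj_linear_form1: "conj_linear (\<lambda>v. form1 u z [v])"
  by (simp add: conj_linear_def conj_linear_simps flip: lact_smult)

lemma conj_linear_form2: "conj_linear (\<lambda>v. form2 w z [v, b])" "conj_linear (\<lambda>v. form2 w z [a, v])"
  by (simp_all add: conj_linear_def conj_linear_simps flip: lact_smult)

lemma form2_not_distinct: assumes "alternating2 w" "\<not> distinct vs" shows "form2 w z vs = 0"
proof (cases "length vs = 2")
  case True
  then obtain a where vs: "vs = [a, a]" using length2E assms(2) by fastforce
  have "(\<Sum>i\<in>UNIV. \<Sum>j\<in>UNIV. (theta i z a * theta j z a) *s w i j z) = 0"
  proof (rule antisym_sum_zero)
    fix i j
    have "w j i z = - w i j z" using assms(1) unfolding alternating2_def by blast
    then show "(theta j z a * theta i z a) *s w j i z = - ((theta i z a * theta j z a) *s w i j z)"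
      by (simp add: vec_eq_iff mult_ac)
  qed
  then show ?thesis by (simp add: vs)
qed (simp add: form2_other)

section \<open>The operator dbar in components\<close>

text \<open>The derivatives along the conjugate of \<open>dual_frame\<close> and along \<open>dual_frame\<close> itself.\<close>

definition Zbar :: "4 \<Rightarrow> (complex^4 \<Rightarrow> complex^4) \<Rightarrow> complex^4 \<Rightarrow> complex^4" where
  "Zbar i f z = D01 f z (dual_frame i z)"

definition Zhol :: "4 \<Rightarrow> (complex^4 \<Rightarrow> complex^4) \<Rightarrow> complex^4 \<Rightarrow> complex^4" where
  "Zhol i f z = D10 f z (dual_frame i z)"

text \<open>The only nontrivial relation of the frame is \<open>[E\<^sub>2, E\<^sub>3] = E\<^sub>4\<close> for the (0,1)-vectors
  \<open>E\<^sub>j\<close> dual to \<open>theta\<close>, equivalently the differential of the fourth form is minus the product of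
  the second and the third.\<close>

definition struct_const :: "4 \<Rightarrow> 4 \<Rightarrow> complex" where
  "struct_const i j = (if i = 2 \<and> j = 3 then 1 else if i = 3 \<and> j = 2 then - 1 else 0)"

text \<open>The invariant formula for the exterior derivative, with \<open>struct_const\<close> for the brackets of
  the frame.\<close>

definition dbar1 :: "(4 \<Rightarrow> complex^4 \<Rightarrow> complex^4) \<Rightarrow> 4 \<Rightarrow> 4 \<Rightarrow> complex^4 \<Rightarrow> complex^4" where
  "dbar1 u i j z = Zbar i (u j) z - Zbar j (u i) z - struct_const i j *s u 4 z"

definition dbar2 :: "(4 \<Rightarrow> 4 \<Rightarrow> complex^4 \<Rightarrow> complex^4) \<Rightarrow> 4 \<Rightarrow> 4 \<Rightarrow> 4 \<Rightarrow> complex^4 \<Rightarrow> complex^4" where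
  "dbar2 w i j k z = Zbar i (w j k) z - Zbar j (w i k) z + Zbar k (w i j) z
     - struct_const i j *s w 4 k z + struct_const i k *s w 4 j z - struct_const j k *s w 4 i z"

lemma D01_eq_Zbar: "smooth f \<Longrightarrow> D01 f z v = (\<Sum>i\<in>UNIV. theta i z v *s Zbar i f z)"
  unfolding Zbar_def by (rule conj_linear_dual_frame[OF conj_linear_D01])

lemma dbar_other:
  assumes "\<And>x us. Suc (length us) = length vs \<Longrightarrow> \<omega> x us = 0"
  shows "dbar \<omega> z vs = 0"
proof -
  have "\<omega> x (take i vs @ drop (Suc i) vs) = 0" if "i < length vs" for i x
    by (rule assms) (use that in simp)
  then show ?thesis unfolding dbar_def by (intro sum.neutral) simp
qed

lemma D01_form1:
  assumes u: "\<And>j. smooth (u j)"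
  shows "D01 (\<lambda>x. form1 u x [b]) z a =
    lact z (\<Sum>j\<in>UNIV. theta_d01 j z b a *s u j z + theta j z b *s (\<Sum>i\<in>UNIV. theta i z a *s Zbar i (u j) z))"
proof -
  have s: "smooth (\<lambda>x. theta j x b *s u j x)" for j by (intro smooth_intros u)
  show ?thesis
    unfolding form1_Cons
    by (subst D01_lact) (auto intro!: smooth_sum s simp: D01_sum[OF s] D01_theta_smult[OF u] D01_eq_Zbar[OF u])
qed

lemma dbar_form1:
  assumes u: "\<And>j. smooth (u j)"
  shows "dbar (form1 u) = form2 (dbar1 u)"
proof (intro ext)
  fix z vs
  show "dbar (form1 u) z vs = form2 (dbar1 u) z vs"
  proof (cases "length vs = 2")
    case False
    then show ?thesis by (subst dbar_other) (auto simp: form1_other form2_other)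
  next
    case True
    then obtain a b where vs: "vs = [a, b]" using length2E by blast
    have "dbar (form1 u) z vs = D01 (\<lambda>x. form1 u x [b]) z a - D01 (\<lambda>x. form1 u x [a]) z b"
      by (simp add: dbar_def vs numeral_2_eq_2)
    also have "\<dots> = form2 (dbar1 u) z [a, b]"
      unfolding D01_form1[OF u] form2_Cons lact_diff[symmetric]
      by (rule arg_cong[where f = "lact z"])
         (simp add: sum_4 vec_eq_iff theta_d01_def dbar1_def struct_const_def algebra_simps)
    finally show ?thesis by (simp add: vs)
  qed
qed

lemma D01_form2:
  assumes w: "\<And>i j. smooth (w i j)"
  shows "D01 (\<lambda>x. form2 w x [b, c]) z a = lact z (\<Sum>j\<in>UNIV. \<Sum>k\<in>UNIV.
     (theta_d01 j z b a * theta k z c + theta j z b * theta_d01 k z c a) *s w j k z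
     + (theta j z b * theta k z c) *s (\<Sum>i\<in>UNIV. theta i z a *s Zbar i (w j k) z))"
proof -
  have s: "smooth (\<lambda>x. theta k x c *s w j k x)" for j k by (intro smooth_intros w)
  have s2: "smooth (\<lambda>x. theta j x b *s (theta k x c *s w j k x))" for j k by (intro smooth_intros w)
  have s3: "smooth (\<lambda>x. \<Sum>k\<in>UNIV. theta j x b *s (theta k x c *s w j k x))" for j
    by (intro smooth_sum s2)
  have D: "D01 (\<lambda>x. \<Sum>j\<in>UNIV. \<Sum>k\<in>UNIV. theta j x b *s (theta k x c *s w j k x)) z a =
     (\<Sum>j\<in>UNIV. \<Sum>k\<in>UNIV. theta_d01 j z b a *s (theta k z c *s w j k z) +
        theta j z b *s (theta_d01 k z c a *s w j k z + theta k z c *s (\<Sum>i\<in>UNIV. theta i z a *s Zbar i (w j k) z)))"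
    unfolding D01_sum[OF s3] D01_sum[OF s2] D01_theta_smult[OF s] D01_theta_smult[OF w] D01_eq_Zbar[OF w]
    by (rule refl)
  show ?thesis
    unfolding form2_Cons vector_smult_assoc[symmetric]
    by (subst D01_lact, intro smooth_sum s2, subst D)
       (simp add: vector_add_ldistrib vector_sadd_rdistrib vector_smult_assoc add.assoc)
qed

lemma dbar_form2:
  assumes w: "\<And>i j. smooth (w i j)" and as: "alternating2 w"
  shows "dbar (form2 w) = form3 (dbar2 w)"
proof (intro ext)
  fix z vs
  show "dbar (form2 w) z vs = form3 (dbar2 w) z vs"
  proof (cases "length vs = 3")
    case False
    then show ?thesis by (subst dbar_other) (auto simp: form2_other form3_other)
  next
    case True
    then obtain a b c where vs: "vs = [a, b, c]" using length3E by blast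
    have as': "w j i z = - w i j z" for i j using as unfolding alternating2_def by blast
    have w0: "w i i z = 0" for i using as'[of i i] by (simp add: vec_eq_iff)
    define A where "A a b c = (\<Sum>j\<in>UNIV. \<Sum>k\<in>UNIV.
       (theta_d01 j z b a * theta k z c + theta j z b * theta_d01 k z c a) *s w j k z)" for a b c
    define S where "S a b c = (\<Sum>j\<in>UNIV. \<Sum>k\<in>UNIV.
       (theta j z b * theta k z c) *s (\<Sum>i\<in>UNIV. theta i z a *s Zbar i (w j k) z))" for a b c
    have "dbar (form2 w) z vs = D01 (\<lambda>x. form2 w x [b, c]) z a - D01 (\<lambda>x. form2 w x [a, c]) z b
        + D01 (\<lambda>x. form2 w x [a, b]) z c"
      by (simp add: dbar_def vs numeral_3_eq_3)
    also have "\<dots> = lact z ((A a b c - A b a c + A c a b) + (S a b c - S b a c + S c a b))"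
      unfolding D01_form2[OF w] A_def S_def sum.distrib lact_add lact_diff by simp
    also have "A a b c - A b a c + A c a b =
       (\<Sum>i\<in>UNIV. \<Sum>j\<in>UNIV. \<Sum>k\<in>UNIV. (theta i z a * theta j z b * theta k z c) *s
          (- (struct_const i j *s w 4 k z) + struct_const i k *s w 4 j z - struct_const j k *s w 4 i z))"
    proof -
      have "w 1 4 z = - w 4 1 z" "w 2 4 z = - w 4 2 z" "w 3 4 z = - w 4 3 z" by (rule as')+
      then show ?thesis
        by (simp add: A_def sum_4 struct_const_def theta_d01_def w0 vec_eq_iff algebra_simps)
    qed
    also have "S a b c = (\<Sum>i\<in>UNIV. \<Sum>j\<in>UNIV. \<Sum>k\<in>UNIV.
        (theta i z a * theta j z b * theta k z c) *s Zbar i (w j k) z)"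
    proof -
      have "S a b c = (\<Sum>j\<in>UNIV. \<Sum>i\<in>UNIV. \<Sum>k\<in>UNIV.
        (theta i z a * theta j z b * theta k z c) *s Zbar i (w j k) z)"
        unfolding S_def smult_sum
        by (rule sum.cong[OF refl], subst sum.swap) (simp add: vector_smult_assoc mult_ac)
      then show ?thesis by (subst sum.swap)
    qed
    also have "S b a c = (\<Sum>i\<in>UNIV. \<Sum>j\<in>UNIV. \<Sum>k\<in>UNIV.
        (theta i z a * theta j z b * theta k z c) *s Zbar j (w i k) z)"
      unfolding S_def smult_sum
      by (rule sum.cong[OF refl], subst sum.swap) (simp add: vector_smult_assoc mult_ac)
    also have "S c a b = (\<Sum>i\<in>UNIV. \<Sum>j\<in>UNIV. \<Sum>k\<in>UNIV.
        (theta i z a * theta j z b * theta k z c) *s Zbar k (w i j) z)"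
      unfolding S_def smult_sum by (simp add: vector_smult_assoc mult_ac)
    also have "lact z ((\<Sum>i\<in>UNIV. \<Sum>j\<in>UNIV. \<Sum>k\<in>UNIV. (theta i z a * theta j z b * theta k z c) *s
          (- (struct_const i j *s w 4 k z) + struct_const i k *s w 4 j z - struct_const j k *s w 4 i z))
       + ((\<Sum>i\<in>UNIV. \<Sum>j\<in>UNIV. \<Sum>k\<in>UNIV. (theta i z a * theta j z b * theta k z c) *s Zbar i (w j k) z)
        - (\<Sum>i\<in>UNIV. \<Sum>j\<in>UNIV. \<Sum>k\<in>UNIV. (theta i z a * theta j z b * theta k z c) *s Zbar j (w i k) z)
        + (\<Sum>i\<in>UNIV. \<Sum>j\<in>UNIV. \<Sum>k\<in>UNIV. (theta i z a * theta j z b * theta k z c) *s Zbar k (w i j) z)))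
       = form3 (dbar2 w) z vs"
      unfolding vs form3_Cons dbar2_def
      by (rule arg_cong[where f = "lact z"])
         (simp add: sum.distrib sum_subtractf sum_negf vector_add_ldistrib vector_ssub_ldistrib algebra_simps)
    finally show ?thesis .
  qed
qed

section \<open>The pointwise metric in components\<close>

lemma sum_lists_0: "(\<Sum>js | length js = 0. f js) = f []"
  by simp

lemma sum_lists_Suc:
  "(\<Sum>js | length js = Suc n. f js) = (\<Sum>j\<in>(UNIV :: 'a::finite set). \<Sum>js | length js = n. f (j # js))"
proof -
  have "(\<Sum>js | length js = Suc n. f js) = (\<Sum>p\<in>(UNIV :: 'a set) \<times> {js. length js = n}. f (fst p # snd p))"
    by (rule sum.reindex_bij_witness[of _ "\<lambda>p. fst p # snd p" "\<lambda>l. (hd l, tl l)"])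
       (auto simp: length_Suc_conv)
  also have "\<dots> = (\<Sum>j\<in>(UNIV :: 'a set). \<Sum>js | length js = n. f (j # js))"
    by (subst sum.cartesian_product) (simp add: case_prod_beta)
  finally show ?thesis .
qed

definition herm :: "complex^4 \<Rightarrow> complex^4 \<Rightarrow> complex" where
  "herm a b = (\<Sum>i\<in>UNIV. a $ i * cnj (b $ i))"

lemma herm_phase: "c * cnj c = 1 \<Longrightarrow> herm (c *s a) (c *s b) = herm a b"
proof -
  assume c: "c * cnj c = 1"
  have "herm (c *s a) (c *s b) = (c * cnj c) * herm a b"
    by (simp add: herm_def sum_distrib_left mult_ac)
  then show ?thesis by (simp add: c)
qed

lemma coframe_herm: "(\<Sum>i\<in>UNIV. coframe i z (lact z f) * cnj (coframe i z (lact z g))) = herm f g"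
  by (simp add: coframe_lact herm_def)

lemma sum_if_smult: "(\<Sum>i\<in>(UNIV::'a::finite set). (if i = a then c else 0) *s (f i :: complex^4)) = c *s f a"
  by (subst sum.cong[OF refl, of _ _ "\<lambda>i. if i = a then c *s f i else 0"]) auto

lemma form1_frame: "form1 u z [frame j z] = lact z (phase j z *s u j z)"
  by (simp add: theta_frame sum_if_smult)

lemma form2_frame: "form2 w z [frame i z, frame j z] = lact z ((phase i z * phase j z) *s w i j z)"
  unfolding form2_Cons vector_smult_assoc[symmetric] smult_sum[symmetric] theta_frame sum_if_smult ..

lemma form3_frame: "form3 x z [frame i z, frame j z, frame k z] =
    lact z ((phase i z * phase j z * phase k z) *s x i j k z)"
  unfolding form3_Cons vector_smult_assoc[symmetric] smult_sum[symmetric] theta_frame sum_if_smult ..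

lemma form_inner_form1: "form_inner 1 z (form1 u) (form1 u') = (\<Sum>j\<in>UNIV. herm (u j z) (u' j z))"
  unfolding form_inner_def One_nat_def sum_lists_Suc sum_lists_0
  by (simp only: list.map form1_frame coframe_herm herm_phase[OF phase_unit]) simp

lemma form_inner_form2: "form_inner 2 z (form2 w) (form2 w') = (\<Sum>i\<in>UNIV. \<Sum>j\<in>UNIV. herm (w i j z) (w' i j z)) / 2"
proof -
  have p: "(phase i z * phase j z) * cnj (phase i z * phase j z) = 1" for i j
    using phase_unit[of i z] phase_unit[of j z] by (metis (no_types, lifting) complex_cnj_mult mult.commute mult.left_commute mult_1)
  show ?thesis
    unfolding form_inner_def numeral_2_eq_2 sum_lists_Suc sum_lists_0
    by (simp only: list.map form2_frame coframe_herm herm_phase[OF p]) (simp add: numeral_2_eq_2)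
qed

lemma form_inner_form3: "form_inner 3 z (form3 w) (form3 w') =
   (\<Sum>i\<in>UNIV. \<Sum>j\<in>UNIV. \<Sum>k\<in>UNIV. herm (w i j k z) (w' i j k z)) / 6"
proof -
  have p: "(phase i z * phase j z * phase k z) * cnj (phase i z * phase j z * phase k z) = 1" for i j k
  proof -
    have "(phase i z * phase j z * phase k z) * cnj (phase i z * phase j z * phase k z) =
      (phase i z * cnj (phase i z)) * (phase j z * cnj (phase j z)) * (phase k z * cnj (phase k z))"
      by (simp add: mult_ac)
    then show ?thesis by (simp only: phase_unit) simp
  qed
  show ?thesis
    unfolding form_inner_def numeral_3_eq_3 sum_lists_Suc sum_lists_0
    by (simp only: list.map form3_frame coframe_herm herm_phase[OF p]) (simp add: fact_numeral)
qed

lemma smooth_herm [smooth_intros]: "smooth f \<Longrightarrow> smooth g \<Longrightarrow> smooth (\<lambda>z. herm (f z) (g z))"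
  unfolding herm_def by (intro smooth_intros)

section \<open>Invariant components\<close>

lemma smooth_derivative_along [smooth_intros]:
  assumes f: "smooth f" and X: "smooth X"
  shows "smooth (\<lambda>z. frechet_derivative f (at z) (X z))"
proof -
  have "smooth (\<lambda>z. \<Sum>b\<in>Basis. (X z \<bullet> b) *\<^sub>R frechet_derivative f (at z) b)"
    by (intro smooth_sum smooth_bounded_bilinear[OF bounded_bilinear_scaleR]
        smooth_bounded_linear_comp[OF bounded_linear_inner_left] X smooth_frechet_derivative f)
  then show ?thesis by (simp only: frechet_derivative_Basis[OF f, of _ "X _", symmetric])
qed

lemma smooth_Zbar [smooth_intros]: "smooth f \<Longrightarrow> smooth (Zbar i f)"
  unfolding Zbar_def[abs_def] D01_def by (intro smooth_intros; assumption?)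

lemma smooth_Zhol [smooth_intros]: "smooth f \<Longrightarrow> smooth (Zhol i f)"
  unfolding Zhol_def[abs_def] D10_def by (intro smooth_intros; assumption?)

context solv_lattice
begin

text \<open>The character condition enters here: it makes the exponential factors in \<open>theta\<close>
  invariant under the lattice.\<close>

lemma exp_real: "y \<in> \<Gamma> \<Longrightarrow> exp (cnj (y$1)) = exp (y$1)"
  using unit_character by (simp add: exp_diff)

lemma theta_invariant: assumes y: "y \<in> \<Gamma>" shows "theta j (gmul y z) (lact y v) = theta j z v"
  by (rule forall_4I[of _ j])
     (simp_all add: theta_def gmul_def lact_def exp_add exp_minus exp_diff exp_real[OF y] exp_cnj field_simps)

lemma dual_frame_invariant: assumes y: "y \<in> \<Gamma>" shows "dual_frame j (gmul y z) = lact y (dual_frame j z)"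
  using dual_frame_expansion[of "gmul y z" "lact y (dual_frame j z)"]
  by (simp add: theta_invariant[OF y] theta_dual_frame if_distrib[of cnj] sum_if_smult cong: if_cong)

lemma phase_invariant: assumes y: "y \<in> \<Gamma>" shows "phase j (gmul y z) = phase j z"
  by (rule forall_4I[of _ j])
     (simp_all add: phase_def gmul_def exp_add exp_diff exp_minus exp_real[OF y] exp_cnj field_simps)

definition smooth_invariant :: "(complex^4 \<Rightarrow> complex^4) \<Rightarrow> bool" where
  "smooth_invariant f \<longleftrightarrow> smooth f \<and> invariant f"

lemma smooth_invariant_smooth: "smooth_invariant f \<Longrightarrow> smooth f" by (simp add: smooth_invariant_def)

lemma form1_vforms: assumes "\<And>j. smooth_invariant (u j)" shows "form1 u \<in> vforms \<Gamma> 1"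
proof -
  have inv: "form1 u (gmul y z) (map (frechet_derivative (gmul y) (at z)) vs) =
      frechet_derivative (gmul y) (at z) (form1 u z vs)" if y: "y \<in> \<Gamma>" for y z vs
  proof (cases "length vs = 1")
    case True
    then obtain a where "vs = [a]" using length1E by blast
    moreover have "u j (gmul y z) = u j z" for j
      using assms[of j] y by (simp add: smooth_invariant_def invariant_def)
    ultimately show ?thesis
      by (simp add: frechet_derivative_gmul theta_invariant[OF y] lact_gmul)
  qed (simp add: form1_other frechet_derivative_gmul)
  have d: "form1 u z vs = 0" if "\<not> distinct vs" for z vs
  proof (rule form1_other, rule notI)
    assume "length vs = 1" then show False using that length1E by fastforce
  qed
  show ?thesis unfolding vforms_def
    using smooth_form1[of u] assms smooth_invariant_smooth inv d
      conj_linear_slot1[of "form1 u _", OF form1_other conj_linear_form1] form1_other[of _ u]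
    by blast
qed

lemma form2_vforms: assumes "\<And>i j. smooth_invariant (w i j)" "alternating2 w" shows "form2 w \<in> vforms \<Gamma> 2"
proof -
  have inv: "form2 w (gmul y z) (map (frechet_derivative (gmul y) (at z)) vs) =
      frechet_derivative (gmul y) (at z) (form2 w z vs)" if y: "y \<in> \<Gamma>" for y z vs
  proof (cases "length vs = 2")
    case True
    then obtain a b where "vs = [a, b]" using length2E by blast
    moreover have "w i j (gmul y z) = w i j z" for i j
      using assms(1)[of i j] y by (simp add: smooth_invariant_def invariant_def)
    ultimately show ?thesis
      by (simp add: frechet_derivative_gmul theta_invariant[OF y] lact_gmul)
  qed (simp add: form2_other frechet_derivative_gmul)
  show ?thesis unfolding vforms_def
    using smooth_form2[of w] assms(1) smooth_invariant_smooth inv form2_not_distinct[OF assms(2)]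
      conj_linear_slot2[of "form2 w _", OF form2_other conj_linear_form2] form2_other[of _ w]
    by blast
qed

lemma vforms_conj_linear: "\<omega> \<in> vforms \<Gamma> q \<Longrightarrow> conj_linear (\<lambda>v. \<omega> z (us @ v # ws))"
  unfolding vforms_def conj_linear_def by blast

lemma vforms_smooth: "\<omega> \<in> vforms \<Gamma> q \<Longrightarrow> smooth (\<lambda>z. \<omega> z vs)"
  unfolding vforms_def by blast

lemma vforms_smooth_efr1: assumes "\<omega> \<in> vforms \<Gamma> q" shows "smooth (\<lambda>z. \<omega> z (us @ dual_frame i z # ws))"
  by (subst conj_linear_axis[OF vforms_conj_linear[OF assms]]) (intro smooth_intros vforms_smooth[OF assms])

lemma vforms_smooth_efr2: assumes "\<omega> \<in> vforms \<Gamma> q" shows "smooth (\<lambda>z. \<omega> z (us @ dual_frame i z # dual_frame j z # ws))"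
proof -
  have "smooth (\<lambda>z. \<omega> z (us @ axis a 1 # dual_frame j z # ws))" for a
    using vforms_smooth_efr1[OF assms, of "us @ [axis a 1]" j ws] by simp
  then show ?thesis
    by (subst conj_linear_axis[OF vforms_conj_linear[OF assms]]) (intro smooth_intros)
qed

lemma vforms_component_invariant:
  assumes "\<omega> \<in> vforms \<Gamma> q"
  shows "invariant (\<lambda>z. lact (ginv z) (\<omega> z (map (\<lambda>j. dual_frame j z) js)))"
  unfolding invariant_def
proof (intro ballI allI)
  fix y z assume y: "y \<in> \<Gamma>"
  have "map (\<lambda>j. dual_frame j (gmul y z)) js = map (frechet_derivative (gmul y) (at z)) (map (\<lambda>j. dual_frame j z) js)"
    by (simp add: dual_frame_invariant[OF y] frechet_derivative_gmul)
  moreover have "\<omega> (gmul y z) (map (frechet_derivative (gmul y) (at z)) vs) = frechet_derivative (gmul y) (at z) (\<omega> z vs)" for vs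
    using assms y unfolding vforms_def by blast
  ultimately have "\<omega> (gmul y z) (map (\<lambda>j. dual_frame j (gmul y z)) js) = lact y (\<omega> z (map (\<lambda>j. dual_frame j z) js))"
    by (simp only: frechet_derivative_gmul)
  then show "lact (ginv (gmul y z)) (\<omega> (gmul y z) (map (\<lambda>j. dual_frame j (gmul y z)) js)) =
     lact (ginv z) (\<omega> z (map (\<lambda>j. dual_frame j z) js))"
    by (simp add: ginv_gmul lact_gmul)
qed

lemma vforms1_eq_form1:
  assumes \<omega>: "\<omega> \<in> vforms \<Gamma> 1"
  obtains u where "\<And>j. smooth_invariant (u j)" "\<omega> = form1 u"
proof
  define u where "u j z = lact (ginv z) (\<omega> z [dual_frame j z])" for j z
  show "smooth_invariant (u j)" for j
    using vforms_component_invariant[OF \<omega>, of "[j]"] vforms_smooth_efr1[OF \<omega>, of "[]" j "[]"]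
    by (auto simp: smooth_invariant_def u_def[abs_def] intro!: smooth_intros)
  show "\<omega> = form1 u"
  proof (intro ext)
    fix z vs
    show "\<omega> z vs = form1 u z vs"
    proof (cases "length vs = 1")
      case True
      then obtain a where vs: "vs = [a]" using length1E by blast
      have "\<omega> z [a] = (\<Sum>j\<in>UNIV. theta j z a *s \<omega> z [dual_frame j z])"
        using conj_linear_dual_frame[OF vforms_conj_linear[OF \<omega>, of z "[]" "[]"]] by simp
      then show ?thesis by (simp add: vs lact_sum lact_smult u_def)
    next
      case False
      then show ?thesis using \<omega> by (simp add: form1_other vforms_def)
    qed
  qed
qed

lemma vforms2_eq_form2:
  assumes \<omega>: "\<omega> \<in> vforms \<Gamma> 2"
  obtains w where "\<And>i j. smooth_invariant (w i j)" "alternating2 w" "\<omega> = form2 w"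
proof
  define w where "w i j z = lact (ginv z) (\<omega> z [dual_frame i z, dual_frame j z])" for i j z
  show "smooth_invariant (w i j)" for i j
    using vforms_component_invariant[OF \<omega>, of "[i, j]"] vforms_smooth_efr2[OF \<omega>, of "[]" i j "[]"]
    by (auto simp: smooth_invariant_def w_def[abs_def] intro!: smooth_intros)
  have add1: "\<omega> z [a + b, c] = \<omega> z [a, c] + \<omega> z [b, c]" for a b c z
    using conj_linear_add[OF vforms_conj_linear[OF \<omega>, of z "[]" "[c]"]] by simp
  have add2: "\<omega> z [c, a + b] = \<omega> z [c, a] + \<omega> z [c, b]" for a b c z
    using conj_linear_add[OF vforms_conj_linear[OF \<omega>, of z "[c]" "[]"]] by simp
  have alt: "\<omega> z [a, a] = 0" for a z using \<omega> by (simp add: vforms_def)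
  have "\<omega> z [b, a] = - \<omega> z [a, b]" for a b z
  proof -
    have "\<omega> z [a, b] + \<omega> z [b, a] = \<omega> z [a + b, a + b]"
      unfolding add1 add2 using alt[of z a] alt[of z b] by simp
    then show ?thesis by (simp add: alt eq_neg_iff_add_eq_0 add.commute)
  qed
  then show "alternating2 w" unfolding alternating2_def w_def by (metis lact_minus)
  show "\<omega> = form2 w"
  proof (intro ext)
    fix z vs
    show "\<omega> z vs = form2 w z vs"
    proof (cases "length vs = 2")
      case True
      then obtain a b where vs: "vs = [a, b]" using length2E by blast
      have "\<omega> z [a, b] = (\<Sum>i\<in>UNIV. theta i z a *s \<omega> z [dual_frame i z, b])"
        using conj_linear_dual_frame[OF vforms_conj_linear[OF \<omega>, of z "[]" "[b]"]] by simp
      also have "\<dots> = (\<Sum>i\<in>UNIV. theta i z a *s (\<Sum>j\<in>UNIV. theta j z b *s \<omega> z [dual_frame i z, dual_frame j z]))"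
        using conj_linear_dual_frame[OF vforms_conj_linear[OF \<omega>, of z "[dual_frame _ z]" "[]"]] by simp
      finally show ?thesis by (simp add: vs lact_sum lact_smult w_def smult_sum vector_smult_assoc)
    next
      case False
      then show ?thesis using \<omega> by (simp add: form2_other vforms_def)
    qed
  qed
qed

end

section \<open>The formal adjoint of dbar\<close>

lemma frechet_derivative_minus': "smooth f \<Longrightarrow> frechet_derivative (\<lambda>x. - f x) (at z) = (\<lambda>v. - frechet_derivative f (at z) v)"
  by (rule frechet_derivative_at[OF has_derivative_minus[OF smooth_has_derivative], symmetric])

lemma Zbar_minus: "smooth f \<Longrightarrow> Zbar i (\<lambda>x. - f x) z = - Zbar i f z"
  by (simp add: Zbar_def D01_def frechet_derivative_minus' vec_eq_iff algebra_simps)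

lemma Zhol_minus: "smooth f \<Longrightarrow> Zhol i (\<lambda>x. - f x) z = - Zhol i f z"
  by (simp add: Zhol_def D10_def frechet_derivative_minus' vec_eq_iff algebra_simps)

lemma Zbar_const [simp]: "Zbar i (\<lambda>x. c) z = 0" and Zhol_const [simp]: "Zhol i (\<lambda>x. c) z = 0"
  by (simp_all add: Zbar_def Zhol_def)

lemma D10_smult: assumes "smooth f" shows "D10 f z (a *s v) = a *s D10 f z v"
proof -
  let ?d = "frechet_derivative f (at z)"
  note d = frechet_derivative_smult[OF assms]
  have e2: "?d (\<i> *s (a *s v)) = - Im a *\<^sub>R ?d v + Re a *\<^sub>R ?d (\<i> *s v)"
    using d[of z "\<i> * a" v] by (simp add: vector_smult_assoc)
  show ?thesis unfolding D10_def e2 unfolding d[of z a v]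
    by (simp add: vec_eq_iff complex_eq_iff field_simps)
qed

text \<open>The sums are the transposes of the derivative terms of \<open>dbar1\<close> and \<open>dbar2\<close>. The remaining
  terms transpose the term with \<open>struct_const\<close>: they contract with the second and the third frame
  vector and multiply by the fourth form.\<close>

definition adj1 :: "(4 \<Rightarrow> 4 \<Rightarrow> complex^4 \<Rightarrow> complex^4) \<Rightarrow> 4 \<Rightarrow> complex^4 \<Rightarrow> complex^4" where
  "adj1 w j z = - (\<Sum>i\<in>UNIV. Zhol i (w i j) z) - (if j = 4 then w 2 3 z else 0)"

definition adj2 :: "(4 \<Rightarrow> 4 \<Rightarrow> 4 \<Rightarrow> complex^4 \<Rightarrow> complex^4) \<Rightarrow> 4 \<Rightarrow> 4 \<Rightarrow> complex^4 \<Rightarrow> complex^4" where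
  "adj2 x j k z = - (\<Sum>i\<in>UNIV. Zhol i (x i j k) z)
     - (if j = 4 then x 2 3 k z else 0) + (if k = 4 then x 2 3 j z else 0)"

lemma alternating2_fun: "alternating2 w \<Longrightarrow> w j i = (\<lambda>z. - w i j z)"
  unfolding alternating2_def by blast

lemma alternating3_fun: "alternating3 x \<Longrightarrow> x j i k = (\<lambda>z. - x i j k z)" "alternating3 x \<Longrightarrow> x i k j = (\<lambda>z. - x i j k z)"
  unfolding alternating3_def by blast+

lemma struct_const_swap: "struct_const j i = - struct_const i j"
  by (auto simp: struct_const_def)

lemma alternating2_dbar1: "alternating2 (dbar1 u)"
  unfolding alternating2_def
proof (intro allI)
  fix i j z
  show "dbar1 u j i z = - dbar1 u i j z"
    unfolding dbar1_def struct_const_swap[of j i] by (simp add: vec_eq_iff)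
qed

lemma alternating3_dbar2:
  assumes w: "alternating2 w" "\<And>i j. smooth (w i j)" shows "alternating3 (dbar2 w)"
proof -
  have Wm: "Zbar k (w j i) z = - Zbar k (w i j) z" for i j k z
    unfolding alternating2_fun[OF w(1), of j i] by (rule Zbar_minus[OF w(2)])
  show ?thesis unfolding alternating3_def
  proof (intro allI conjI)
    fix i j k z
    show "dbar2 w j i k z = - dbar2 w i j k z"
      unfolding dbar2_def Wm[of k j i] struct_const_swap[of j i] by (simp add: vec_eq_iff)
    show "dbar2 w i k j z = - dbar2 w i j k z"
      unfolding dbar2_def Wm[of i k j] struct_const_swap[of k j] by (simp add: vec_eq_iff)
  qed
qed

lemma alternating2_adj2:
  assumes x: "alternating3 x" "\<And>i j k. smooth (x i j k)" shows "alternating2 (adj2 x)"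
proof -
  have Wm: "Zhol l (x i k j) z = - Zhol l (x i j k) z" for i j k l z
    unfolding alternating3_fun(2)[OF x(1), of i k j] by (rule Zhol_minus[OF x(2)])
  show ?thesis unfolding alternating2_def
  proof (intro allI)
    fix j k z
    have S: "(\<Sum>i\<in>UNIV. Zhol i (x i k j) z) = - (\<Sum>i\<in>UNIV. Zhol i (x i j k) z)"
      unfolding sum_negf[symmetric] Wm[of _ _ k j] ..
    show "adj2 x k j z = - adj2 x j k z"
      unfolding adj2_def S by (simp add: vec_eq_iff)
  qed
qed

context solv_lattice
begin

lemma derivative_invariant:
  assumes f: "smooth f" "invariant f" and y: "y \<in> \<Gamma>"
  shows "frechet_derivative f (at (gmul y z)) (lact y v) = frechet_derivative f (at z) v"
proof -
  have "((\<lambda>z. f (gmul y z)) has_derivative (\<lambda>v. frechet_derivative f (at (gmul y z)) (lact y v))) (at z)"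
    by (rule has_derivative_compose[OF has_derivative_gmul smooth_has_derivative[OF f(1)]])
  moreover have "(\<lambda>z. f (gmul y z)) = f" using f(2) y by (auto simp: invariant_def)
  ultimately show ?thesis using frechet_derivative_at by metis
qed

lemma smooth_invariant_add: "smooth_invariant f \<Longrightarrow> smooth_invariant g \<Longrightarrow> smooth_invariant (\<lambda>z. f z + g z)"
  and smooth_invariant_diff: "smooth_invariant f \<Longrightarrow> smooth_invariant g \<Longrightarrow> smooth_invariant (\<lambda>z. f z - g z)"
  and smooth_invariant_minus: "smooth_invariant f \<Longrightarrow> smooth_invariant (\<lambda>z. - f z)"
  and smooth_invariant_smult: "smooth_invariant f \<Longrightarrow> smooth_invariant (\<lambda>z. c *s f z)"
  and smooth_invariant_const: "smooth_invariant (\<lambda>z. d)"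
  by (auto simp: smooth_invariant_def invariant_def intro!: smooth_intros)

lemma smooth_invariant_sum: "(\<And>i. smooth_invariant (f i)) \<Longrightarrow> smooth_invariant (\<lambda>z. \<Sum>i\<in>A. f i z)"
  by (induction A rule: infinite_finite_induct) (simp_all add: smooth_invariant_const smooth_invariant_add)

lemma smooth_invariant_Zbar: assumes "smooth_invariant f" shows "smooth_invariant (Zbar i f)"
proof -
  have f: "smooth f" "invariant f" using assms by (auto simp: smooth_invariant_def)
  have "invariant (Zbar i f)"
    unfolding invariant_def Zbar_def D01_def
    by (auto simp: dual_frame_invariant derivative_invariant[OF f] simp flip: lact_smult)
  then show ?thesis using f by (simp add: smooth_invariant_def smooth_Zbar)
qed

lemma smooth_invariant_Zhol: assumes "smooth_invariant f" shows "smooth_invariant (Zhol i f)"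
proof -
  have f: "smooth f" "invariant f" using assms by (auto simp: smooth_invariant_def)
  have "invariant (Zhol i f)"
    unfolding invariant_def Zhol_def D10_def
    by (auto simp: dual_frame_invariant derivative_invariant[OF f] simp flip: lact_smult)
  then show ?thesis using f by (simp add: smooth_invariant_def smooth_Zhol)
qed

lemmas smooth_invariant_intros = smooth_invariant_add smooth_invariant_diff smooth_invariant_minus smooth_invariant_smult smooth_invariant_const smooth_invariant_sum smooth_invariant_Zbar smooth_invariant_Zhol

definition pairing :: "(complex^4 \<Rightarrow> complex^4) \<Rightarrow> (complex^4 \<Rightarrow> complex^4) \<Rightarrow> complex" where
  "pairing f g = quotient_integral (\<lambda>z. herm (f z) (g z))"

lemma continuous_herm: "smooth_invariant f \<Longrightarrow> smooth_invariant g \<Longrightarrow> continuous_on UNIV (\<lambda>z. herm (f z) (g z))"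
  by (intro smooth_imp_continuous_on smooth_intros smooth_invariant_smooth)

lemma herm_simps: "herm (a + b) c = herm a c + herm b c" "herm c (a + b) = herm c a + herm c b"
  "herm (s *s a) c = s * herm a c" "herm c (s *s a) = cnj s * herm c a" "herm (- a) c = - herm a c" "herm c (- a) = - herm c a"
  "herm 0 c = 0" "herm c 0 = 0"
  by (simp_all add: herm_def sum.distrib sum_distrib_left sum_negf algebra_simps)

lemma pairing_add_left: "smooth_invariant f \<Longrightarrow> smooth_invariant g \<Longrightarrow> smooth_invariant h \<Longrightarrow> pairing (\<lambda>z. f z + g z) h = pairing f h + pairing g h"
  and pairing_add_right: "smooth_invariant f \<Longrightarrow> smooth_invariant g \<Longrightarrow> smooth_invariant h \<Longrightarrow> pairing h (\<lambda>z. f z + g z) = pairing h f + pairing h g"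
  unfolding pairing_def herm_simps by (auto intro!: quotient_integral_add continuous_herm)

lemma pairing_smult_left: "pairing (\<lambda>z. c *s f z) h = c * pairing f h"
  and pairing_smult_right: "pairing h (\<lambda>z. c *s f z) = cnj c * pairing h f"
  unfolding pairing_def herm_simps by (rule quotient_integral_cmult)+

lemma pairing_minus_left: "pairing (\<lambda>z. - f z) h = - pairing f h" and pairing_minus_right: "pairing h (\<lambda>z. - f z) = - pairing h f"
  using pairing_smult_left[of "-1" f h] pairing_smult_right[of h "-1" f] by simp_all

lemma pairing_diff_left: "smooth_invariant f \<Longrightarrow> smooth_invariant g \<Longrightarrow> smooth_invariant h \<Longrightarrow> pairing (\<lambda>z. f z - g z) h = pairing f h - pairing g h"
  and pairing_diff_right: "smooth_invariant f \<Longrightarrow> smooth_invariant g \<Longrightarrow> smooth_invariant h \<Longrightarrow> pairing h (\<lambda>z. f z - g z) = pairing h f - pairing h g"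
  using pairing_add_left[of f "\<lambda>z. - g z" h] pairing_add_right[of f "\<lambda>z. - g z" h]
  by (simp_all add: pairing_minus_left pairing_minus_right smooth_invariant_minus)

lemma pairing_zero [simp]: "pairing (\<lambda>z. 0) h = 0" "pairing h (\<lambda>z. 0) = 0"
  using pairing_smult_left[of 0 "\<lambda>z. 0" h] pairing_smult_right[of h 0 "\<lambda>z. 0"] by simp_all

lemma pairing_sum_right: "finite A \<Longrightarrow> (\<And>i. smooth_invariant (f i)) \<Longrightarrow> smooth_invariant h \<Longrightarrow> pairing h (\<lambda>z. \<Sum>i\<in>A. f i z) = (\<Sum>i\<in>A. pairing h (f i))"
  by (induction A rule: finite_induct) (simp_all add: pairing_add_right smooth_invariant_sum)

lemma pairing_cnj: "pairing g f = cnj (pairing f g)"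
proof -
  have "herm (g z) (f z) = cnj (herm (f z) (g z))" for z
    by (simp add: herm_def mult.commute)
  then show ?thesis
    unfolding pairing_def quotient_integral_def set_lebesgue_integral_def
    by (simp flip: Bochner_Integration.integral_cnj)
qed

lemma herm_self: "herm a a = of_real (\<Sum>i\<in>UNIV. (cmod (a $ i))\<^sup>2)"
  unfolding herm_def of_real_sum complex_norm_square ..

lemma pairing_self_nonneg: assumes "smooth_invariant f" shows "0 \<le> Re (pairing f f)"
proof -
  have i: "integrable lborel (\<lambda>z. indicator fund z *\<^sub>R herm (f z) (f z))"
    by (intro integrable_on_bounded continuous_herm assms fund_borel bounded_fund)
  show ?thesis
    unfolding pairing_def quotient_integral_def set_lebesgue_integral_def integral_Re[OF i, symmetric]
    by (rule Bochner_Integration.integral_nonneg) (simp add: herm_self sum_nonneg del: of_real_sum)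
qed

lemma pairing_self_eq_0: assumes f: "smooth_invariant f" and "pairing f f = 0" shows "f = (\<lambda>z. 0)"
proof
  fix z
  have "herm (f z) (f z) = 0"
  proof (rule quotient_integral_nonneg_eq_0[where h = "\<lambda>z. herm (f z) (f z)"])
    show "continuous_on UNIV (\<lambda>z. herm (f z) (f z))" by (rule continuous_herm[OF f f])
    show "invariant (\<lambda>z. herm (f z) (f z))" using f by (simp add: smooth_invariant_def invariant_def)
    show "quotient_integral (\<lambda>z. herm (f z) (f z)) = 0" using assms(2) by (simp add: pairing_def)
  qed (simp_all add: herm_self sum_nonneg del: of_real_sum)
  then have "(\<Sum>i\<in>UNIV. (cmod (f z $ i))\<^sup>2) = 0" unfolding herm_self of_real_eq_0_iff .
  then show "f z = 0" by (simp add: sum_nonneg_eq_0_iff vec_eq_iff)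
qed

text \<open>The factors depend on the first coordinate only, and the frame vectors for which they are
  not constant do not change that coordinate.\<close>

lemma has_derivative_phase:
  "\<exists>p'. ((\<lambda>z. cnj (phase i z)) has_derivative p') (at z) \<and> (\<forall>c. p' (c *s frame i z) = 0)"
proof (rule forall_4I[of _ i])
  have d: "((\<lambda>z. cnj (exp (z$1 - cnj (z$1)))) has_derivative
     (\<lambda>v. cnj (exp (z$1 - cnj (z$1)) * (v$1 - cnj (v$1))))) (at z)"
    "((\<lambda>z. cnj (exp (cnj (z$1) - z$1))) has_derivative
     (\<lambda>v. cnj (exp (cnj (z$1) - z$1) * (cnj (v$1) - v$1)))) (at z)" for z :: "complex^4"
    by (intro bounded_linear.has_derivative[OF bounded_linear_cnj] has_derivative_cexp
        has_derivative_diff has_derivative_nth has_derivative_ident)+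
  show "\<exists>p'. ((\<lambda>z. cnj (phase 1 z)) has_derivative p') (at z) \<and> (\<forall>c. p' (c *s frame 1 z) = 0)"
    "\<exists>p'. ((\<lambda>z. cnj (phase 4 z)) has_derivative p') (at z) \<and> (\<forall>c. p' (c *s frame 4 z) = 0)"
    unfolding phase_def vector_nth_4 by (rule exI[of _ "\<lambda>v. 0"], simp)+
  show "\<exists>p'. ((\<lambda>z. cnj (phase 2 z)) has_derivative p') (at z) \<and> (\<forall>c. p' (c *s frame 2 z) = 0)"
    unfolding phase_def vector_nth_4 by (rule exI, rule conjI, rule d) (simp add: frame_def)
  show "\<exists>p'. ((\<lambda>z. cnj (phase 3 z)) has_derivative p') (at z) \<and> (\<forall>c. p' (c *s frame 3 z) = 0)"
    unfolding phase_def vector_nth_4 by (rule exI, rule conjI, rule d) (simp add: frame_def)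
qed

text \<open>The hermitian product of \<open>f\<close> and \<open>g\<close>, multiplied by the conjugate phase, is invariant. Its
  derivative along the conjugate of \<open>frame i\<close> has integral zero, and by the Leibniz rule it is the
  sum of the two products below because the phase is constant in that direction.\<close>

lemma integration_by_parts:
  assumes f: "smooth_invariant f" and g: "smooth_invariant g"
  shows "pairing (Zbar i f) g = - pairing f (Zhol i g)"
proof -
  define k where "k z = cnj (phase i z) * herm (f z) (g z)" for z
  have sf: "smooth f" and sg: "smooth g" using f g by (auto simp: smooth_invariant_def)
  have sphase: "smooth (phase i)"
    by (rule forall_4I[of _ i]) (simp_all add: phase_def[abs_def], (intro smooth_intros)+)
  have sk: "smooth k" unfolding k_def[abs_def] by (intro smooth_intros sphase sf sg)
  have ik: "invariant k" using f g by (simp add: invariant_def k_def phase_invariant smooth_invariant_def)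
  let ?dk = "\<lambda>z. frechet_derivative k (at z)"
  have c: "continuous_on UNIV (\<lambda>z. ?dk z (lact z v))" for v
    by (intro smooth_imp_continuous_on smooth_intros sk)
  have fr: "frame i z = lact z (axis i 1)" "\<i> *s frame i z = lact z (\<i> *s axis i 1)" for z
    by (simp_all add: frame_eq_lact lact_smult)
  have key: "herm (Zbar i f z) (g z) + herm (f z) (Zhol i g z) =
      1/2 * (?dk z (lact z (axis i 1)) + \<i> * ?dk z (lact z (\<i> *s axis i 1)))" for z
  proof -
    let ?f = "frechet_derivative f (at z)" and ?g = "frechet_derivative g (at z)"
    obtain p' where p': "((\<lambda>z. cnj (phase i z)) has_derivative p') (at z)" "\<And>c. p' (c *s frame i z) = 0"
      using has_derivative_phase by blast
    have p0: "p' (frame i z) = 0" using p'(2)[of 1] by simp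
    have "((\<lambda>z. herm (f z) (g z)) has_derivative (\<lambda>v. \<Sum>a\<in>UNIV. f z $ a * cnj (?g v $ a) + ?f v $ a * cnj (g z $ a))) (at z)"
      unfolding herm_def
      by (intro has_derivative_sum has_derivative_mult bounded_linear.has_derivative[OF bounded_linear_cnj]
          has_derivative_nth smooth_has_derivative sf sg)
    from has_derivative_mult[OF p'(1) this]
    have "(k has_derivative (\<lambda>v. cnj (phase i z) * (\<Sum>a\<in>UNIV. f z $ a * cnj (?g v $ a) + ?f v $ a * cnj (g z $ a))
        + p' v * herm (f z) (g z))) (at z)"
      unfolding k_def[abs_def] .
    then have dk: "?dk z = (\<lambda>v. cnj (phase i z) * (\<Sum>a\<in>UNIV. f z $ a * cnj (?g v $ a) + ?f v $ a * cnj (g z $ a))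
        + p' v * herm (f z) (g z))"
      by (rule frechet_derivative_at[symmetric])
    have Wf: "Zbar i f z = cnj (phase i z) *s ((1/2) *\<^sub>R (?f (frame i z) + \<i> *s ?f (\<i> *s frame i z)))"
      unfolding Zbar_def dual_frame_eq_frame conj_linear_smult[OF conj_linear_D01[OF sf]] by (simp add: D01_def)
    have Wg: "Zhol i g z = phase i z *s ((1/2) *\<^sub>R (?g (frame i z) - \<i> *s ?g (\<i> *s frame i z)))"
      unfolding Zhol_def dual_frame_eq_frame D10_smult[OF sg] by (simp add: D10_def)
    show ?thesis
      unfolding fr[symmetric] dk Wf Wg
      by (simp add: p0 p'(2) herm_def scaleR_conv_of_real[where 'a=complex] sum_distrib_left algebra_simps
          flip: sum.distrib)
  qed
  have "pairing (Zbar i f) g + pairing f (Zhol i g) = quotient_integral (\<lambda>z. herm (Zbar i f z) (g z) + herm (f z) (Zhol i g z))"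
    unfolding pairing_def by (rule quotient_integral_add[symmetric]) (intro continuous_herm smooth_invariant_intros f g)+
  also have "\<dots> = 1/2 * (quotient_integral (\<lambda>z. ?dk z (lact z (axis i 1))) + \<i> * quotient_integral (\<lambda>z. ?dk z (lact z (\<i> *s axis i 1))))"
    unfolding key quotient_integral_cmult by (subst quotient_integral_add) (auto intro!: continuous_intros c simp only: quotient_integral_cmult)
  also have "\<dots> = 0" by (simp only: quotient_integral_derivative[OF sk ik]) simp
  finally show ?thesis by (simp add: add_eq_0_iff2)
qed

end

section \<open>Forms of degree one, two and three with their inner products\<close>

lemma form2_dual_frame: "form2 w z [dual_frame i z, dual_frame j z] = lact z (w i j z)"
  unfolding form2_Cons vector_smult_assoc[symmetric] smult_sum[symmetric] theta_dual_frame sum_if_smult by simp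

lemma form2_inj: "form2 w = form2 w' \<longleftrightarrow> w = w'"
proof
  assume "form2 w = form2 w'"
  then have "form2 w z [dual_frame i z, dual_frame j z] = form2 w' z [dual_frame i z, dual_frame j z]" for i j z by simp
  then have "lact z (w i j z) = lact z (w' i j z)" for i j z
    by (simp only: form2_dual_frame)
  then show "w = w'" by (metis ext lact_ginv(1))
qed simp

lemma form1_add: "form1 (\<lambda>j z. u j z + u' j z) = (\<lambda>z vs. form1 u z vs + form1 u' z vs)"
  by (intro ext) (simp add: form1_def vector_add_ldistrib sum.distrib lact_add split: list.split)

lemma form1_scaleR: "form1 (\<lambda>j z. r *\<^sub>R u j z) = (\<lambda>z vs. r *\<^sub>R form1 u z vs)"
  by (intro ext) (simp add: form1_def scaleR_eq_smult vector_smult_assoc mult.commute[of "theta _ _ _"]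
      lact_sum lact_smult smult_sum split: list.split)

lemma form2_add: "form2 (\<lambda>i j z. w i j z + w' i j z) = (\<lambda>z vs. form2 w z vs + form2 w' z vs)"
  by (intro ext) (simp add: form2_def vector_add_ldistrib sum.distrib lact_add split: list.split)

lemma form2_diff: "form2 (\<lambda>i j z. w i j z - w' i j z) = (\<lambda>z vs. form2 w z vs - form2 w' z vs)"
  by (intro ext) (simp add: form2_def vector_ssub_ldistrib sum_subtractf lact_diff split: list.split)

lemma form2_zero: "form2 (\<lambda>i j z. 0) = (\<lambda>z vs. 0)"
  by (intro ext) (simp add: form2_def split: list.split)

context solv_lattice
begin

text \<open>The components of the forms on the quotient.\<close>

definition admissible1 :: "(4 \<Rightarrow> complex^4 \<Rightarrow> complex^4) \<Rightarrow> bool" where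
  "admissible1 u \<longleftrightarrow> (\<forall>j. smooth_invariant (u j))"
definition admissible2 :: "(4 \<Rightarrow> 4 \<Rightarrow> complex^4 \<Rightarrow> complex^4) \<Rightarrow> bool" where
  "admissible2 w \<longleftrightarrow> (\<forall>i j. smooth_invariant (w i j)) \<and> alternating2 w"
definition admissible3 :: "(4 \<Rightarrow> 4 \<Rightarrow> 4 \<Rightarrow> complex^4 \<Rightarrow> complex^4) \<Rightarrow> bool" where
  "admissible3 x \<longleftrightarrow> (\<forall>i j k. smooth_invariant (x i j k)) \<and> alternating3 x"

lemma smooth_invariant_if: "smooth_invariant f \<Longrightarrow> smooth_invariant (\<lambda>z. if b then f z else 0)"
  by (cases b) (simp_all add: smooth_invariant_const)

lemma admissible2_dbar1: "admissible1 u \<Longrightarrow> admissible2 (dbar1 u)"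
  unfolding admissible1_def admissible2_def dbar1_def[abs_def]
  by (auto intro!: smooth_invariant_intros) (use alternating2_dbar1 in \<open>simp add: dbar1_def[abs_def]\<close>)

lemma admissible3_dbar2: "admissible2 w \<Longrightarrow> admissible3 (dbar2 w)"
  using alternating3_dbar2[of w] unfolding admissible2_def admissible3_def dbar2_def[abs_def]
  by (auto intro!: smooth_invariant_intros smooth_invariant_smooth)

lemma admissible1_adj1: "admissible2 w \<Longrightarrow> admissible1 (adj1 w)"
  unfolding admissible1_def admissible2_def adj1_def[abs_def]
  by (auto intro!: smooth_invariant_intros smooth_invariant_if)

lemma admissible2_adj2: "admissible3 x \<Longrightarrow> admissible2 (adj2 x)"
  using alternating2_adj2[of x] unfolding admissible2_def admissible3_def adj2_def[abs_def]
  by (auto intro!: smooth_invariant_intros smooth_invariant_if smooth_invariant_smooth)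

lemma admissible2_diff: "admissible2 w \<Longrightarrow> admissible2 w' \<Longrightarrow> admissible2 (\<lambda>i j z. w i j z - w' i j z)"
  unfolding admissible2_def alternating2_def
proof (intro conjI allI)
  fix i j z
  assume a: "(\<forall>i j. smooth_invariant (w i j)) \<and> (\<forall>i j z. w j i z = - w i j z)"
    and b: "(\<forall>i j. smooth_invariant (w' i j)) \<and> (\<forall>i j z. w' j i z = - w' i j z)"
  show "smooth_invariant (\<lambda>z. w i j z - w' i j z)" by (rule smooth_invariant_diff) (use a b in blast)+
  have "w j i z = - w i j z" "w' j i z = - w' i j z" using a b by blast+
  then show "w j i z - w' j i z = - (w i j z - w' i j z)" by simp
qed

lemma admissible2_add: "admissible2 w \<Longrightarrow> admissible2 w' \<Longrightarrow> admissible2 (\<lambda>i j z. w i j z + w' i j z)"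
  unfolding admissible2_def alternating2_def
proof (intro conjI allI)
  fix i j z
  assume a: "(\<forall>i j. smooth_invariant (w i j)) \<and> (\<forall>i j z. w j i z = - w i j z)"
    and b: "(\<forall>i j. smooth_invariant (w' i j)) \<and> (\<forall>i j z. w' j i z = - w' i j z)"
  show "smooth_invariant (\<lambda>z. w i j z + w' i j z)" by (rule smooth_invariant_add) (use a b in blast)+
  have "w j i z = - w i j z" "w' j i z = - w' i j z" using a b by blast+
  then show "w j i z + w' j i z = - (w i j z + w' i j z)" by simp
qed

definition pairing1 where "pairing1 u v = (\<Sum>j\<in>UNIV. pairing (u j) (v j))"
definition pairing2 where "pairing2 w v = (\<Sum>i\<in>UNIV. \<Sum>j\<in>UNIV. pairing (w i j) (v i j)) / 2"
definition pairing3 where "pairing3 x v = (\<Sum>i\<in>UNIV. \<Sum>j\<in>UNIV. \<Sum>k\<in>UNIV. pairing (x i j k) (v i j k)) / 6"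

lemma quotient_integral_sum:
  "finite A \<Longrightarrow> (\<And>i. continuous_on UNIV (f i)) \<Longrightarrow> quotient_integral (\<lambda>z. \<Sum>i\<in>A. f i z) = (\<Sum>i\<in>A. quotient_integral (f i))"
proof (induction A rule: finite_induct)
  case empty
  then show ?case using quotient_integral_cmult[of 0 "\<lambda>z. 0"] by simp
qed (simp add: quotient_integral_add continuous_intros)

lemma quotient_integral_divide: "quotient_integral (\<lambda>z. f z / c) = quotient_integral f / c"
  using quotient_integral_cmult[of "1/c" f] by simp

lemma l2_inner_form1: "admissible1 u \<Longrightarrow> admissible1 v \<Longrightarrow> l2_inner \<Gamma> 1 (form1 u) (form1 v) = pairing1 u v"
  unfolding l2_inner_def form_inner_form1 fund_def[symmetric] quotient_integral_def[symmetric] pairing1_def pairing_def admissible1_def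
  by (intro quotient_integral_sum continuous_herm) auto

lemma l2_inner_form2: "admissible2 u \<Longrightarrow> admissible2 v \<Longrightarrow> l2_inner \<Gamma> 2 (form2 u) (form2 v) = pairing2 u v"
  unfolding l2_inner_def form_inner_form2 fund_def[symmetric] quotient_integral_def[symmetric] pairing2_def pairing_def admissible2_def quotient_integral_divide
  by (simp add: quotient_integral_sum continuous_herm continuous_on_sum)

lemma l2_inner_form3: "admissible3 u \<Longrightarrow> admissible3 v \<Longrightarrow> l2_inner \<Gamma> 3 (form3 u) (form3 v) = pairing3 u v"
  unfolding l2_inner_def form_inner_form3 fund_def[symmetric] quotient_integral_def[symmetric] pairing3_def pairing_def admissible3_def quotient_integral_divide
  by (simp add: quotient_integral_sum continuous_herm continuous_on_sum)

lemma pairing_if_right: "pairing h (\<lambda>z. if b then f z else 0) = (if b then pairing h f else 0)"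
  by (cases b) auto

text \<open>Since \<open>w\<close> is alternating, the two derivative terms of \<open>dbar1\<close> contribute equally; one of
  them is integrated by parts.\<close>

lemma adjoint1:
  assumes u: "admissible1 u" and w: "admissible2 w"
  shows "pairing2 (dbar1 u) w = pairing1 u (adj1 w)"
proof -
  have su: "smooth_invariant (u j)" and sw: "smooth_invariant (w i j)" for i j using u w by (auto simp: admissible1_def admissible2_def)
  have as: "w j i = (\<lambda>z. - w i j z)" for i j using w by (intro alternating2_fun) (simp add: admissible2_def)
  define S where "S = (\<Sum>i\<in>UNIV. \<Sum>j\<in>UNIV. pairing (Zbar i (u j)) (w i j))"
  have l: "pairing (dbar1 u i j) (w i j) = pairing (Zbar i (u j)) (w i j) - pairing (Zbar j (u i)) (w i j) - struct_const i j * pairing (u 4) (w i j)" for i j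
    unfolding dbar1_def[abs_def]
    by (simp add: pairing_diff_left pairing_smult_left smooth_invariant_intros su sw)
  have "(\<Sum>i\<in>UNIV. \<Sum>j\<in>UNIV. pairing (Zbar j (u i)) (w i j)) = (\<Sum>j\<in>UNIV. \<Sum>i\<in>UNIV. pairing (Zbar j (u i)) (w i j))"
    by (rule sum.swap)
  also have "\<dots> = (\<Sum>j\<in>UNIV. \<Sum>i\<in>UNIV. - pairing (Zbar j (u i)) (w j i))"
    by (intro sum.cong refl, subst as) (rule pairing_minus_right)
  also have "\<dots> = - S" by (simp add: S_def sum_negf)
  finally have S2: "(\<Sum>i\<in>UNIV. \<Sum>j\<in>UNIV. pairing (Zbar j (u i)) (w i j)) = - S" .
  have S3: "(\<Sum>i\<in>UNIV. \<Sum>j\<in>UNIV. struct_const i j * pairing (u 4) (w i j)) = 2 * pairing (u 4) (w 2 3)"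
  proof -
    have "pairing (u 4) (w 3 2) = - pairing (u 4) (w 2 3)" by (subst as[of 3 2]) (rule pairing_minus_right)
    then show ?thesis by (simp add: sum_4 struct_const_def)
  qed
  have "pairing2 (dbar1 u) w = S - pairing (u 4) (w 2 3)"
    unfolding pairing2_def l sum_subtractf S2 S3 S_def[symmetric] by simp
  also have "\<dots> = pairing1 u (adj1 w)"
  proof -
    have r: "pairing (u j) (adj1 w j) = (\<Sum>i\<in>UNIV. pairing (Zbar i (u j)) (w i j)) - (if j = 4 then pairing (u 4) (w 2 3) else 0)" for j
      unfolding adj1_def[abs_def]
      by (simp add: pairing_diff_right pairing_minus_right pairing_sum_right pairing_if_right smooth_invariant_intros smooth_invariant_if su sw
          integration_by_parts sum_negf)
    show ?thesis unfolding pairing1_def r sum_subtractf S_def by (subst sum.swap) simp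
  qed
  finally show ?thesis .
qed

text \<open>As in degree one: by the alternation of \<open>x\<close> the three derivative terms have the same
  integral \<open>S\<close>, and the three structure terms have the same integral \<open>2 * T\<close> up to sign.\<close>

lemma adjoint2:
  assumes w: "admissible2 w" and x: "admissible3 x"
  shows "pairing3 (dbar2 w) x = pairing2 w (adj2 x)"
proof -
  have sw: "smooth_invariant (w i j)" and sx: "smooth_invariant (x i j k)" for i j k using w x by (auto simp: admissible2_def admissible3_def)
  have aw: "w j i = (\<lambda>z. - w i j z)" for i j using w by (intro alternating2_fun) (simp add: admissible2_def)
  have ax: "x j i k = (\<lambda>z. - x i j k z)" "x i k j = (\<lambda>z. - x i j k z)" for i j k
    using x alternating3_fun[of x] unfolding admissible3_def by blast+
  have neg1: "pairing h (x j i k) = - pairing h (x i j k)" and neg2: "pairing h (x i k j) = - pairing h (x i j k)" for h i j k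
    by (subst ax, rule pairing_minus_right)+
  define S where "S = (\<Sum>i\<in>UNIV. \<Sum>j\<in>UNIV. \<Sum>k\<in>UNIV. pairing (Zbar i (w j k)) (x i j k))"
  define T where "T = (\<Sum>k\<in>UNIV. pairing (w 4 k) (x 2 3 k))"
  have l: "pairing (dbar2 w i j k) (x i j k) = pairing (Zbar i (w j k)) (x i j k) - pairing (Zbar j (w i k)) (x i j k)
     + pairing (Zbar k (w i j)) (x i j k) - struct_const i j * pairing (w 4 k) (x i j k) + struct_const i k * pairing (w 4 j) (x i j k)
     - struct_const j k * pairing (w 4 i) (x i j k)" for i j k
    unfolding dbar2_def[abs_def]
    by (simp add: pairing_diff_left pairing_add_left pairing_smult_left smooth_invariant_intros sw sx)
  have S2: "(\<Sum>i\<in>UNIV. \<Sum>j\<in>UNIV. \<Sum>k\<in>UNIV. pairing (Zbar j (w i k)) (x i j k)) = - S"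
  proof -
    have "(\<Sum>i\<in>UNIV. \<Sum>j\<in>UNIV. \<Sum>k\<in>UNIV. pairing (Zbar j (w i k)) (x i j k)) =
       (\<Sum>j\<in>UNIV. \<Sum>i\<in>UNIV. \<Sum>k\<in>UNIV. pairing (Zbar j (w i k)) (x i j k))" by (rule sum.swap)
    also have "\<dots> = (\<Sum>j\<in>UNIV. \<Sum>i\<in>UNIV. \<Sum>k\<in>UNIV. - pairing (Zbar j (w i k)) (x j i k))"
      by (intro sum.cong refl) (rule neg1)
    finally show ?thesis by (simp add: S_def sum_negf)
  qed
  have S3: "(\<Sum>i\<in>UNIV. \<Sum>j\<in>UNIV. \<Sum>k\<in>UNIV. pairing (Zbar k (w i j)) (x i j k)) = S"
  proof -
    have "(\<Sum>i\<in>UNIV. \<Sum>j\<in>UNIV. \<Sum>k\<in>UNIV. pairing (Zbar k (w i j)) (x i j k)) =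
       (\<Sum>i\<in>UNIV. \<Sum>k\<in>UNIV. \<Sum>j\<in>UNIV. pairing (Zbar k (w i j)) (x i j k))"
      by (rule sum.cong[OF refl], rule sum.swap)
    also have "\<dots> = (\<Sum>k\<in>UNIV. \<Sum>i\<in>UNIV. \<Sum>j\<in>UNIV. pairing (Zbar k (w i j)) (x i j k))"
      by (rule sum.swap)
    also have "\<dots> = S" unfolding S_def
    proof (intro sum.cong refl)
      fix k i j
      show "pairing (Zbar k (w i j)) (x i j k) = pairing (Zbar k (w i j)) (x k i j)"
        using neg1[of _ i k j] neg2[of _ i k j] by simp
    qed
    finally show ?thesis .
  qed
  have x32: "pairing h (x 3 2 k) = - pairing h (x 2 3 k)" for h k by (rule neg1)
  have T1: "(\<Sum>i\<in>UNIV. \<Sum>j\<in>UNIV. \<Sum>k\<in>UNIV. struct_const i j * pairing (w 4 k) (x i j k)) = 2 * T"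
    by (simp add: sum_4 struct_const_def x32 T_def)
  have T2: "(\<Sum>i\<in>UNIV. \<Sum>j\<in>UNIV. \<Sum>k\<in>UNIV. struct_const i k * pairing (w 4 j) (x i j k)) = - 2 * T"
  proof -
    have "(\<Sum>i\<in>UNIV. \<Sum>j\<in>UNIV. \<Sum>k\<in>UNIV. struct_const i k * pairing (w 4 j) (x i j k)) =
      (\<Sum>i\<in>UNIV. \<Sum>j\<in>UNIV. \<Sum>k\<in>UNIV. struct_const i j * pairing (w 4 k) (x i k j))"
      by (rule sum.cong[OF refl], rule sum.swap)
    also have "\<dots> = (\<Sum>i\<in>UNIV. \<Sum>j\<in>UNIV. \<Sum>k\<in>UNIV. - (struct_const i j * pairing (w 4 k) (x i j k)))"
      by (intro sum.cong refl, subst neg2) simp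
    finally show ?thesis unfolding sum_negf T1 by simp
  qed
  have T3: "(\<Sum>i\<in>UNIV. \<Sum>j\<in>UNIV. \<Sum>k\<in>UNIV. struct_const j k * pairing (w 4 i) (x i j k)) = 2 * T"
  proof -
    have "(\<Sum>i\<in>UNIV. \<Sum>j\<in>UNIV. \<Sum>k\<in>UNIV. struct_const j k * pairing (w 4 i) (x i j k)) =
      (\<Sum>i\<in>UNIV. \<Sum>j\<in>UNIV. \<Sum>k\<in>UNIV. struct_const i k * pairing (w 4 j) (x j i k))"
      by (rule sum.swap)
    also have "\<dots> = (\<Sum>i\<in>UNIV. \<Sum>j\<in>UNIV. \<Sum>k\<in>UNIV. - (struct_const i k * pairing (w 4 j) (x i j k)))"
      by (intro sum.cong refl, subst neg1) simp
    finally show ?thesis unfolding sum_negf T2 by simp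
  qed
  have "pairing3 (dbar2 w) x = (3 * S - 6 * T) / 6"
    unfolding pairing3_def l sum_subtractf sum.distrib S2 S3 T1 T2 T3 S_def[symmetric] by simp
  also have "\<dots> = pairing2 w (adj2 x)"
  proof -
    have r: "pairing (w j k) (adj2 x j k) = (\<Sum>i\<in>UNIV. pairing (Zbar i (w j k)) (x i j k))
       - (if j = 4 then pairing (w 4 k) (x 2 3 k) else 0) + (if k = 4 then pairing (w j 4) (x 2 3 j) else 0)" for j k
      unfolding adj2_def[abs_def]
      by (simp add: pairing_diff_right pairing_add_right pairing_minus_right pairing_sum_right pairing_if_right smooth_invariant_intros smooth_invariant_if sw sx
          integration_by_parts sum_negf)
    have w4: "pairing (w j 4) h = - pairing (w 4 j) h" for j h by (subst aw[of j 4]) (simp add: pairing_minus_left)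
    have a: "(\<Sum>j\<in>UNIV. \<Sum>k\<in>UNIV. \<Sum>i\<in>UNIV. pairing (Zbar i (w j k)) (x i j k)) = S"
    proof -
      have "(\<Sum>j\<in>UNIV. \<Sum>k\<in>UNIV. \<Sum>i\<in>UNIV. pairing (Zbar i (w j k)) (x i j k)) =
        (\<Sum>j\<in>UNIV. \<Sum>i\<in>UNIV. \<Sum>k\<in>UNIV. pairing (Zbar i (w j k)) (x i j k))"
        by (rule sum.cong[OF refl], rule sum.swap)
      also have "\<dots> = S" unfolding S_def by (rule sum.swap)
      finally show ?thesis .
    qed
    have b: "(\<Sum>j\<in>(UNIV::4 set). \<Sum>k\<in>UNIV. if j = 4 then pairing (w 4 k) (x 2 3 k) else 0) = T"
      by (simp add: T_def sum_4)
    have c: "(\<Sum>j\<in>UNIV. \<Sum>k\<in>(UNIV::4 set). if k = 4 then pairing (w j 4) (x 2 3 j) else 0) = - T"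
      by (simp add: T_def w4 sum_negf)
    show ?thesis unfolding pairing2_def r sum_subtractf sum.distrib a b c by (simp add: field_simps)
  qed
  finally show ?thesis .
qed

lemma pairing1_cnj: "pairing1 v u = cnj (pairing1 u v)" and pairing2_cnj: "pairing2 x w = cnj (pairing2 w x)"
  unfolding pairing1_def pairing2_def by (simp_all add: pairing_cnj[of "v _"] pairing_cnj[of "x _ _"])

lemma pairing3_cnj: "pairing3 x w = cnj (pairing3 w x)"
  unfolding pairing3_def by (simp add: pairing_cnj[of "x _ _ _"])

lemma pairing_self_real: "Im (pairing f f) = 0"
  using pairing_cnj[of f f] by (simp add: complex_eq_iff)

lemma pairing1_definite: assumes "admissible1 u" "pairing1 u u = 0" shows "u = (\<lambda>j z. 0)"
proof -
  have s: "smooth_invariant (u j)" for j using assms(1) by (simp add: admissible1_def)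
  have "(\<Sum>j\<in>UNIV. Re (pairing (u j) (u j))) = 0"
    using arg_cong[OF assms(2), of Re] by (simp add: pairing1_def)
  then have "Re (pairing (u j) (u j)) = 0" for j
    by (simp add: sum_nonneg_eq_0_iff pairing_self_nonneg[OF s])
  then show ?thesis
    using pairing_self_eq_0[OF s] by (auto simp: fun_eq_iff complex_eq_iff pairing_self_real)
qed

lemma pairing2_definite: assumes "admissible2 w" "pairing2 w w = 0" shows "w = (\<lambda>i j z. 0)"
proof -
  have s: "smooth_invariant (w i j)" for i j using assms(1) by (simp add: admissible2_def)
  have "(\<Sum>i\<in>UNIV. \<Sum>j\<in>UNIV. Re (pairing (w i j) (w i j))) = 0"
    using arg_cong[OF assms(2), of Re] by (simp add: pairing2_def)
  then have "Re (pairing (w i j) (w i j)) = 0" for i j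
    by (simp add: sum_nonneg_eq_0_iff sum_nonneg pairing_self_nonneg[OF s])
  then show ?thesis
    using pairing_self_eq_0[OF s] by (auto simp: fun_eq_iff complex_eq_iff pairing_self_real)
qed

lemma pairing1_diff_right: "admissible1 u \<Longrightarrow> admissible1 v \<Longrightarrow> admissible1 v' \<Longrightarrow> pairing1 u (\<lambda>j z. v j z - v' j z) = pairing1 u v - pairing1 u v'"
  unfolding pairing1_def admissible1_def by (simp add: pairing_diff_right sum_subtractf)

lemma pairing2_diff_right: "admissible2 u \<Longrightarrow> admissible2 v \<Longrightarrow> admissible2 v' \<Longrightarrow> pairing2 u (\<lambda>i j z. v i j z - v' i j z) = pairing2 u v - pairing2 u v'"
  unfolding pairing2_def admissible2_def by (simp add: pairing_diff_right sum_subtractf diff_divide_distrib)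

lemma pairing2_add_right: "admissible2 u \<Longrightarrow> admissible2 v \<Longrightarrow> admissible2 v' \<Longrightarrow> pairing2 u (\<lambda>i j z. v i j z + v' i j z) = pairing2 u v + pairing2 u v'"
  unfolding pairing2_def admissible2_def by (simp add: pairing_add_right sum.distrib add_divide_distrib)

lemma pairing1_ext:
  assumes "admissible1 v" "admissible1 v'" "\<And>u. admissible1 u \<Longrightarrow> pairing1 u v = pairing1 u v'" shows "v = v'"
proof -
  have o: "admissible1 (\<lambda>j z. v j z - v' j z)" using assms(1,2) by (simp add: admissible1_def smooth_invariant_diff)
  have "(\<lambda>j z. v j z - v' j z) = (\<lambda>j z. 0)"
    by (rule pairing1_definite[OF o]) (simp add: pairing1_diff_right[OF o assms(1,2)] assms(3)[OF o])
  then show ?thesis by (simp add: fun_eq_iff)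
qed

text \<open>The inner product is definite, so a form is determined by its products with all forms. This
  gives the uniqueness behind the definite description in \<open>dbar_star\<close>.\<close>

lemma pairing2_ext:
  assumes "admissible2 v" "admissible2 v'" "\<And>u. admissible2 u \<Longrightarrow> pairing2 u v = pairing2 u v'" shows "v = v'"
proof -
  have o: "admissible2 (\<lambda>i j z. v i j z - v' i j z)" using assms(1,2) by (rule admissible2_diff)
  have "(\<lambda>i j z. v i j z - v' i j z) = (\<lambda>i j z. 0)"
    by (rule pairing2_definite[OF o]) (simp add: pairing2_diff_right[OF o assms(1,2)] assms(3)[OF o])
  then show ?thesis by (simp add: fun_eq_iff)
qed

end

context solv_lattice
begin

section \<open>The Laplacian and the Green operator\<close>

lemma l2_inner_dbar1:
  assumes "admissible1 u" "admissible2 w" shows "l2_inner \<Gamma> 2 (dbar (form1 u)) (form2 w) = l2_inner \<Gamma> 1 (form1 u) (form1 (adj1 w))"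
proof -
  have "dbar (form1 u) = form2 (dbar1 u)" by (rule dbar_form1) (use assms in \<open>simp add: admissible1_def smooth_invariant_smooth\<close>)
  then show ?thesis
    by (simp only: l2_inner_form1 l2_inner_form2 adjoint1 admissible2_dbar1 admissible1_adj1 assms)
qed

lemma dbar_form2_admissible: "admissible2 w \<Longrightarrow> dbar (form2 w) = form3 (dbar2 w)"
  by (rule dbar_form2) (auto simp: admissible2_def smooth_invariant_smooth)

lemma form1_in_vforms: "admissible1 u \<Longrightarrow> form1 u \<in> vforms \<Gamma> 1" by (simp only: form1_vforms admissible1_def)
lemma form2_in_vforms: "admissible2 w \<Longrightarrow> form2 w \<in> vforms \<Gamma> 2" by (simp only: form2_vforms admissible2_def)

lemma vforms1E: assumes "\<omega> \<in> vforms \<Gamma> 1" obtains u where "admissible1 u" "\<omega> = form1 u"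
  using vforms1_eq_form1[OF assms] unfolding admissible1_def by blast
lemma vforms2E: assumes "\<omega> \<in> vforms \<Gamma> 2" obtains w where "admissible2 w" "\<omega> = form2 w"
  using vforms2_eq_form2[OF assms] unfolding admissible2_def by blast

lemma dbar_star_form2:
  assumes w: "admissible2 w" shows "dbar_star \<Gamma> 2 (form2 w) = form1 (adj1 w)"
proof -
  have "dbar_star \<Gamma> 2 (form2 w) = (THE \<alpha>. \<alpha> \<in> vforms \<Gamma> 1 \<and>
      (\<forall>\<gamma>\<in>vforms \<Gamma> 1. l2_inner \<Gamma> 2 (dbar \<gamma>) (form2 w) = l2_inner \<Gamma> 1 \<gamma> \<alpha>))"
    by (simp add: dbar_star_def)
  also have "\<dots> = form1 (adj1 w)"
  proof (rule the_equality, intro conjI ballI)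
    show "form1 (adj1 w) \<in> vforms \<Gamma> 1" by (rule form1_in_vforms[OF admissible1_adj1[OF w]])
    fix \<gamma> assume "\<gamma> \<in> vforms \<Gamma> 1"
    then obtain u where "admissible1 u" "\<gamma> = form1 u" by (rule vforms1E)
    then show "l2_inner \<Gamma> 2 (dbar \<gamma>) (form2 w) = l2_inner \<Gamma> 1 \<gamma> (form1 (adj1 w))"
      using l2_inner_dbar1 w by simp
  next
    fix \<alpha> assume a: "\<alpha> \<in> vforms \<Gamma> 1 \<and>
      (\<forall>\<gamma>\<in>vforms \<Gamma> 1. l2_inner \<Gamma> 2 (dbar \<gamma>) (form2 w) = l2_inner \<Gamma> 1 \<gamma> \<alpha>)"
    then obtain v where v: "admissible1 v" "\<alpha> = form1 v" using vforms1E by blast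
    have "v = adj1 w"
    proof (rule pairing1_ext[OF v(1) admissible1_adj1[OF w]])
      fix u assume u: "admissible1 u"
      have "l2_inner \<Gamma> 1 (form1 u) (form1 v) = l2_inner \<Gamma> 1 (form1 u) (form1 (adj1 w))"
        using a form1_in_vforms[OF u] l2_inner_dbar1[OF u w] v by metis
      then show "pairing1 u v = pairing1 u (adj1 w)" using l2_inner_form1 u v admissible1_adj1[OF w] by simp
    qed
    then show "\<alpha> = form1 (adj1 w)" using v by simp
  qed
  finally show ?thesis .
qed

lemma l2_inner_dbar2:
  assumes "admissible2 w" "admissible3 x" shows "l2_inner \<Gamma> 3 (dbar (form2 w)) (form3 x) = l2_inner \<Gamma> 2 (form2 w) (form2 (adj2 x))"
  by (simp only: dbar_form2_admissible l2_inner_form2 l2_inner_form3 adjoint2 admissible3_dbar2 admissible2_adj2 assms)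

lemma dbar_star_form3:
  assumes x: "admissible3 x" shows "dbar_star \<Gamma> 3 (form3 x) = form2 (adj2 x)"
proof -
  have "dbar_star \<Gamma> 3 (form3 x) = (THE \<alpha>. \<alpha> \<in> vforms \<Gamma> 2 \<and>
      (\<forall>\<gamma>\<in>vforms \<Gamma> 2. l2_inner \<Gamma> 3 (dbar \<gamma>) (form3 x) = l2_inner \<Gamma> 2 \<gamma> \<alpha>))"
    by (simp add: dbar_star_def)
  also have "\<dots> = form2 (adj2 x)"
  proof (rule the_equality, intro conjI ballI)
    show "form2 (adj2 x) \<in> vforms \<Gamma> 2" by (rule form2_in_vforms[OF admissible2_adj2[OF x]])
    fix \<gamma> assume "\<gamma> \<in> vforms \<Gamma> 2"
    then obtain u where "admissible2 u" "\<gamma> = form2 u" by (rule vforms2E)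
    then show "l2_inner \<Gamma> 3 (dbar \<gamma>) (form3 x) = l2_inner \<Gamma> 2 \<gamma> (form2 (adj2 x))"
      using l2_inner_dbar2 x by simp
  next
    fix \<alpha> assume a: "\<alpha> \<in> vforms \<Gamma> 2 \<and>
      (\<forall>\<gamma>\<in>vforms \<Gamma> 2. l2_inner \<Gamma> 3 (dbar \<gamma>) (form3 x) = l2_inner \<Gamma> 2 \<gamma> \<alpha>)"
    then obtain v where v: "admissible2 v" "\<alpha> = form2 v" using vforms2E by blast
    have "v = adj2 x"
    proof (rule pairing2_ext[OF v(1) admissible2_adj2[OF x]])
      fix u assume u: "admissible2 u"
      have "l2_inner \<Gamma> 2 (form2 u) (form2 v) = l2_inner \<Gamma> 2 (form2 u) (form2 (adj2 x))"
        using a form2_in_vforms[OF u] l2_inner_dbar2[OF u x] v by metis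
      then show "pairing2 u v = pairing2 u (adj2 x)" using l2_inner_form2 u v admissible2_adj2[OF x] by simp
    qed
    then show "\<alpha> = form2 (adj2 x)" using v by simp
  qed
  finally show ?thesis .
qed

definition laplacian_comps :: "(4 \<Rightarrow> 4 \<Rightarrow> complex^4 \<Rightarrow> complex^4) \<Rightarrow> 4 \<Rightarrow> 4 \<Rightarrow> complex^4 \<Rightarrow> complex^4" where
  "laplacian_comps w i j z = dbar1 (adj1 w) i j z + adj2 (dbar2 w) i j z"

lemma admissible2_laplacian_comps: "admissible2 w \<Longrightarrow> admissible2 (laplacian_comps w)"
  unfolding laplacian_comps_def[abs_def] by (intro admissible2_add admissible2_dbar1 admissible1_adj1 admissible2_adj2 admissible3_dbar2)

lemma laplacian_form2: assumes w: "admissible2 w" shows "laplacian \<Gamma> 2 (form2 w) = form2 (laplacian_comps w)"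
proof -
  have 3: "Suc 2 = (3::nat)" by simp
  have "dbar (form1 (adj1 w)) = form2 (dbar1 (adj1 w))"
    by (rule dbar_form1) (use admissible1_adj1[OF w] in \<open>simp add: admissible1_def smooth_invariant_smooth\<close>)
  then show ?thesis
    unfolding laplacian_def 3 dbar_star_form2[OF w] dbar_form2_admissible[OF w] dbar_star_form3[OF admissible3_dbar2[OF w]]
    by (simp add: laplacian_comps_def[abs_def] form2_add)
qed

lemma laplacian_comps_symmetric:
  assumes w: "admissible2 w" and h: "admissible2 h"
  shows "pairing2 (laplacian_comps w) h = pairing2 w (laplacian_comps h)"
proof -
  have eq: "pairing2 v (laplacian_comps h) = pairing1 (adj1 v) (adj1 h) + pairing3 (dbar2 v) (dbar2 h)" if v: "admissible2 v" and h: "admissible2 h" for v h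
  proof -
    have "pairing2 v (laplacian_comps h) = pairing2 v (dbar1 (adj1 h)) + pairing2 v (adj2 (dbar2 h))"
      unfolding laplacian_comps_def[abs_def]
      by (rule pairing2_add_right[OF v admissible2_dbar1[OF admissible1_adj1[OF h]] admissible2_adj2[OF admissible3_dbar2[OF h]]])
    moreover have "pairing2 v (dbar1 (adj1 h)) = pairing1 (adj1 v) (adj1 h)"
      using adjoint1[OF admissible1_adj1[OF h] v] pairing2_cnj[of v "dbar1 (adj1 h)"] pairing1_cnj[of "adj1 v" "adj1 h"] by simp
    moreover have "pairing2 v (adj2 (dbar2 h)) = pairing3 (dbar2 v) (dbar2 h)"
      by (rule adjoint2[OF v admissible3_dbar2[OF h], symmetric])
    ultimately show ?thesis by simp
  qed
  have "pairing2 (laplacian_comps w) h = cnj (pairing2 h (laplacian_comps w))" by (rule pairing2_cnj)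
  also have "\<dots> = cnj (pairing1 (adj1 h) (adj1 w)) + cnj (pairing3 (dbar2 h) (dbar2 w))" by (simp add: eq[OF h w])
  also have "\<dots> = pairing2 w (laplacian_comps h)"
    using eq[OF w h] pairing1_cnj[of "adj1 w" "adj1 h"] pairing3_cnj[of "dbar2 w" "dbar2 h"] by simp
  finally show ?thesis .
qed

text \<open>The Laplacian is symmetric for a definite product, hence linear.\<close>

lemma laplacian_comps_diff:
  assumes w: "admissible2 w" and v: "admissible2 v"
  shows "laplacian_comps (\<lambda>i j z. w i j z - v i j z) = (\<lambda>i j z. laplacian_comps w i j z - laplacian_comps v i j z)"
proof (rule pairing2_ext)
  show "admissible2 (laplacian_comps (\<lambda>i j z. w i j z - v i j z))" by (rule admissible2_laplacian_comps[OF admissible2_diff[OF w v]])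
  show "admissible2 (\<lambda>i j z. laplacian_comps w i j z - laplacian_comps v i j z)" by (rule admissible2_diff[OF admissible2_laplacian_comps[OF w] admissible2_laplacian_comps[OF v]])
  fix u assume u: "admissible2 u"
  show "pairing2 u (laplacian_comps (\<lambda>i j z. w i j z - v i j z)) = pairing2 u (\<lambda>i j z. laplacian_comps w i j z - laplacian_comps v i j z)"
    unfolding laplacian_comps_symmetric[OF u admissible2_diff[OF w v], symmetric]
      pairing2_diff_right[OF admissible2_laplacian_comps[OF u] w v] pairing2_diff_right[OF u admissible2_laplacian_comps[OF w] admissible2_laplacian_comps[OF v]]
      laplacian_comps_symmetric[OF u w] laplacian_comps_symmetric[OF u v] ..
qed

lemma harmonic_form2_iff: "admissible2 w \<Longrightarrow> form2 w \<in> harmonic \<Gamma> 2 \<longleftrightarrow> laplacian_comps w = (\<lambda>i j z. 0)"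
  unfolding harmonic_def by (simp add: laplacian_form2 form2_in_vforms form2_inj flip: form2_zero)

lemma harmonicE: assumes "\<eta> \<in> harmonic \<Gamma> 2" obtains h where "admissible2 h" "\<eta> = form2 h" "laplacian_comps h = (\<lambda>i j z. 0)"
proof -
  have "\<eta> \<in> vforms \<Gamma> 2" using assms by (simp add: harmonic_def)
  then obtain h where h: "admissible2 h" "\<eta> = form2 h" by (rule vforms2E)
  then show ?thesis using that assms harmonic_form2_iff by blast
qed

lemma pairing2_zero_right: "pairing2 u (\<lambda>i j z. 0) = 0"
  by (simp add: pairing2_def)

text \<open>If \<open>v\<close> is another candidate and \<open>\<delta> = v - b\<close>, then the Laplacian of \<open>\<delta>\<close> is a difference of
  harmonic forms. Being harmonic and in the image of the symmetric Laplacian, it is orthogonal to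
  itself and vanishes. So \<open>\<delta>\<close> is harmonic, but it is also orthogonal to the harmonic forms.\<close>

lemma green_form2:
  assumes a: "admissible2 a" and b: "admissible2 b" and image: "laplacian_comps b = b"
    and rest: "laplacian_comps (\<lambda>i j z. a i j z - b i j z) = (\<lambda>i j z. 0)"
  shows "green \<Gamma> 2 (form2 a) = form2 b"
  unfolding green_def
proof (rule the_equality, intro conjI ballI)
  show "form2 b \<in> vforms \<Gamma> 2" by (rule form2_in_vforms[OF b])
next
  fix \<eta> assume "\<eta> \<in> harmonic \<Gamma> 2"
  then obtain h where h: "admissible2 h" "\<eta> = form2 h" "laplacian_comps h = (\<lambda>i j z. 0)" by (rule harmonicE)
  have "pairing2 b h = pairing2 (laplacian_comps b) h" by (simp only: image)
  also have "\<dots> = 0" by (simp add: laplacian_comps_symmetric[OF b h(1)] h(3) pairing2_zero_right)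
  finally show "l2_inner \<Gamma> 2 (form2 b) \<eta> = 0" by (simp add: h l2_inner_form2 b)
next
  show "(\<lambda>z vs. form2 a z vs - laplacian \<Gamma> 2 (form2 b) z vs) \<in> harmonic \<Gamma> 2"
    unfolding laplacian_form2[OF b] image form2_diff[symmetric]
    by (simp add: harmonic_form2_iff[OF admissible2_diff[OF a b]] rest)
next
  fix \<beta> assume \<beta>: "\<beta> \<in> vforms \<Gamma> 2 \<and> (\<forall>\<eta>\<in>harmonic \<Gamma> 2. l2_inner \<Gamma> 2 \<beta> \<eta> = 0) \<and>
     (\<lambda>z vs. form2 a z vs - laplacian \<Gamma> 2 \<beta> z vs) \<in> harmonic \<Gamma> 2"
  then obtain v where v: "admissible2 v" "\<beta> = form2 v" using vforms2E by blast
  let ?\<delta> = "\<lambda>i j z. v i j z - b i j z"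
  have \<delta>: "admissible2 ?\<delta>" by (rule admissible2_diff[OF v(1) b])
  have L\<delta>: "admissible2 (laplacian_comps ?\<delta>)" by (rule admissible2_laplacian_comps[OF \<delta>])
  have r: "admissible2 (\<lambda>i j z. a i j z - laplacian_comps v i j z)" by (rule admissible2_diff[OF a admissible2_laplacian_comps[OF v(1)]])
  have "(\<lambda>z vs. form2 a z vs - laplacian \<Gamma> 2 \<beta> z vs) = form2 (\<lambda>i j z. a i j z - laplacian_comps v i j z)"
    unfolding v(2) laplacian_form2[OF v(1)] form2_diff ..
  then have hv: "laplacian_comps (\<lambda>i j z. a i j z - laplacian_comps v i j z) = (\<lambda>i j z. 0)"
    using \<beta> harmonic_form2_iff[OF r] by simp
  have ab: "admissible2 (\<lambda>i j z. a i j z - b i j z)" by (rule admissible2_diff[OF a b])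
  have "laplacian_comps (laplacian_comps ?\<delta>) = laplacian_comps (\<lambda>i j z. (a i j z - b i j z) - (a i j z - laplacian_comps v i j z))"
    by (simp add: laplacian_comps_diff[OF v(1) b] image)
  also have "\<dots> = (\<lambda>i j z. 0)"
    unfolding laplacian_comps_diff[OF ab r] hv rest by simp
  finally have LL: "laplacian_comps (laplacian_comps ?\<delta>) = (\<lambda>i j z. 0)" .
  have "pairing2 (laplacian_comps ?\<delta>) (laplacian_comps ?\<delta>) = 0"
    unfolding laplacian_comps_symmetric[OF \<delta> L\<delta>] LL by (rule pairing2_zero_right)
  then have L0: "laplacian_comps ?\<delta> = (\<lambda>i j z. 0)" by (rule pairing2_definite[OF L\<delta>])
  then have harm: "form2 ?\<delta> \<in> harmonic \<Gamma> 2" using harmonic_form2_iff[OF \<delta>] by simp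
  have "pairing2 v ?\<delta> = 0" using \<beta> harm l2_inner_form2[OF v(1) \<delta>] v(2) by simp
  moreover have "pairing2 b ?\<delta> = 0"
    using laplacian_comps_symmetric[OF b \<delta>] by (simp add: image L0 pairing2_zero_right)
  ultimately have "pairing2 ?\<delta> ?\<delta> = 0"
    using pairing2_diff_right[OF \<delta> v(1) b] pairing2_cnj[of ?\<delta> v] pairing2_cnj[of ?\<delta> b] by simp
  then have "?\<delta> = (\<lambda>i j z. 0)" by (rule pairing2_definite[OF \<delta>])
  then have "v = b" by (simp add: fun_eq_iff)
  then show "\<beta> = form2 b" using v by simp
qed

text \<open>For constant components \<open>theta 2 \<and> theta 3\<close> spans the exact and \<open>theta 1 \<and> theta 4\<close> the
  coexact part; the other four products are harmonic.\<close>

definition nonharmonic_part :: "(4 \<Rightarrow> 4 \<Rightarrow> complex^4) \<Rightarrow> 4 \<Rightarrow> 4 \<Rightarrow> complex^4" where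
  "nonharmonic_part b i j = (if {i, j} = {2, 3} \<or> {i, j} = {1, 4} then b i j else 0)"

lemma laplacian_comps_const:
  assumes b: "\<And>i j. b j i = - b i j"
  shows "laplacian_comps (\<lambda>i j z. b i j) = (\<lambda>i j z. nonharmonic_part b i j)"
proof (intro ext)
  fix i j z
  have b0: "b k k = 0" for k using b[of k k] by (simp add: vec_eq_iff)
  have b': "b 2 1 = - b 1 2" "b 3 1 = - b 1 3" "b 4 1 = - b 1 4" "b 3 2 = - b 2 3"
    "b 4 2 = - b 2 4" "b 4 3 = - b 3 4" by (rule b)+
  have "\<forall>i j. laplacian_comps (\<lambda>i j z. b i j) i j z = nonharmonic_part b i j"
  proof -
    have a: "adj1 (\<lambda>i j z. b i j) = (\<lambda>j z. if j = 4 then - b 2 3 else 0)"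
      by (auto simp: adj1_def fun_eq_iff)
    have d: "dbar2 (\<lambda>i j z. b i j) = (\<lambda>i j k z. - (struct_const i j *s b 4 k) + struct_const i k *s b 4 j - struct_const j k *s b 4 i)"
      by (auto simp: dbar2_def fun_eq_iff)
    show ?thesis
      unfolding laplacian_comps_def a d
      by (simp add: dbar1_def adj2_def forall_4 struct_const_def nonharmonic_part_def b0 b' doubleton_eq_iff)
  qed
  then show "laplacian_comps (\<lambda>i j z. b i j) i j z = nonharmonic_part b i j" by blast
qed

lemma admissible2_const: "(\<And>i j. b j i = - b i j) \<Longrightarrow> admissible2 (\<lambda>i j z. b i j)"
  unfolding admissible2_def alternating2_def using smooth_invariant_const by blast

text \<open>On the nonharmonic part the Laplacian is the identity, so the Green operator is the
  projection to that part. The adjoint of dbar kills the coexact product and sends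
  \<open>theta 2 \<and> theta 3\<close> to minus \<open>theta 4\<close>.\<close>

lemma dbar_star_green_const:
  assumes b: "\<And>i j. b j i = - b i j"
  shows "dbar_star \<Gamma> 2 (green \<Gamma> 2 (form2 (\<lambda>i j z. b i j))) = form1 (\<lambda>j z. if j = 4 then - b 2 3 else 0)"
proof -
  have e: "nonharmonic_part b j i = - nonharmonic_part b i j" for i j
    using b[of j i] by (simp add: nonharmonic_part_def insert_commute)
  have d: "b j i - nonharmonic_part b j i = - (b i j - nonharmonic_part b i j)" for i j
    using b[of j i] e[of i j] by simp
  have "green \<Gamma> 2 (form2 (\<lambda>i j z. b i j)) = form2 (\<lambda>i j z. nonharmonic_part b i j)"
  proof (rule green_form2)
    show "admissible2 (\<lambda>i j z. b i j)" by (rule admissible2_const[OF b])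
    show "admissible2 (\<lambda>i j z. nonharmonic_part b i j)" by (rule admissible2_const[OF e])
    show "laplacian_comps (\<lambda>i j z. nonharmonic_part b i j) = (\<lambda>i j z. nonharmonic_part b i j)"
      unfolding laplacian_comps_const[OF e] by (auto simp: nonharmonic_part_def fun_eq_iff)
    show "laplacian_comps (\<lambda>i j z. b i j - nonharmonic_part b i j) = (\<lambda>i j z. 0)"
      unfolding laplacian_comps_const[OF d] by (auto simp: nonharmonic_part_def fun_eq_iff)
  qed
  moreover have "adj1 (\<lambda>i j z. nonharmonic_part b i j) = (\<lambda>j z. if j = 4 then - b 2 3 else 0)"
    by (auto simp: adj1_def nonharmonic_part_def fun_eq_iff)
  ultimately show ?thesis by (simp only: dbar_star_form2[OF admissible2_const[OF e]])
qed

end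

section \<open>The bracket of forms with constant components\<close>

text \<open>The weights of the first frame vector on the forms \<open>theta\<close>.\<close>

definition weight :: "4 \<Rightarrow> complex" where
  "weight j = vector [0, 1, - 1, 0] $ j"

text \<open>The components, before antisymmetrization, of the derivative of the second form along the
  first: one term comes from the frame and one from \<open>theta\<close>.\<close>

definition half_bracket :: "(4 \<Rightarrow> complex^4) \<Rightarrow> (4 \<Rightarrow> complex^4) \<Rightarrow> 4 \<Rightarrow> 4 \<Rightarrow> complex^4" where
  "half_bracket u u' i j = lact_deriv (u i) (u' j) + (u i $ 1 * weight j) *s u' j"

definition bracket_comps :: "(4 \<Rightarrow> complex^4) \<Rightarrow> (4 \<Rightarrow> complex^4) \<Rightarrow> 4 \<Rightarrow> 4 \<Rightarrow> complex^4" where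
  "bracket_comps u u' i j = half_bracket u u' i j - half_bracket u u' j i + half_bracket u' u i j - half_bracket u' u j i"

lemma D10_form1_const:
  "D10 (\<lambda>x. form1 (\<lambda>j z. u' j) x [b]) z (form1 (\<lambda>j z. u j) z [a]) =
     lact z (\<Sum>i\<in>UNIV. \<Sum>j\<in>UNIV. (theta i z a * theta j z b) *s half_bracket u u' i j)"
proof -
  define \<xi> where "\<xi> = (\<Sum>i\<in>UNIV. theta i z a *s u i)"
  have s: "smooth (\<lambda>x. theta j x b *s u' j)" for j by (intro smooth_intros)
  have \<xi>1: "lact z \<xi> $ 1 = \<xi> $ 1" by (simp add: lact_def)
  have "D10 (\<lambda>x. form1 (\<lambda>j z. u' j) x [b]) z (lact z \<xi>) =
     lact z (lact_deriv \<xi> (\<Sum>j\<in>UNIV. theta j z b *s u' j) + (\<Sum>j\<in>UNIV. theta_d10 j z b (lact z \<xi>) *s u' j))"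
    unfolding form1_Cons D10_lact[OF smooth_sum[OF s]] D10_sum[OF s] D10_theta_smult[OF smooth_const]
    by simp
  also have "lact_deriv \<xi> (\<Sum>j\<in>UNIV. theta j z b *s u' j) + (\<Sum>j\<in>UNIV. theta_d10 j z b (lact z \<xi>) *s u' j) =
     (\<Sum>i\<in>UNIV. \<Sum>j\<in>UNIV. (theta i z a * theta j z b) *s half_bracket u u' i j)"
    unfolding theta_d10_def \<xi>1
    by (simp add: \<xi>_def sum_4 half_bracket_def lact_deriv_def weight_def vec_eq_iff forall_4 field_simps)
  finally show ?thesis by (simp add: \<xi>_def)
qed

lemma bracket_form1_const:
  "bracket (form1 (\<lambda>j z. u j)) (form1 (\<lambda>j z. u' j)) = form2 (\<lambda>i j z. bracket_comps u u' i j)"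
proof (intro ext)
  fix z vs
  show "bracket (form1 (\<lambda>j z. u j)) (form1 (\<lambda>j z. u' j)) z vs = form2 (\<lambda>i j z. bracket_comps u u' i j) z vs"
  proof (cases "length vs = 2")
    case False
    then show ?thesis by (auto simp: bracket_def form2_other split: list.split)
  next
    case True
    then obtain a b where vs: "vs = [a, b]" using length2E by blast
    have sw: "(\<Sum>i\<in>UNIV. \<Sum>j\<in>UNIV. (theta i z b * theta j z a) *s half_bracket v v' i j) =
       (\<Sum>i\<in>UNIV. \<Sum>j\<in>UNIV. (theta i z a * theta j z b) *s half_bracket v v' j i)" for v v'
      by (subst sum.swap) (simp add: mult.commute)
    show ?thesis
      unfolding vs bracket_def list.case D10_form1_const sw form2_Cons bracket_comps_def
      by (simp add: lact_add[symmetric] lact_diff[symmetric] vector_add_ldistrib vector_ssub_ldistrib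
          sum.distrib sum_subtractf)
  qed
qed

lemma bracket_comps_antisym: "bracket_comps u u' j i = - bracket_comps u u' i j"
  by (simp add: bracket_comps_def)

lemma form2_sum: "finite A \<Longrightarrow> form2 (\<lambda>i j z. \<Sum>k\<in>A. w k i j z) = (\<lambda>z vs. \<Sum>k\<in>A. form2 (w k) z vs)"
  by (induction A rule: finite_induct) (simp_all add: form2_zero form2_add)

lemma form2_scaleR: "form2 (\<lambda>i j z. r *\<^sub>R w i j z) = (\<lambda>z vs. r *\<^sub>R form2 w z vs)"
  by (intro ext) (simp add: form2_def scaleR_eq_smult vector_smult_assoc mult.commute[of "theta _ _ _ * theta _ _ _"]
      lact_sum lact_smult smult_sum split: list.split)

section \<open>The Kuranishi series\<close>

text \<open>The components of the terms of degree one and two, of the term of degree \<open>k\<close>, and of the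
  sum of the series.\<close>

definition first_comps :: "complex^3^4 \<Rightarrow> 4 \<Rightarrow> complex^4" where
  "first_comps t j = vector [\<chi> i. t $ i $ 1, \<chi> i. t $ i $ 2, \<chi> i. t $ i $ 3, 0] $ j"

definition second_comps :: "complex^3^4 \<Rightarrow> complex^4" where
  "second_comps t = - ((1/2) *\<^sub>R bracket_comps (first_comps t) (first_comps t) 2 3)"

definition term_comps :: "complex^3^4 \<Rightarrow> nat \<Rightarrow> 4 \<Rightarrow> complex^4" where
  "term_comps t k = (if k = 1 then first_comps t else if k = 2 then (\<lambda>j. if j = 4 then second_comps t else 0) else (\<lambda>j. 0))"

definition total_comps :: "complex^3^4 \<Rightarrow> 4 \<Rightarrow> complex^4" where
  "total_comps t j = (if j = 4 then second_comps t else first_comps t j)"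

lemma total_comps_eq: "total_comps t j = term_comps t 1 j + term_comps t 2 j"
  by (simp add: total_comps_def term_comps_def first_comps_def)

lemma psi1_eq_form1: "psi1 t = form1 (\<lambda>j z. first_comps t j)"
proof (intro ext)
  fix z vs
  show "psi1 t z vs = form1 (\<lambda>j z. first_comps t j) z vs"
  proof (cases "length vs = 1")
    case False
    then have "tensor \<alpha> X z vs = 0" for \<alpha> X by (auto simp: tensor_def split: list.split)
    then show ?thesis using False by (simp add: psi1_def form1_other)
  next
    case True
    then obtain a where vs: "vs = [a]" using length1E by blast
    have t: "tilde_form 1 z a = theta 1 z a" "tilde_form 2 z a = theta 2 z a" "tilde_form 3 z a = theta 3 z a"
      by (simp_all add: tilde_form_def theta_def vector_3 coframe_def exp_cnj exp_diff exp_minus field_simps)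
    show ?thesis
      by (simp add: vs psi1_def tensor_def t sum_3 sum_4 lact_eq_frame first_comps_def)
         (simp add: vec_eq_iff algebra_simps)
  qed
qed

lemma form1_zero: "form1 (\<lambda>j z. 0) = (\<lambda>z vs. 0)"
  by (intro ext) (simp add: form1_def split: list.split)

context solv_lattice
begin

text \<open>Only the \<open>theta 2 \<and> theta 3\<close> component of a bracket survives the recursion. The term of
  degree two is a multiple of \<open>theta 4\<close>, and a bracket with such a form has no
  \<open>theta 2 \<and> theta 3\<close> component. Hence the series stops after degree two.\<close>

lemma kuranishi_term_eq: "kuranishi_term \<Gamma> (psi1 t) k = form1 (\<lambda>j z. term_comps t k j)"
proof (induction k rule: less_induct)
  case (less k)
  consider "k = 0" | "k = 1" | "k \<ge> 2" by linarith
  then show ?case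
  proof cases
    case 1
    then show ?thesis by (simp add: kuranishi_term.simps term_comps_def form1_zero)
  next
    case 2
    then show ?thesis by (simp add: kuranishi_term.simps term_comps_def psi1_eq_form1)
  next
    case 3
    let ?b = "\<lambda>i j. \<Sum>l\<in>{1..<k}. bracket_comps (term_comps t l) (term_comps t (k - l)) i j"
    have br: "(\<lambda>x us. \<Sum>j\<in>{1..<k}. bracket (kuranishi_term \<Gamma> (psi1 t) j) (kuranishi_term \<Gamma> (psi1 t) (k - j)) x us)
        = form2 (\<lambda>i j z. ?b i j)"
    proof -
      have "bracket (kuranishi_term \<Gamma> (psi1 t) l) (kuranishi_term \<Gamma> (psi1 t) (k - l)) =
          form2 (\<lambda>i j z. bracket_comps (term_comps t l) (term_comps t (k - l)) i j)" if "l \<in> {1..<k}" for l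
      proof -
        have "l < k" "k - l < k" using that by auto
        then show ?thesis by (simp only: less.IH bracket_form1_const)
      qed
      then have "(\<lambda>x us. \<Sum>j\<in>{1..<k}. bracket (kuranishi_term \<Gamma> (psi1 t) j) (kuranishi_term \<Gamma> (psi1 t) (k - j)) x us) =
         (\<lambda>x us. \<Sum>l\<in>{1..<k}. form2 (\<lambda>i j z. bracket_comps (term_comps t l) (term_comps t (k - l)) i j) x us)"
        by (intro ext sum.cong refl) simp
      also have "\<dots> = form2 (\<lambda>i j z. ?b i j)" by (rule form2_sum[symmetric]) simp
      finally show ?thesis .
    qed
    have anti: "?b j i = - ?b i j" for i j
      unfolding sum_negf[symmetric] by (intro sum.cong refl bracket_comps_antisym)
    have g: "dbar_star \<Gamma> 2 (green \<Gamma> 2 (form2 (\<lambda>i j z. ?b i j))) = form1 (\<lambda>j z. if j = 4 then - ?b 2 3 else 0)"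
      by (rule dbar_star_green_const[OF anti])
    have "kuranishi_term \<Gamma> (psi1 t) k =
        (\<lambda>z vs. (1/2) *\<^sub>R form1 (\<lambda>j z. if j = 4 then - ?b 2 3 else 0) z vs)"
      unfolding kuranishi_term.simps[of \<Gamma> "psi1 t" k] br g using 3 by simp
    also have "\<dots> = form1 (\<lambda>j z. (1/2) *\<^sub>R (if j = 4 then - ?b 2 3 else 0))"
      by (rule form1_scaleR[symmetric])
    also have "(\<lambda>j (z::complex^4). (1/2) *\<^sub>R (if j = 4 then - ?b 2 3 else 0)) = (\<lambda>j z. term_comps t k j)"
    proof (cases "k = 2")
      case True
      have "{1..<2} = {1::nat}" by auto
      then show ?thesis by (auto simp: True term_comps_def second_comps_def fun_eq_iff)
    next
      case False
      have "bracket_comps (term_comps t l) (term_comps t (k - l)) 2 3 = 0" if "l \<in> {1..<k}" for l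
      proof -
        have z: "term_comps t m 2 = 0 \<and> term_comps t m 3 = 0" if "m \<ge> 2" for m
          using that by (simp add: term_comps_def)
        have l0: "lact_deriv 0 f = 0" "lact_deriv f 0 = 0" for f
          by (simp_all add: lact_deriv_def vec_eq_iff forall_4)
        have "l \<ge> 2 \<or> k - l \<ge> 2" using that 3 False by auto
        then show ?thesis using z[of l] z[of "k - l"] by (auto simp: bracket_comps_def half_bracket_def l0)
      qed
      then have b0: "?b 2 3 = 0" by simp
      show ?thesis unfolding b0 using 3 False by (simp add: term_comps_def fun_eq_iff)
    qed
    finally show ?thesis .
  qed
qed

lemma kuranishi_term_sums: "(\<lambda>k. kuranishi_term \<Gamma> (psi1 t) k z vs) sums form1 (\<lambda>j z. total_comps t j) z vs"
proof -
  have "(\<lambda>k. kuranishi_term \<Gamma> (psi1 t) k z vs) sums (\<Sum>k\<in>{1,2}. kuranishi_term \<Gamma> (psi1 t) k z vs)"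
    by (rule sums_finite) (auto simp: kuranishi_term_eq term_comps_def form1_zero)
  then show ?thesis
    by (simp add: kuranishi_term_eq total_comps_eq form1_add)
qed

lemma kuranishi_sum_eq: "kuranishi_sum \<Gamma> t = form1 (\<lambda>j z. total_comps t j)"
  by (intro ext) (simp add: kuranishi_sum_def sums_unique[OF kuranishi_term_sums, symmetric])

lemma maurer_cartan_form1_const:
  "maurer_cartan (form1 (\<lambda>j z. v j)) \<longleftrightarrow>
     (\<forall>i j. - (struct_const i j *s v 4) = half_bracket v v i j - half_bracket v v j i)"
proof -
  have d: "dbar (form1 (\<lambda>j z. v j)) = form2 (\<lambda>i j z. - (struct_const i j *s v 4))"
    by (subst dbar_form1) (auto simp: dbar1_def[abs_def] smooth_const)
  have "maurer_cartan (form1 (\<lambda>j z. v j)) \<longleftrightarrow>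
     form2 (\<lambda>i j z. - (struct_const i j *s v 4) - (1/2) *\<^sub>R bracket_comps v v i j) = form2 (\<lambda>i j z. 0)"
    unfolding maurer_cartan_def d bracket_form1_const form2_diff form2_scaleR form2_zero by (auto simp: fun_eq_iff)
  also have "\<dots> \<longleftrightarrow> (\<forall>i j. - (struct_const i j *s v 4) - (1/2) *\<^sub>R bracket_comps v v i j = 0)"
    unfolding form2_inj by (auto simp: fun_eq_iff)
  also have "(\<lambda>i j. (1/2) *\<^sub>R bracket_comps v v i j) = (\<lambda>i j. half_bracket v v i j - half_bracket v v j i)"
    by (auto simp: bracket_comps_def fun_eq_iff vec_eq_iff scaleR_conv_of_real[where 'a=complex])
  then have "(1/2) *\<^sub>R bracket_comps v v i j = half_bracket v v i j - half_bracket v v j i" for i j by meson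
  then have "(\<forall>i j. - (struct_const i j *s v 4) - (1/2) *\<^sub>R bracket_comps v v i j = 0) \<longleftrightarrow>
     (\<forall>i j. - (struct_const i j *s v 4) = half_bracket v v i j - half_bracket v v j i)"
    by simp
  finally show ?thesis .
qed

lemma kuranishi_space_iff:
  "t \<in> kuranishi_space \<Gamma> \<longleftrightarrow> maurer_cartan (form1 (\<lambda>j z. total_comps t j))"
proof -
  have "form1 (\<lambda>j z. total_comps t j) \<in> vforms \<Gamma> 1"
    by (rule form1_in_vforms) (simp add: admissible1_def smooth_invariant_const)
  then show ?thesis
    unfolding kuranishi_space_def kuranishi_sum_eq
    using kuranishi_term_sums sums_summable by blast
qed

end

lemma second_comps_nth:
  "second_comps t $ 1 = 2 * t$1$2 * t$1$3" "second_comps t $ 2 = 2 * t$1$2 * t$2$3"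
  "second_comps t $ 3 = 2 * t$1$3 * t$3$2"
  "second_comps t $ 4 = - (t$2$2) * t$3$3 + t$1$2 * t$4$3 + t$1$3 * t$4$2 + t$2$3 * t$3$2"
  by (simp_all add: second_comps_def bracket_comps_def half_bracket_def lact_deriv_def weight_def first_comps_def
      scaleR_conv_of_real[where 'a=complex] field_simps)

section \<open>The Maurer-Cartan equations\<close>

lemma total_comps_simps: "total_comps t 1 = (\<chi> i. t $ i $ 1)" "total_comps t 2 = (\<chi> i. t $ i $ 2)"
  "total_comps t 3 = (\<chi> i. t $ i $ 3)" "total_comps t 4 = second_comps t"
  by (simp_all add: total_comps_def first_comps_def)

lemma half_bracket_eq: "half_bracket v v i j - half_bracket v v j i = vector
   [v i $ 1 * weight j * v j $ 1 - v j $ 1 * weight i * v i $ 1,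
    - (v i $ 1) * v j $ 2 + v i $ 1 * weight j * v j $ 2 + v j $ 1 * v i $ 2 - v j $ 1 * weight i * v i $ 2,
    v i $ 1 * v j $ 3 + v i $ 1 * weight j * v j $ 3 - v j $ 1 * v i $ 3 - v j $ 1 * weight i * v i $ 3,
    v i $ 2 * v j $ 3 - v i $ 3 * v j $ 2 + v i $ 1 * weight j * v j $ 4 - v j $ 1 * weight i * v i $ 4]"
  by (simp add: half_bracket_def lact_deriv_def vec_eq_iff forall_4 field_simps)

lemma all_pairs:
  assumes "\<And>i j. R i j \<longleftrightarrow> R j i" "\<And>i::4. R i i"
  shows "(\<forall>i j. R i j) \<longleftrightarrow> R 1 2 \<and> R 1 3 \<and> R 1 4 \<and> R 2 3 \<and> R 2 4 \<and> R 3 4"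
  unfolding forall_4 using assms by blast

text \<open>The pairs of indices 12 and 13 give eight of the quadratic equations, and the pair 23 holds
  by the choice of the second term. The pairs 24 and 34 give cubic equations such as
  \<open>2 * (t$1$2)\<^sup>2 * t$1$3 = 0\<close>. They force the first three components of the second term to vanish,
  which is the content of the remaining three quadratic equations; conversely, once these
  components vanish, the pairs 14, 24 and 34 hold trivially.\<close>

lemma maurer_cartan_equations:
  fixes t :: "complex^3^4"
  defines "v \<equiv> total_comps t"
  shows "(\<forall>i j. - (struct_const i j *s v 4) = half_bracket v v i j - half_bracket v v j i) \<longleftrightarrow>
       t$1$1 * t$1$2 = 0 \<and>
       t$1$1 * t$1$3 = 0 \<and>
       t$1$2 * t$2$1 = 0 \<and>
       t$2$1 * t$1$3 - 2 * t$1$1 * t$2$3 = 0 \<and>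
       2 * t$1$1 * t$3$2 - t$3$1 * t$1$2 = 0 \<and>
       t$1$3 * t$3$1 = 0 \<and>
       t$1$2 * t$1$3 = 0 \<and>
       t$1$2 * t$2$3 = 0 \<and>
       t$1$3 * t$3$2 = 0 \<and>
       t$1$1 * t$4$2 + t$2$1 * t$3$2 - t$3$1 * t$2$2 = 0 \<and>
       t$2$1 * t$3$3 - t$1$1 * t$4$3 - t$3$1 * t$2$3 = 0" (is "?L \<longleftrightarrow> ?R")
proof -
  let ?E = "\<lambda>i j. - (struct_const i j *s v 4) = half_bracket v v i j - half_bracket v v j i"
  have "?E i j \<longleftrightarrow> ?E j i" for i j
    unfolding struct_const_swap[of j i] by (auto simp: vec_eq_iff) (metis minus_diff_eq minus_minus)+
  moreover have "?E i i" for i using struct_const_swap[of i i] by simp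
  ultimately have "?L \<longleftrightarrow> ?E 1 2 \<and> ?E 1 3 \<and> ?E 1 4 \<and> ?E 2 3 \<and> ?E 2 4 \<and> ?E 3 4"
    by (rule all_pairs)
  also have "?E 2 3 \<longleftrightarrow> True"
    by (simp add: struct_const_def v_def total_comps_simps half_bracket_eq weight_def vec_eq_iff forall_4 second_comps_nth)
  also have "?E 1 2 \<longleftrightarrow> t$1$1 * t$1$2 = 0 \<and> t$1$2 * t$2$1 = 0 \<and> 2 * t$1$1 * t$3$2 - t$3$1 * t$1$2 = 0 \<and>
      t$1$1 * t$4$2 + t$2$1 * t$3$2 - t$3$1 * t$2$2 = 0"
    by (auto simp add: struct_const_def v_def total_comps_simps half_bracket_eq weight_def vec_eq_iff forall_4 algebra_simps)
  also have "?E 1 3 \<longleftrightarrow> t$1$1 * t$1$3 = 0 \<and> t$2$1 * t$1$3 - 2 * t$1$1 * t$2$3 = 0 \<and> t$1$3 * t$3$1 = 0 \<and>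
       t$2$1 * t$3$3 - t$1$1 * t$4$3 - t$3$1 * t$2$3 = 0"
    by (auto simp add: struct_const_def v_def total_comps_simps half_bracket_eq weight_def vec_eq_iff forall_4 algebra_simps)
  finally have eq: "?L \<longleftrightarrow> (t$1$1 * t$1$2 = 0 \<and> t$1$2 * t$2$1 = 0 \<and> 2 * t$1$1 * t$3$2 - t$3$1 * t$1$2 = 0 \<and>
      t$1$1 * t$4$2 + t$2$1 * t$3$2 - t$3$1 * t$2$2 = 0) \<and>
      (t$1$1 * t$1$3 = 0 \<and> t$2$1 * t$1$3 - 2 * t$1$1 * t$2$3 = 0 \<and> t$1$3 * t$3$1 = 0 \<and>
       t$2$1 * t$3$3 - t$1$1 * t$4$3 - t$3$1 * t$2$3 = 0) \<and> ?E 1 4 \<and> True \<and> ?E 2 4 \<and> ?E 3 4" .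
  have 24: "t$1$2 * t$1$3 = 0 \<and> t$1$2 * t$2$3 = 0" if "?E 2 4"
  proof -
    have "(- (struct_const 2 4 *s v 4)) $ i = (half_bracket v v 2 4 - half_bracket v v 4 2) $ i" for i using that by simp
    from this[of 1] this[of 2] show ?thesis
      by (auto simp: struct_const_def v_def total_comps_simps half_bracket_eq weight_def second_comps_nth)
  qed
  have 34: "t$1$3 * t$3$2 = 0" if "?E 3 4" "t$1$2 * t$1$3 = 0"
  proof -
    have "(- (struct_const 3 4 *s v 4)) $ 3 = (half_bracket v v 3 4 - half_bracket v v 4 3) $ 3" using that by simp
    then show ?thesis using that(2)
      by (auto simp: struct_const_def v_def total_comps_simps half_bracket_eq weight_def second_comps_nth)
  qed
  have rest: "?E 1 4" "?E 2 4" "?E 3 4"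
    if "t$1$2 * t$1$3 = 0" "t$1$2 * t$2$3 = 0" "t$1$3 * t$3$2 = 0"
    using that
    by (auto simp add: struct_const_def v_def total_comps_simps half_bracket_eq weight_def vec_eq_iff forall_4 second_comps_nth)
  show ?thesis unfolding eq using 24 34 rest by blast
qed

lemma tensor_coframe4:
  assumes "v = (\<lambda>j. if j = 4 then c *s axis 4 1 else 0)"
  shows "form1 (\<lambda>j z. v j) = (\<lambda>z vs. c *s tensor (\<lambda>x v. cnj (coframe 4 x v)) (frame 4) z vs)"
proof (intro ext)
  fix z vs
  have "theta 4 z a = cnj (coframe 4 z a)" for a by (simp add: theta_def coframe_def)
  then show "form1 (\<lambda>j z. v j) z vs = c *s tensor (\<lambda>x v. cnj (coframe 4 x v)) (frame 4) z vs"
    by (auto simp: form1_def tensor_def assms sum_4 lact_smult vector_smult_assoc mult.commute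
        frame_eq_lact[of 4] split: list.split)
qed

theorem mainTheorem5:
  fixes \<Gamma> :: "(complex^4) set"
  assumes lattice: "cocompact_lattice \<Gamma>"
    and unit_character: "\<forall>y\<in>\<Gamma>. exp (y$1 - cnj (y$1)) = 1"
  shows "\<forall>\<^sub>F t :: complex^3^4 in nhds 0.
    (t \<in> kuranishi_space \<Gamma> \<longleftrightarrow>
       t$1$1 * t$1$2 = 0 \<and>
       t$1$1 * t$1$3 = 0 \<and>
       t$1$2 * t$2$1 = 0 \<and>
       t$2$1 * t$1$3 - 2 * t$1$1 * t$2$3 = 0 \<and>
       2 * t$1$1 * t$3$2 - t$3$1 * t$1$2 = 0 \<and>
       t$1$3 * t$3$1 = 0 \<and>
       t$1$2 * t$1$3 = 0 \<and>
       t$1$2 * t$2$3 = 0 \<and>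
       t$1$3 * t$3$2 = 0 \<and>
       t$1$1 * t$4$2 + t$2$1 * t$3$2 - t$3$1 * t$2$2 = 0 \<and>
       t$2$1 * t$3$3 - t$1$1 * t$4$3 - t$3$1 * t$2$3 = 0) \<and>
    (t \<in> kuranishi_space \<Gamma> \<longrightarrow>
       kuranishi_sum \<Gamma> t = (\<lambda>z vs.
         (\<Sum>l\<in>UNIV. \<Sum>i\<in>UNIV. t $ i $ l *s tensor (tilde_form l) (frame i) z vs)
         + (- (t$2$2) * t$3$3 + t$1$2 * t$4$3 + t$1$3 * t$4$2 + t$2$3 * t$3$2)
             *s tensor (\<lambda>x v. cnj (coframe 4 x v)) (frame 4) z vs))"
proof (intro always_eventually allI conjI impI)
  fix t :: "complex^3^4"
  interpret solv_lattice \<Gamma> by unfold_locales (fact assms)+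
  show iff: "t \<in> kuranishi_space \<Gamma> \<longleftrightarrow>
       t$1$1 * t$1$2 = 0 \<and>
       t$1$1 * t$1$3 = 0 \<and>
       t$1$2 * t$2$1 = 0 \<and>
       t$2$1 * t$1$3 - 2 * t$1$1 * t$2$3 = 0 \<and>
       2 * t$1$1 * t$3$2 - t$3$1 * t$1$2 = 0 \<and>
       t$1$3 * t$3$1 = 0 \<and>
       t$1$2 * t$1$3 = 0 \<and>
       t$1$2 * t$2$3 = 0 \<and>
       t$1$3 * t$3$2 = 0 \<and>
       t$1$1 * t$4$2 + t$2$1 * t$3$2 - t$3$1 * t$2$2 = 0 \<and>
       t$2$1 * t$3$3 - t$1$1 * t$4$3 - t$3$1 * t$2$3 = 0"
    unfolding kuranishi_space_iff maurer_cartan_form1_const by (rule maurer_cartan_equations)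
  let ?c = "- (t$2$2) * t$3$3 + t$1$2 * t$4$3 + t$1$3 * t$4$2 + t$2$3 * t$3$2"
  assume "t \<in> kuranishi_space \<Gamma>"
  then have z: "t$1$2 * t$1$3 = 0" "t$1$2 * t$2$3 = 0" "t$1$3 * t$3$2 = 0" unfolding iff by blast+
  have sc: "second_comps t = ?c *s axis 4 1"
    unfolding vec_eq_iff forall_4 second_comps_nth using z by simp
  then have two: "term_comps t 2 = (\<lambda>j. if j = 4 then ?c *s axis 4 1 else 0)"
    unfolding term_comps_def sc by simp
  have "kuranishi_sum \<Gamma> t = (\<lambda>z vs. form1 (\<lambda>j z. term_comps t 1 j) z vs + form1 (\<lambda>j z. term_comps t 2 j) z vs)"
    unfolding kuranishi_sum_eq total_comps_eq form1_add ..
  also have "form1 (\<lambda>j z. term_comps t 1 j) = psi1 t" by (simp add: term_comps_def psi1_eq_form1)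
  also have "form1 (\<lambda>j z. term_comps t 2 j) = (\<lambda>z vs. ?c *s tensor (\<lambda>x v. cnj (coframe 4 x v)) (frame 4) z vs)"
    by (rule tensor_coframe4[OF two])
  finally show "kuranishi_sum \<Gamma> t = (\<lambda>z vs.
         (\<Sum>l\<in>UNIV. \<Sum>i\<in>UNIV. t $ i $ l *s tensor (tilde_form l) (frame i) z vs)
         + ?c *s tensor (\<lambda>x v. cnj (coframe 4 x v)) (frame 4) z vs)"
    unfolding psi1_def .
qed

end
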